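(* Let $(Q,N,C_1,\dots,C_N)$ be a random vector with $N\in\{0,1,2,\dots\}\cup\{\infty\}$, $C_i\ge 0$ for all $i$, and $P(|Q|>0)>0$; let $Z_N=\sum_{i=1}^N C_i$. Suppose $P(Q>x)\in\mathcal{R}_{-\alpha}$ with $\alpha>1$, and $E[|Q|^\beta]<\infty$ for all $0<\beta<\alpha$. Assume $\rho\vee\rho_\alpha<1$, and $E[Z_N^{\alpha+\epsilon}]<\infty$ for some $\epsilon>0$. Then $$P(R>x)\sim(1-\rho_\alpha)^{-1}P(Q>x)\qquad\text{as }x\to\infty,$$ where $R=\sum_{n=0}^\infty W_n$ is the random variable constructed on the weighted branching tree.
   Context: The components of $(Q,N,C_1,\dots,C_N)$ may be arbitrarily dependent, and $Q$ is real-valued. When $N=\infty$, sums $\sum_{i=1}^N$ run over all $i\ge1$. Weighted branching tree: let $U=\bigcup_{k\ge0}\{1,2,3,\dots\}^k$ be the set of finite sequences of positive integers, with $\emptyset$ the empty sequence (root); for $\mathbf{i}=(i_1,\dots,i_n)\in U$ write $(\mathbf{i},j)=(i_1,\dots,i_n,j)$. To each node $\mathbf{i}$ assign an i.i.d. copy $(Q_{\mathbf i},N_{\mathbf i},C_{(\mathbf i,1)},\dots,C_{(\mathbf i,N_{\mathbf i})})$ of $(Q,N,C_1,\dots,C_N)$, the root's vector being $(Q,N,C_1,\dots,C_N)$ itself. Let $A_0=\{\emptyset\}$ and $A_n=\{(\mathbf i,j):\mathbf i\in A_{n-1},\ 1\le j<N_{\mathbf i}+1\}$ for $n\ge1$ (the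 $n$th generation). Set $\Pi_\emptyset=1$ and $\Pi_{(\mathbf i,j)}=C_{(\mathbf i,j)}\Pi_{\mathbf i}$. Define $W_n=\sum_{\mathbf i\in A_n}Q_{\mathbf i}\Pi_{\mathbf i}$ for $n\ge0$ (so $W_0=Q$) and $R=\sum_{n=0}^\infty W_n$. Notation: $\rho_\beta=E\left[\sum_{i=1}^N C_i^\beta\right]$ for $\beta>0$, $\rho=\rho_1$, $x\vee y=\max\{x,y\}$. $f(x)\sim g(x)$ means $\lim_{x\to\infty}f(x)/g(x)=1$. $f\in\mathcal{R}_{-\alpha}$ means $f(x)=x^{-\alpha}L(x)$ for some slowly varying $L$, i.e. $L:[0,\infty)\to(0,\infty)$ with $\lim_{x\to\infty}L(\lambda x)/L(x)=1$ for every $\lambda>0$. *)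

theory Defs
  imports "HOL-Probability.Probability" "HOL-Library.Landau_Symbols"
begin

definition slowly_varying :: "(real \<Rightarrow> real) \<Rightarrow> bool" where
  "slowly_varying L \<longleftrightarrow>
     (\<forall>x\<ge>0. L x > 0) \<and> (\<forall>c>0. ((\<lambda>x. L (c * x) / L x) \<longlongrightarrow> 1) at_top)"

text \<open>The class $\mathcal{R}_a$; the argument \<open>a\<close> is the exponent itself, so it is negative for a
  decaying tail. The point \<open>x = 0\<close> is left out because \<open>0 powr a = 0\<close> in HOL.\<close>

definition regularly_varying :: "real \<Rightarrow> (real \<Rightarrow> real) set" where
  "regularly_varying a = {f. \<exists>L. slowly_varying L \<and> (\<forall>x>0. f x = x powr a * L x)}"

text \<open>Components are indexed from \<open>1\<close>. Of a vector $(Q,N,C_1,\dots,C_N)$ only the components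
  \<open>C j\<close> with \<open>j \<in> offspring N\<close> are meaningful; the values of \<open>C\<close> elsewhere are junk and never used.\<close>

definition offspring :: "enat \<Rightarrow> nat set" where
  "offspring n = {j. 1 \<le> j \<and> enat j < n + 1}"

text \<open>To speak about the law of a vector of random length it is encoded in one fixed measurable
  space, with the junk components overwritten by \<open>0\<close>. The component \<open>n\<close> keeps the encoding
  injective.\<close>

definition vec_space :: "(real \<times> enat \<times> (nat \<Rightarrow> real)) measure" where
  "vec_space = borel \<Otimes>\<^sub>M (count_space UNIV \<Otimes>\<^sub>M (\<Pi>\<^sub>M j\<in>UNIV. borel))"

definition vec :: "real \<Rightarrow> enat \<Rightarrow> (nat \<Rightarrow> real) \<Rightarrow> real \<times> enat \<times> (nat \<Rightarrow> real)" where
  "vec q n c = (q, n, \<lambda>j. if j \<in> offspring n then c j else 0)"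

text \<open>Moments of nonnegative quantities take values in \<open>ennreal\<close>, so that no finiteness is
  presupposed and a condition \<open>< \<infinity>\<close> or \<open>< 1\<close> has its usual meaning.\<close>

definition rho :: "'w measure \<Rightarrow> ('w \<Rightarrow> enat) \<Rightarrow> (nat \<Rightarrow> 'w \<Rightarrow> real) \<Rightarrow> real \<Rightarrow> ennreal" where
  "rho M N C \<beta> = (\<integral>\<^sup>+\<omega>. (\<Sum>\<^sub>\<infinity>j\<in>offspring (N \<omega>). ennreal (C j \<omega> powr \<beta>)) \<partial>M)"

definition Z_sum :: "('w \<Rightarrow> enat) \<Rightarrow> (nat \<Rightarrow> 'w \<Rightarrow> real) \<Rightarrow> 'w \<Rightarrow> ennreal" where
  "Z_sum N C \<omega> = (\<Sum>\<^sub>\<infinity>j\<in>offspring (N \<omega>). ennreal (C j \<omega>))"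

definition ennreal_powr :: "ennreal \<Rightarrow> real \<Rightarrow> ennreal" where
  "ennreal_powr z p = (if z = \<infinity> then \<infinity> else ennreal (enn2real z powr p))"

definition nodes :: "nat list set" where
  "nodes = lists {1..}"

primrec generation :: "(nat list \<Rightarrow> 'w \<Rightarrow> enat) \<Rightarrow> nat \<Rightarrow> 'w \<Rightarrow> nat list set" where
  "generation NT 0 \<omega> = {[]}"
| "generation NT (Suc n) \<omega> = {i @ [j] | i j. i \<in> generation NT n \<omega> \<and> j \<in> offspring (NT i \<omega>)}"

function weight :: "(nat list \<Rightarrow> 'w \<Rightarrow> real) \<Rightarrow> nat list \<Rightarrow> 'w \<Rightarrow> real" where
  "weight CT [] \<omega> = 1"
| "weight CT (i @ [j]) \<omega> = CT (i @ [j]) \<omega> * weight CT i \<omega>"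
  by (auto, metis rev_exhaust)
termination by (relation "Wellfounded.measure (\<lambda>(CT, i, \<omega>). length i)") auto

text \<open>\<open>QT i\<close> and \<open>NT i\<close> belong to node \<open>i\<close>, whereas the weight \<open>CT (i @ [j])\<close> is indexed by the
  child but is part of the vector of its parent \<open>i\<close>. The vectors of distinct nodes are
  independent; the components within one vector may depend on each other arbitrarily.
  Measurability of all vectors is part of \<open>indep_vars\<close>.\<close>

locale weighted_branching_tree = prob_space M
  for M :: "'w measure" +
  fixes Q :: "'w \<Rightarrow> real" and N :: "'w \<Rightarrow> enat" and C :: "nat \<Rightarrow> 'w \<Rightarrow> real"
    and QT :: "nat list \<Rightarrow> 'w \<Rightarrow> real" and NT :: "nat list \<Rightarrow> 'w \<Rightarrow> enat"
    and CT :: "nat list \<Rightarrow> 'w \<Rightarrow> real"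
  assumes root:
    "\<And>\<omega>. \<omega> \<in> space M \<Longrightarrow>
       vec (QT [] \<omega>) (NT [] \<omega>) (\<lambda>j. CT [j] \<omega>) = vec (Q \<omega>) (N \<omega>) (\<lambda>j. C j \<omega>)"
  assumes independent:
    "indep_vars (\<lambda>_. vec_space)
       (\<lambda>i \<omega>. vec (QT i \<omega>) (NT i \<omega>) (\<lambda>j. CT (i @ [j]) \<omega>)) nodes"
  assumes identically_distributed:
    "\<And>i. i \<in> nodes \<Longrightarrow>
       distr M vec_space (\<lambda>\<omega>. vec (QT i \<omega>) (NT i \<omega>) (\<lambda>j. CT (i @ [j]) \<omega>)) =
       distr M vec_space (\<lambda>\<omega>. vec (Q \<omega>) (N \<omega>) (\<lambda>j. C j \<omega>))"

text \<open>A generation may be infinite; \<open>W_gen\<close> is then an unconditional (i.e. absolutely convergent) sum.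
  Where the sums diverge pointwise, \<open>W_gen\<close> is \<open>0\<close> and \<open>R_total\<close> unspecified; if \<open>rho M N C 1 < 1\<close> and \<open>Q\<close> is
  integrable, this happens only on a null set.\<close>

definition W_gen ::
  "(nat list \<Rightarrow> 'w \<Rightarrow> real) \<Rightarrow> (nat list \<Rightarrow> 'w \<Rightarrow> enat) \<Rightarrow> (nat list \<Rightarrow> 'w \<Rightarrow> real) \<Rightarrow> nat \<Rightarrow> 'w \<Rightarrow> real"
  where "W_gen QT NT CT n \<omega> = (\<Sum>\<^sub>\<infinity>i\<in>generation NT n \<omega>. QT i \<omega> * weight CT i \<omega>)"

definition R_total ::
  "(nat list \<Rightarrow> 'w \<Rightarrow> real) \<Rightarrow> (nat list \<Rightarrow> 'w \<Rightarrow> enat) \<Rightarrow> (nat list \<Rightarrow> 'w \<Rightarrow> real) \<Rightarrow> 'w \<Rightarrow> real"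
  where "R_total QT NT CT \<omega> = (\<Sum>n. W_gen QT NT CT n \<omega>)"

end

theory Submission
  imports Defs
begin

text \<open>The total weight satisfies \<open>R = Q + (\<Sum>j. C j * R j)\<close>, where the \<open>R j\<close> are the total weights of
  the subtrees at the children of the root: copies of \<open>R\<close>, independent of each other and of the
  root's vector. Heavy tails make one summand do all the work: up to negligible errors, \<open>R > x\<close> holds
  exactly if one summand on the right exceeds \<open>x\<close>. Writing \<open>F\<close> and \<open>G\<close> for the tails of \<open>Q\<close> and \<open>R\<close>,
  this says that \<open>G x\<close> is close to \<open>F x + E (\<Sum>j. G (x / C j))\<close>. By regular variation the operator
  \<open>g \<mapsto> E (\<Sum>j. g (x / C j))\<close> multiplies \<open>F\<close> asymptotically by \<open>\<rho>\<close>, the moment sum of order \<open>\<alpha>\<close>, so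
  that \<open>G\<close> must be asymptotic to \<open>F / (1 - \<rho>)\<close>.

  The errors are controlled by a single quantity. If \<open>b j\<close> bounds the \<open>j\<close>th summand, the cross term
  \<open>\<Sum>j. b j * (\<Sum>k\<noteq>j. b k) powr (p - 1)\<close> is at least of order \<open>x powr p\<close> whenever \<open>R > x\<close> without a
  large summand, and whenever a large summand fails to bring \<open>R\<close> above \<open>x\<close>
  (\<open>one_big_jump_upper\<close>, \<open>one_big_jump_lower\<close>). Since one factor can be pulled out by independence,
  moments of \<open>R\<close> below \<open>\<alpha>\<close> suffice for a finite expectation of the cross term at some \<open>p > \<alpha>\<close>
  (\<open>cross_term_integrable\<close>, \<open>exponent_above\<close>), and Markov's inequality gives an error of order
  \<open>x powr (-p)\<close>, negligible against \<open>F\<close>.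

  The approximate equation for \<open>G\<close> is solved by comparison (\<open>tail_op_comparison\<close>): subsolutions lie
  below supersolutions, because \<open>G x\<close> is at most a multiple of \<open>1 / x\<close> and the operator contracts
  \<open>1 / x\<close> by the moment sum of order \<open>1\<close>. Multiples \<open>a * F\<close> are super- or subsolutions according
  as \<open>a\<close> is above or below \<open>1 / (1 - \<rho>)\<close> (\<open>tail_equation_asymptotics\<close>). The same comparison, with powers
  of \<open>x\<close> in place of \<open>F\<close>, yields the moments below \<open>\<alpha>\<close> of the sum \<open>B\<close> of absolute values that
  dominates \<open>R\<close> (\<open>majorant_moments\<close>).\<close>

section \<open>Regularly varying tails\<close>

lemma regularly_varying_pos:
  assumes "f \<in> regularly_varying a" "x > 0"
  shows "f x > 0"
  using assms by (auto simp: regularly_varying_def slowly_varying_def)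

lemma regularly_varying_ratio:
  assumes f: "f \<in> regularly_varying a" and c: "c > 0"
  shows "((\<lambda>x. f (c * x) / f x) \<longlongrightarrow> c powr a) at_top"
proof -
  obtain L where L: "slowly_varying L" and fL: "\<And>x. x > 0 \<Longrightarrow> f x = x powr a * L x"
    using f by (auto simp: regularly_varying_def)
  have "((\<lambda>x. L (c * x) / L x) \<longlongrightarrow> 1) at_top"
    using L c by (auto simp: slowly_varying_def)
  then have "((\<lambda>x. c powr a * (L (c * x) / L x)) \<longlongrightarrow> c powr a * 1) at_top"
    by (intro tendsto_intros)
  moreover have "\<forall>\<^sub>F x in at_top. c powr a * (L (c * x) / L x) = f (c * x) / f x"
    using eventually_gt_at_top[of 0]
  proof eventually_elim
    case (elim x)
    then show ?case using c by (simp add: fL powr_mult)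
  qed
  ultimately show ?thesis by (simp add: filterlim_cong[OF refl refl])
qed

text \<open>The two halves of Potter's bound. One doubling of the argument costs a factor close to
  \<open>2 powr (-\<alpha>)\<close>; doublings are iterated, and monotonicity covers the arguments in between.\<close>

lemma potter_decay:
  fixes f :: "real \<Rightarrow> real"
  assumes anti: "antimono f" and pos: "\<And>x. x > 0 \<Longrightarrow> f x > 0"
    and ratio: "((\<lambda>x. f (2 * x) / f x) \<longlongrightarrow> 2 powr (- \<alpha>)) at_top"
    and g: "0 \<le> \<gamma>" "\<gamma> < \<alpha>"
  obtains x0 where "x0 > 0" "\<And>x l. x \<ge> x0 \<Longrightarrow> l \<ge> 1 \<Longrightarrow> f (l * x) \<le> (2 / l) powr \<gamma> * f x"
proof -
  have "\<forall>\<^sub>F x in at_top. f (2 * x) / f x < 2 powr (- \<gamma>)"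
    using ratio by (rule order_tendstoD) (use g in simp)
  then obtain x1 where x1: "\<And>x. x \<ge> x1 \<Longrightarrow> f (2 * x) / f x < 2 powr (- \<gamma>)"
    by (auto simp: eventually_at_top_linorder)
  define x0 where "x0 = max x1 1"
  have dbl: "f (2 * x) \<le> 2 powr (- \<gamma>) * f x" if "x \<ge> x0" for x
    using x1[of x] pos[of x] that by (simp add: x0_def field_simps)
  have claim: "f (l * x) \<le> (2 / l) powr \<gamma> * f x" if "x \<ge> x0" "1 \<le> l" "l \<le> 2 ^ k" for k l x
    using that
  proof (induction k arbitrary: l x)
    case (Suc k)
    show ?case
    proof (cases "l \<le> 2")
      case True
      have "f (l * x) \<le> f x"
        using Suc.prems by (intro antimonoD[OF anti]) (auto simp: x0_def)
      also have "\<dots> \<le> (2 / l) powr \<gamma> * f x"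
        using True Suc.prems pos[of x] g by (auto simp: x0_def intro!: ge_one_powr_ge_zero)
      finally show ?thesis .
    next
      case False
      have "f (l * x) = f (l / 2 * (2 * x))" by simp
      also have "\<dots> \<le> (2 / (l / 2)) powr \<gamma> * f (2 * x)"
        using False Suc.prems by (intro Suc.IH) (auto simp: x0_def)
      also have "\<dots> \<le> (2 / (l / 2)) powr \<gamma> * (2 powr (- \<gamma>) * f x)"
        using dbl[of x] Suc.prems by (intro mult_left_mono) auto
      also have "\<dots> = (2 / l) powr \<gamma> * f x"
        using False by (simp add: powr_divide powr_minus field_simps)
          (simp flip: powr_mult)
      finally show ?thesis .
    qed
  next
    case 0
    then have "l = 1" by simp
    with 0 show ?case using pos[of x] g by (auto simp: x0_def intro!: ge_one_powr_ge_zero)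
  qed
  show thesis
  proof (rule that[of x0])
    fix x l :: real assume "x \<ge> x0" "l \<ge> 1"
    moreover obtain k where "l < 2 ^ k" using real_arch_pow[of 2 l] by auto
    ultimately show "f (l * x) \<le> (2 / l) powr \<gamma> * f x" using claim[of x l k] by simp
  qed (simp add: x0_def)
qed

lemma potter_growth:
  fixes f :: "real \<Rightarrow> real"
  assumes anti: "antimono f" and pos: "\<And>x. x > 0 \<Longrightarrow> f x > 0" and le1: "\<And>x. f x \<le> 1"
    and ratio: "((\<lambda>x. f (2 * x) / f x) \<longlongrightarrow> 2 powr (- \<alpha>)) at_top"
    and g: "0 \<le> \<gamma>" "\<alpha> < \<gamma>"
  obtains x0 K where "x0 > 0" "K > 0"
    "\<And>x y. x \<ge> x0 \<Longrightarrow> 0 < y \<Longrightarrow> y \<le> x \<Longrightarrow> f y \<le> K * (x / y) powr \<gamma> * f x"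
proof -
  have "\<forall>\<^sub>F x in at_top. f (2 * x) / f x > 2 powr (- \<gamma>)"
    using ratio by (rule order_tendstoD) (use g in simp)
  then obtain x1 where x1: "\<And>x. x \<ge> x1 \<Longrightarrow> f (2 * x) / f x > 2 powr (- \<gamma>)"
    by (auto simp: eventually_at_top_linorder)
  define x0 where "x0 = max x1 1"
  \<comment> \<open>The first summand of \<open>K\<close> serves arguments below \<open>2 * x0\<close>, where \<open>f \<le> 1\<close> is the only bound; the
    second one makes up for the last, incomplete halving.\<close>
  define K where "K = 1 / f (2 * x0) + 2 powr \<gamma>"
  have p0: "f (2 * x0) > 0" by (rule pos) (simp add: x0_def)
  have K: "K > 0" "2 powr \<gamma> \<le> K" "1 / f (2 * x0) \<le> K"
    using p0 by (auto simp: K_def add_nonneg_pos less_imp_le)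
  have half: "f (x / 2) \<le> 2 powr \<gamma> * f x" if "x \<ge> 2 * x0" for x
  proof -
    have "x > 0" "x / 2 \<ge> x1" using that by (auto simp: x0_def)
    then show ?thesis using x1[of "x / 2"] pos[of "x / 2"] by (simp add: powr_minus field_simps)
  qed
  have claim: "f y \<le> K * (x / y) powr \<gamma> * f x" if "x \<ge> x0" "0 < y" "y \<le> x" "x \<le> 2 ^ k * x0" for k x y
    using that
  proof (induction k arbitrary: x)
    case 0
    have "1 \<le> K * f (2 * x0)" using K p0 by (simp add: field_simps)
    also have "\<dots> \<le> K * f x"
      using 0 K by (intro mult_left_mono antimonoD[OF anti]) (auto simp: x0_def)
    finally have "1 * 1 \<le> (K * f x) * (x / y) powr \<gamma>"
      using 0 g K pos[of x] by (intro mult_mono ge_one_powr_ge_zero) (auto simp: x0_def)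
    then show ?case using le1[of y] by (simp add: mult_ac)
  next
    case (Suc k)
    show ?case
    proof (cases "x \<le> 2 * x0")
      case True
      have "1 \<le> K * f (2 * x0)" using K p0 by (simp add: field_simps)
      also have "\<dots> \<le> K * f x"
        using True K by (intro mult_left_mono antimonoD[OF anti]) (auto simp: x0_def)
      finally have "1 * 1 \<le> (K * f x) * (x / y) powr \<gamma>"
        using Suc.prems g K pos[of x] by (intro mult_mono ge_one_powr_ge_zero) (auto simp: x0_def)
      then show ?thesis using le1[of y] by (simp add: mult_ac)
    next
      case False
      have fx: "f x > 0" using False by (intro pos) (simp add: x0_def)
      show ?thesis
      proof (cases "y \<le> x / 2")
        case True
        have "f y \<le> K * (x / 2 / y) powr \<gamma> * f (x / 2)"
          using False True Suc.prems by (intro Suc.IH) auto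
        also have "\<dots> \<le> K * (x / 2 / y) powr \<gamma> * (2 powr \<gamma> * f x)"
          using half[of x] False K by (intro mult_left_mono) auto
        also have "\<dots> = K * (x / y) powr \<gamma> * f x"
          using False Suc.prems by (simp add: powr_divide powr_mult x0_def)
        finally show ?thesis .
      next
        case y: False
        have "f y \<le> f (x / 2)" using y by (intro antimonoD[OF anti]) simp
        also have "\<dots> \<le> (2 powr \<gamma> * 1) * f x" using half[of x] False by simp
        also have "\<dots> \<le> (K * (x / y) powr \<gamma>) * f x"
          using K g fx Suc.prems by (intro mult_right_mono mult_mono ge_one_powr_ge_zero) auto
        finally show ?thesis .
      qed
    qed
  qed
  show thesis
  proof (rule that[of x0 K])
    fix x y :: real assume "x \<ge> x0" "0 < y" "y \<le> x"
    moreover obtain k where "x / x0 < 2 ^ k" using real_arch_pow[of 2 "x / x0"] by auto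
    then have "x \<le> 2 ^ k * x0" by (simp add: x0_def field_simps split: if_splits)
    ultimately show "f y \<le> K * (x / y) powr \<gamma> * f x" using claim[of x y k] by simp
  qed (use K in \<open>simp_all add: x0_def\<close>)
qed

section \<open>The tail operator of an intensity measure\<close>

text \<open>If \<open>\<nu>\<close> is the intensity measure of random weights \<open>C j\<close> and \<open>g\<close> the tail of a variable \<open>R\<close>, this
  is the expected number of indices \<open>j\<close> with \<open>C j * R j > s * x\<close>, for copies \<open>R j\<close> of \<open>R\<close> that are
  independent of the weights. The dilation \<open>s\<close> is kept as a parameter because the one-step
  inequalities hold for \<open>s \<noteq> 1\<close> only.\<close>

definition tail_op :: "real measure \<Rightarrow> real \<Rightarrow> (real \<Rightarrow> ennreal) \<Rightarrow> real \<Rightarrow> ennreal" where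
  "tail_op \<nu> s g x = (\<integral>\<^sup>+c\<in>{0<..}. g (s * x / c) \<partial>\<nu>)"

definition moment :: "real measure \<Rightarrow> real \<Rightarrow> ennreal" where
  "moment \<nu> \<beta> = (\<integral>\<^sup>+c\<in>{0<..}. ennreal (c powr \<beta>) \<partial>\<nu>)"

lemma tail_op_mono:
  assumes "\<And>y. y > 0 \<Longrightarrow> g y \<le> h y" "s > 0" "x > 0"
  shows "tail_op \<nu> s g x \<le> tail_op \<nu> s h x"
  unfolding tail_op_def using assms
  by (intro nn_integral_mono) (auto simp: indicator_def)

lemma tail_op_add:
  assumes [measurable_cong]: "sets \<nu> = sets borel"
    and [measurable]: "g \<in> borel_measurable borel" "h \<in> borel_measurable borel"
  shows "tail_op \<nu> s (\<lambda>x. g x + h x) x = tail_op \<nu> s g x + tail_op \<nu> s h x"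
  unfolding tail_op_def by (subst nn_integral_add[symmetric]) (auto simp: distrib_right)

lemma tail_op_cmult:
  assumes [measurable_cong]: "sets \<nu> = sets borel"
    and [measurable]: "g \<in> borel_measurable borel"
  shows "tail_op \<nu> s (\<lambda>x. k * g x) x = k * tail_op \<nu> s g x"
  unfolding tail_op_def by (subst nn_integral_cmult[symmetric]) (auto simp: mult_ac)

lemma tail_op_power:
  assumes [measurable_cong]: "sets \<nu> = sets borel" and "s > 0" "x > 0"
  shows "tail_op \<nu> s (\<lambda>y. ennreal (K * y powr (-\<beta>))) x = ennreal (K * (s * x) powr (-\<beta>)) * moment \<nu> \<beta>"
proof (cases "K \<ge> 0")
  case True
  have "ennreal (K * (s * x / c) powr (-\<beta>)) * indicator {0<..} c
      = ennreal (K * (s * x) powr (-\<beta>)) * (ennreal (c powr \<beta>) * indicator {0<..} c)" for c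
    using assms True
    by (auto simp: indicator_def powr_divide powr_minus field_simps simp flip: ennreal_mult)
  then show ?thesis
    unfolding tail_op_def moment_def by (subst nn_integral_cmult[symmetric]) auto
next
  case False
  then have "K * y powr (-\<beta>) \<le> 0" for y by (simp add: mult_nonpos_nonneg)
  then show ?thesis unfolding tail_op_def by (simp add: ennreal_neg)
qed

text \<open>A power \<open>x powr (-p)\<close> is contracted by the operator, so a large multiple of it absorbs error terms
  of the same order. The lower bound \<open>D\<close> leaves room for a prescribed bound at bounded \<open>x\<close>.\<close>

lemma power_supersolution:
  assumes sets: "sets \<nu> = sets borel" and s: "s > 0" and \<mu>: "moment \<nu> p = ennreal \<mu>" "0 \<le> \<mu>"
    and contr: "s powr (-p) * \<mu> < 1" and K: "K \<ge> 0" and D: "D \<ge> 0"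
  obtains K' where "K' \<ge> D" "\<And>x. x > 0 \<Longrightarrow>
    ennreal (K * x powr (-p)) + tail_op \<nu> s (\<lambda>y. ennreal (K' * y powr (-p))) x \<le> ennreal (K' * x powr (-p))"
proof -
  define r where "r = s powr (-p) * \<mu>"
  have r: "0 \<le> r" "r < 1" using contr \<mu> by (auto simp: r_def)
  define K' where "K' = max (K / (1 - r)) D"
  have "K / (1 - r) \<le> K'" "K' \<ge> D" by (simp_all add: K'_def)
  then have K': "K' \<ge> D" "K' \<ge> 0" "K + K' * r \<le> K'" using r D by (simp_all add: field_simps)
  show thesis
  proof (rule that[OF K'(1)])
    fix x :: real assume x: "x > 0"
    have "tail_op \<nu> s (\<lambda>y. ennreal (K' * y powr (-p))) x = ennreal (K' * (s * x) powr (-p)) * ennreal \<mu>"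
      unfolding \<mu>(1)[symmetric] using s x by (intro tail_op_power sets)
    also have "\<dots> = ennreal (K' * r * x powr (-p))"
      using s x \<mu> K' by (simp add: r_def powr_mult mult_ac flip: ennreal_mult)
    finally show "ennreal (K * x powr (-p)) + tail_op \<nu> s (\<lambda>y. ennreal (K' * y powr (-p))) x \<le> ennreal (K' * x powr (-p))"
      using mult_right_mono[OF K'(3), of "x powr (-p)"] K' K r
      by (simp add: distrib_right ennreal_leI flip: ennreal_plus)
  qed
qed

text \<open>The comparison principle: a subsolution \<open>L\<close> of \<open>L = b + tail_op \<nu> s L\<close> lies below a
  supersolution \<open>U\<close>, because the a priori error \<open>\<kappa> / x\<close> is multiplied by
  \<open>moment \<nu> 1 / s < 1\<close> in each application of the operator. On a bounded range of \<open>x\<close> the order is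
  assumed, which later absorbs everything that holds for large \<open>x\<close> only.\<close>

lemma tail_op_comparison:
  fixes L U b :: "real \<Rightarrow> ennreal"
  assumes sets[measurable_cong]: "sets \<nu> = sets borel"
    and [measurable]: "U \<in> borel_measurable borel"
    and sub: "\<And>x. x > 0 \<Longrightarrow> x \<ge> T \<Longrightarrow> L x \<le> b x + tail_op \<nu> s L x"
    and super: "\<And>x. x > 0 \<Longrightarrow> x \<ge> T \<Longrightarrow> b x + tail_op \<nu> s U x \<le> U x"
    and init: "\<And>x. x > 0 \<Longrightarrow> x < T \<Longrightarrow> L x \<le> U x"
    and apriori: "\<And>x. x > 0 \<Longrightarrow> L x \<le> U x + ennreal (\<kappa> / x)"
    and \<kappa>: "\<kappa> \<ge> 0" and s: "s > 0" and contr: "moment \<nu> 1 < ennreal s" and x: "x > 0"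
  shows "L x \<le> U x"
proof -
  obtain m where m: "moment \<nu> 1 = ennreal m" "0 \<le> m" "m < s"
    using contr s by (cases "moment \<nu> 1") (auto simp: ennreal_less_iff)
  define r where "r = m / s"
  have r: "0 \<le> r" "r < 1" using m s by (auto simp: r_def)
  have bound: "L x \<le> U x + ennreal (\<kappa> * r ^ n * x powr (-1))" if "x > 0" for n x
    using that
  proof (induction n arbitrary: x)
    case 0
    then show ?case using apriori[of x] by (simp add: powr_minus field_simps)
  next
    case (Suc n)
    show ?case
    proof (cases "x < T")
      case True
      then show ?thesis using init[of x] Suc.prems by (meson add_increasing2 order.trans zero_le)
    next
      case False
      have "tail_op \<nu> s L x \<le> tail_op \<nu> s (\<lambda>y. U y + ennreal (\<kappa> * r ^ n * y powr (-1))) x"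
        using Suc s by (intro tail_op_mono) auto
      also have "\<dots> = tail_op \<nu> s U x + tail_op \<nu> s (\<lambda>y. ennreal (\<kappa> * r ^ n * y powr (-1))) x"
        by (intro tail_op_add sets) measurable
      also have "tail_op \<nu> s (\<lambda>y. ennreal (\<kappa> * r ^ n * y powr (-1))) x
          = ennreal (\<kappa> * r ^ n * (s * x) powr (-1)) * ennreal m"
        unfolding m(1)[symmetric] using s Suc.prems by (intro tail_op_power sets)
      also have "ennreal (\<kappa> * r ^ n * (s * x) powr (-1)) * ennreal m
          = ennreal (\<kappa> * r ^ Suc n * x powr (-1))"
        unfolding ennreal_mult''[OF m(2), symmetric] using s Suc.prems m
        by (intro arg_cong[where f=ennreal]) (simp add: r_def powr_minus field_simps)
      finally have "L x \<le> (b x + tail_op \<nu> s U x) + ennreal (\<kappa> * r ^ Suc n * x powr (-1))"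
        using sub[of x] False Suc.prems by (simp add: add.assoc) (meson add_left_mono order.trans)
      also have "\<dots> \<le> U x + ennreal (\<kappa> * r ^ Suc n * x powr (-1))"
        using super[of x] False Suc.prems by (intro add_right_mono) auto
      finally show ?thesis .
    qed
  qed
  have "(\<lambda>n. U x + ennreal (\<kappa> * r ^ n * x powr (-1))) \<longlonglongrightarrow> U x + ennreal (\<kappa> * 0 * x powr (-1))"
    using r by (intro tendsto_intros tendsto_ennrealI LIMSEQ_power_zero) auto
  then show ?thesis
    using bound[OF x] by (intro LIMSEQ_le_const[where X="\<lambda>n. U x + ennreal (\<kappa> * r ^ n * x powr (-1))"]) auto
qed

text \<open>Powers of a fixed base are convex in the exponent; hence moments below \<open>1\<close> at two exponents stay
  below \<open>1\<close> in between, and slightly beyond if a further moment is finite.\<close>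

lemma moment_convex:
  assumes [measurable_cong]: "sets \<nu> = sets borel" and t: "0 \<le> t" "t \<le> 1"
  shows "moment \<nu> ((1 - t) * a + t * b) \<le> ennreal (1 - t) * moment \<nu> a + ennreal t * moment \<nu> b"
proof -
  have *: "c powr ((1 - t) * a + t * b) \<le> (1 - t) * c powr a + t * c powr b" if "c > 0" for c :: real
  proof -
    have "c powr ((1 - t) * a + t * b) = (c powr a) powr (1 - t) * (c powr b) powr t"
      using that by (simp add: powr_add powr_powr mult_ac)
    also have "\<dots> \<le> (1 - t) * c powr a + t * c powr b"
      using t that by (intro Youngs_inequality_0) auto
    finally show ?thesis .
  qed
  have "moment \<nu> ((1 - t) * a + t * b)
      \<le> (\<integral>\<^sup>+c. ennreal (1 - t) * (ennreal (c powr a) * indicator {0<..} c) +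
           ennreal t * (ennreal (c powr b) * indicator {0<..} c) \<partial>\<nu>)"
    unfolding moment_def using t *
    by (intro nn_integral_mono)
       (auto simp: indicator_def ennreal_leI simp flip: ennreal_mult ennreal_plus)
  also have "\<dots> = ennreal (1 - t) * moment \<nu> a + ennreal t * moment \<nu> b"
    unfolding moment_def by (subst nn_integral_add) (auto simp: nn_integral_cmult)
  finally show ?thesis .
qed


lemma antimono_borel_measurable:
  fixes F :: "real \<Rightarrow> real"
  assumes "antimono F"
  shows "F \<in> borel_measurable borel"
proof -
  have "mono (\<lambda>x. - F x)" using assms by (auto simp: mono_def antimono_def)
  then have "(\<lambda>x. - (- F x)) \<in> borel_measurable borel"
    by (intro borel_measurable_uminus borel_measurable_mono)
  then show ?thesis by simp
qed

text \<open>Dominated convergence: at each fixed \<open>c\<close> the ratio converges by regular variation. Potter's bounds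
  dominate it by a multiple of \<open>c + c powr p\<close>, where \<open>1 < \<alpha> < p\<close>; the decay bound serves \<open>c \<le> s\<close>,
  where the argument of \<open>F\<close> increases, and the growth bound serves \<open>c > s\<close>.\<close>

lemma tail_op_ratio:
  fixes F :: "real \<Rightarrow> real"
  assumes sets[measurable_cong]: "sets \<nu> = sets borel"
    and anti: "antimono F" and le1: "\<And>x. F x \<le> 1"
    and F: "F \<in> regularly_varying (- \<alpha>)" and \<alpha>: "\<alpha> > 1" and p: "p > \<alpha>"
    and fin: "moment \<nu> 1 < \<infinity>" "moment \<nu> p < \<infinity>" and s: "s > 0"
  shows "((\<lambda>x. tail_op \<nu> s (\<lambda>y. ennreal (F y)) x / ennreal (F x))
           \<longlongrightarrow> ennreal (s powr (-\<alpha>)) * moment \<nu> \<alpha>) at_top"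
proof -
  have pos: "F x > 0" if "x > 0" for x using regularly_varying_pos[OF F that] .
  have F0: "F x \<ge> 0" for x
    using pos[of "max x 1"] antimonoD[OF anti, of x "max x 1"] by linarith
  note [measurable] = antimono_borel_measurable[OF anti]
  obtain x1 where x1: "x1 > 0" "\<And>x l. x \<ge> x1 \<Longrightarrow> l \<ge> 1 \<Longrightarrow> F (l * x) \<le> (2 / l) powr 1 * F x"
    using potter_decay[OF anti pos regularly_varying_ratio[OF F], of 1] \<alpha> by auto
  obtain x2 K where x2: "x2 > 0" "K > 0"
    "\<And>x y. x \<ge> x2 \<Longrightarrow> 0 < y \<Longrightarrow> y \<le> x \<Longrightarrow> F y \<le> K * (x / y) powr p * F x"
    using potter_growth[OF anti pos le1 regularly_varying_ratio[OF F], of p] \<alpha> p by auto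
  define x0 where "x0 = max x1 x2"
  define D where "D = max (2 / s) (K / s powr p)"
  have bound: "F (s * x / c) / F x \<le> D * c powr 1 + D * c powr p" if x: "x \<ge> x0" and c: "c > 0" for x c
  proof -
    have xx: "x > 0" "x \<ge> x1" "x \<ge> x2" using x x1 by (auto simp: x0_def)
    have D: "D \<ge> 2 / s" "D \<ge> K / s powr p" "D \<ge> 0"
      using s by (auto simp: D_def le_max_iff_disj)
    show ?thesis
    proof (cases "c \<le> s")
      case True
      have "F (s * x / c) = F ((s / c) * x)" by simp
      also have "\<dots> \<le> (2 / (s / c)) powr 1 * F x" using True c xx by (intro x1) auto
      also have "\<dots> = (2 / s * c) * F x" using s c by simp
      finally have "F (s * x / c) / F x \<le> 2 / s * c powr 1" using pos[OF xx(1)] c by (simp add: field_simps)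
      also have "\<dots> \<le> D * c powr 1" by (intro mult_right_mono D) auto
      also have "\<dots> \<le> D * c powr 1 + D * c powr p" using D by simp
      finally show ?thesis .
    next
      case False
      have "s * x / c \<le> x" using False c xx by (simp add: field_simps)
      then have "F (s * x / c) \<le> K * (x / (s * x / c)) powr p * F x"
        using c s xx by (intro x2) auto
      also have "x / (s * x / c) = c / s" using xx c by simp
      also have "K * (c / s) powr p = K / s powr p * c powr p" using c s by (simp add: powr_divide)
      finally have "F (s * x / c) / F x \<le> K / s powr p * c powr p"
        using pos[OF xx(1)] by (simp add: field_simps)
      also have "\<dots> \<le> D * c powr p" by (intro mult_right_mono D) auto
      also have "\<dots> \<le> D * c powr 1 + D * c powr p" using D by simp
      finally show ?thesis .
    qed
  qed
  have D0: "D \<ge> 0" using s by (auto simp: D_def le_max_iff_disj)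
  define w where "w c = (ennreal D * (ennreal (c powr 1) * indicator {0<..} c) +
      ennreal D * (ennreal (c powr p) * indicator {0<..} c))" for c :: real
  have [measurable]: "w \<in> borel_measurable borel" unfolding w_def by measurable
  have "(\<integral>\<^sup>+c. w c \<partial>\<nu>) = ennreal D * moment \<nu> 1 + ennreal D * moment \<nu> p"
    unfolding w_def moment_def by (subst nn_integral_add) (auto simp: nn_integral_cmult)
  also have "\<dots> < \<infinity>" using fin by (simp add: ennreal_mult_less_top)
  finally have w_fin: "(\<integral>\<^sup>+c. w c \<partial>\<nu>) < \<infinity>" .
  have seq: "(\<lambda>n. tail_op \<nu> s (\<lambda>y. ennreal (F y)) (X n) / ennreal (F (X n)))
      \<longlonglongrightarrow> ennreal (s powr (-\<alpha>)) * moment \<nu> \<alpha>"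
    if X: "filterlim X at_top sequentially" for X :: "nat \<Rightarrow> real"
  proof -
    define Y where "Y n = max x0 (X n)" for n
    have YX: "\<forall>\<^sub>F n in sequentially. Y n = X n"
      using filterlim_at_top[THEN iffD1, OF X, rule_format, of x0]
      by eventually_elim (simp add: Y_def)
    have Y: "Y n \<ge> x0" "Y n > 0" for n using x1 by (auto simp: Y_def x0_def less_max_iff_disj)
    have Yt: "filterlim Y at_top sequentially"
      by (rule filterlim_cong[OF refl refl YX, THEN iffD2, OF X])
    define u where "u n c = ennreal (F (s * Y n / c) / F (Y n)) * indicator {0<..} c" for n c
    define u' where "u' c = ennreal (s powr (-\<alpha>)) * (ennreal (c powr \<alpha>) * indicator {0<..} c)" for c :: real
    have "(\<lambda>n. \<integral>\<^sup>+c. u n c \<partial>\<nu>) \<longlonglongrightarrow> (\<integral>\<^sup>+c. u' c \<partial>\<nu>)"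
    proof (rule nn_integral_dominated_convergence[where w=w])
      show "u n \<in> borel_measurable \<nu>" "u' \<in> borel_measurable \<nu>" "w \<in> borel_measurable \<nu>" for n
        unfolding u_def u'_def by measurable
      have "u n c \<le> w c" for n c
        using bound[OF Y(1)[of n], of c] D0
        by (auto simp: u_def w_def indicator_def ennreal_leI simp flip: ennreal_mult ennreal_plus)
      then show "\<And>n. AE c in \<nu>. u n c \<le> w c" by simp
      have "(\<lambda>n. u n c) \<longlonglongrightarrow> u' c" for c
      proof (cases "c > 0")
        case True
        have "((\<lambda>x. F (s / c * x) / F x) \<longlongrightarrow> (s / c) powr (-\<alpha>)) at_top"
          using True s by (intro regularly_varying_ratio[OF F]) auto
        then have "(\<lambda>n. F (s / c * Y n) / F (Y n)) \<longlonglongrightarrow> (s / c) powr (-\<alpha>)"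
          using Yt by (rule filterlim_compose)
        then have "(\<lambda>n. ennreal (F (s / c * Y n) / F (Y n))) \<longlonglongrightarrow> ennreal ((s / c) powr (-\<alpha>))"
          by (rule tendsto_ennrealI)
        moreover have "(s / c) powr (-\<alpha>) = s powr (-\<alpha>) * c powr \<alpha>"
          using True s by (simp add: powr_divide powr_minus field_simps)
        ultimately show ?thesis
          using True by (simp add: u_def u'_def ennreal_mult)
      qed (simp add: u_def u'_def)
      then show "AE c in \<nu>. (\<lambda>n. u n c) \<longlonglongrightarrow> u' c" by simp
    qed (use w_fin in simp)
    also have "(\<integral>\<^sup>+c. u' c \<partial>\<nu>) = ennreal (s powr (-\<alpha>)) * moment \<nu> \<alpha>"
      unfolding u'_def moment_def by (rule nn_integral_cmult) measurable
    also have "(\<lambda>n. \<integral>\<^sup>+c. u n c \<partial>\<nu>) = (\<lambda>n. tail_op \<nu> s (\<lambda>y. ennreal (F y)) (Y n) / ennreal (F (Y n)))"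
    proof
      fix n
      have "u n c = ennreal (F (s * Y n / c)) * indicator {0<..} c / ennreal (F (Y n))" for c
        using pos[OF Y(2)[of n]] F0
        by (auto simp: u_def indicator_def divide_ennreal)
      then show "(\<integral>\<^sup>+c. u n c \<partial>\<nu>) = tail_op \<nu> s (\<lambda>y. ennreal (F y)) (Y n) / ennreal (F (Y n))"
        unfolding tail_op_def by (simp add: nn_integral_divide)
    qed
    finally show ?thesis
      by (rule Lim_transform_eventually) (use YX in \<open>auto elim: eventually_mono\<close>)
  qed
  show ?thesis
    using seq by (rule tendsto_at_topI_sequentially)
qed


text \<open>The tail \<open>G\<close> satisfies the one-step relation
  \<open>G x = F x + tail_op \<nu> 1 G x\<close> up to dilations \<open>s \<noteq> 1\<close> of the argument and errors of the
  smaller order \<open>x powr (-p)\<close>. Multiplication by \<open>a\<close> turns \<open>F\<close> into an approximate super- or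
  subsolution of this relation according as \<open>a\<close> is above or below \<open>1 / (1 - \<rho>)\<close>,
  and comparison traps \<open>G\<close> in between.\<close>

lemma tail_equation_asymptotics:
  fixes F G :: "real \<Rightarrow> real"
  assumes sets[measurable_cong]: "sets \<nu> = sets borel"
    and anti: "antimono F" and le1: "\<And>x. F x \<le> 1"
    and F: "F \<in> regularly_varying (- \<alpha>)" and \<alpha>: "\<alpha> > 1" and p: "p > \<alpha>"
    and antiG: "antimono G" and G0: "\<And>x. 0 \<le> G x" and G1: "\<And>x. G x \<le> 1"
    and m1: "moment \<nu> 1 < 1" and m\<alpha>: "moment \<nu> \<alpha> = ennreal \<rho>" "0 \<le> \<rho>" "\<rho> < 1" and mp: "moment \<nu> p < 1"
    and upper: "\<And>s. 0 < s \<Longrightarrow> s < 1 \<Longrightarrow> \<exists>K\<ge>0. \<forall>x>0.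
        ennreal (G x) \<le> ennreal (F (s * x)) + tail_op \<nu> s (\<lambda>y. ennreal (G y)) x + ennreal (K * x powr (-p))"
    and lower: "\<And>s. 1 < s \<Longrightarrow> \<exists>K\<ge>0. \<forall>x>0.
        ennreal (F (s * x)) + tail_op \<nu> s (\<lambda>y. ennreal (G y)) x \<le> ennreal (G x) + ennreal (K * x powr (-p))"
    and \<kappa>: "\<kappa> \<ge> 0" and G\<kappa>: "\<And>x. x > 0 \<Longrightarrow> G x \<le> \<kappa> / x" and F\<kappa>: "\<And>x. x > 0 \<Longrightarrow> F x \<le> \<kappa> / x"
  shows "((\<lambda>x. G x / F x) \<longlongrightarrow> 1 / (1 - \<rho>)) at_top"
proof -
  have pos: "F x > 0" if "x > 0" for x using regularly_varying_pos[OF F that] .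
  have F0: "F x \<ge> 0" for x
    using pos[of "max x 1"] antimonoD[OF anti, of x "max x 1"] by linarith
  note [measurable] = antimono_borel_measurable[OF anti] antimono_borel_measurable[OF antiG]
  obtain \<mu>1 where \<mu>1: "moment \<nu> 1 = ennreal \<mu>1" "0 \<le> \<mu>1" "\<mu>1 < 1"
    using m1 by (cases "moment \<nu> 1") auto
  obtain \<mu>p where \<mu>p: "moment \<nu> p = ennreal \<mu>p" "0 \<le> \<mu>p" "\<mu>p < 1"
    using mp by (cases "moment \<nu> p") auto
  \<comment> \<open>Potter's bound with an exponent strictly between \<open>\<alpha>\<close> and \<open>p\<close> bounds \<open>F\<close> from below.\<close>
  have negl: "((\<lambda>x. K * x powr (-p) / F x) \<longlongrightarrow> 0) at_top" for K
  proof -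
    define g where "g = (\<alpha> + p) / 2"
    have g: "0 \<le> g" "\<alpha> < g" "g < p" using \<alpha> p by (auto simp: g_def)
    obtain x2 k where x2: "x2 > 0" "k > 0"
      "\<And>x y. x \<ge> x2 \<Longrightarrow> 0 < y \<Longrightarrow> y \<le> x \<Longrightarrow> F y \<le> k * (x / y) powr g * F x"
      using potter_growth[OF anti pos le1 regularly_varying_ratio[OF F], of g] g by auto
    have ev: "\<forall>\<^sub>F x in at_top. norm (x powr (-p) / F x) \<le> k / F 1 * x powr (g - p)"
      using eventually_ge_at_top[of "max x2 1"]
    proof eventually_elim
      case (elim x)
      have "F 1 \<le> k * x powr g * F x" using x2(3)[of x 1] elim by simp
      then have "1 / F x \<le> k / F 1 * x powr g"
        using pos[of 1] pos[of x] elim by (simp add: field_simps)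
      then have "x powr (-p) * (1 / F x) \<le> x powr (-p) * (k / F 1 * x powr g)"
        by (rule mult_left_mono) simp
      also have "\<dots> = k / F 1 * x powr (g - p)"
        using elim by (simp add: powr_add[symmetric])
      finally show ?case using pos[of x] elim by (simp add: abs_of_nonneg less_imp_le)
    qed
    have "((\<lambda>x. k / F 1 * x powr (g - p)) \<longlongrightarrow> k / F 1 * 0) at_top"
      using g by (intro tendsto_intros tendsto_neg_powr filterlim_ident) auto
    then have "((\<lambda>x. x powr (-p) / F x) \<longlongrightarrow> 0) at_top"
      using ev by (intro Lim_null_comparison[OF ev]) simp
    then have "((\<lambda>x. K * (x powr (-p) / F x)) \<longlongrightarrow> K * 0) at_top"
      by (intro tendsto_intros)
    then show ?thesis by simp
  qed
  define lhs where "lhs s a x = ennreal (F (s * x)) + ennreal a * tail_op \<nu> s (\<lambda>y. ennreal (F y)) x" for s a x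
  have lhs_lim: "((\<lambda>x. lhs s a x / ennreal (F x)) \<longlongrightarrow> ennreal (s powr (-\<alpha>) * (1 + a * \<rho>))) at_top"
    if s: "s > 0" and a: "a \<ge> 0" for s a
  proof -
    have "((\<lambda>x. ennreal (F (s * x) / F x) +
          ennreal a * (tail_op \<nu> s (\<lambda>y. ennreal (F y)) x / ennreal (F x)))
        \<longlongrightarrow> ennreal (s powr (-\<alpha>)) + ennreal a * (ennreal (s powr (-\<alpha>)) * moment \<nu> \<alpha>)) at_top"
      using s \<alpha> p \<mu>1 \<mu>p by (intro tendsto_add ennreal_tendsto_cmult tendsto_ennrealI
          regularly_varying_ratio[OF F] tail_op_ratio[where p=p] sets anti le1 F) auto
    moreover have "\<forall>\<^sub>F x in at_top. ennreal (F (s * x) / F x) +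
          ennreal a * (tail_op \<nu> s (\<lambda>y. ennreal (F y)) x / ennreal (F x)) = lhs s a x / ennreal (F x)"
      using eventually_gt_at_top[of 0]
    proof eventually_elim
      case (elim x)
      then show ?case using pos[of x] F0
        by (simp add: lhs_def add_divide_distrib_ennreal ennreal_times_divide divide_ennreal)
    qed
    moreover have "ennreal (s powr (-\<alpha>)) + ennreal a * (ennreal (s powr (-\<alpha>)) * moment \<nu> \<alpha>)
        = ennreal (s powr (-\<alpha>) * (1 + a * \<rho>))"
      using a m\<alpha> by (simp add: algebra_simps flip: ennreal_mult ennreal_plus)
    ultimately show ?thesis by (simp add: filterlim_cong[OF refl refl])
  qed
  have le_mult: "A / ennreal (F x) < ennreal a \<Longrightarrow> A \<le> ennreal (a * F x)"
      "ennreal a < A / ennreal (F x) \<Longrightarrow> ennreal (a * F x) \<le> A" if "x > 0" "a \<ge> 0" for A x a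
  proof -
    have fx: "ennreal (F x) \<noteq> 0" "ennreal (F x) \<noteq> top" using pos[OF that(1)] by auto
    have A: "A / ennreal (F x) * ennreal (F x) = A"
      using fx by (metis ennreal_mult_divide_eq ennreal_times_divide mult.commute)
    show "A / ennreal (F x) < ennreal a \<Longrightarrow> A \<le> ennreal (a * F x)"
      using mult_right_mono[of "A / ennreal (F x)" "ennreal a" "ennreal (F x)"] that
      by (simp add: A ennreal_mult F0 less_imp_le)
    show "ennreal a < A / ennreal (F x) \<Longrightarrow> ennreal (a * F x) \<le> A"
      using mult_right_mono[of "ennreal a" "A / ennreal (F x)" "ennreal (F x)"] that
      by (simp add: A ennreal_mult F0 less_imp_le)
  qed
  have lim1: "((\<lambda>s. s powr (-\<alpha>) * (1 + a * \<rho>)) \<longlongrightarrow> 1 powr (-\<alpha>) * (1 + a * \<rho>)) (at (1::real) within S)"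
    for a S
    by (intro tendsto_intros) auto
  have limp: "((\<lambda>s. s powr (-p) * \<mu>p) \<longlongrightarrow> 1 powr (-p) * \<mu>p) (at (1::real) within S)" for S
    by (intro tendsto_intros) auto
  have up: "\<exists>K. \<forall>x>0. G x \<le> a * F x + K * x powr (-p)" if a: "a > 1 / (1 - \<rho>)" for a
  proof -
    \<comment> \<open>The strict inequality for \<open>a\<close> leaves room for a dilation by some \<open>s < 1\<close>.\<close>
    have a0: "a > 0" using a m\<alpha> by (metis diff_gt_0_iff_gt divide_pos_pos less_trans zero_less_one)
    have a1: "1 + a * \<rho> < a" using a m\<alpha> by (simp add: field_simps)
    have "\<forall>\<^sub>F s in at_left 1. s powr (-\<alpha>) * (1 + a * \<rho>) < a"
      by (rule order_tendstoD(2)[OF lim1]) (use a1 in simp)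
    moreover have "\<forall>\<^sub>F s in at_left 1. s powr (-p) * \<mu>p < 1"
      by (rule order_tendstoD(2)[OF limp]) (use \<mu>p in simp)
    moreover have "\<forall>\<^sub>F s in at_left (1::real). max \<mu>1 0 < s \<and> s < 1"
      using eventually_at_left_real[of "max \<mu>1 0" 1] \<mu>1 by simp
    ultimately have "\<forall>\<^sub>F s in at_left 1. s powr (-\<alpha>) * (1 + a * \<rho>) < a \<and> s powr (-p) * \<mu>p < 1
        \<and> max \<mu>1 0 < s \<and> s < 1" by eventually_elim simp
    then obtain s where s: "s powr (-\<alpha>) * (1 + a * \<rho>) < a" "s powr (-p) * \<mu>p < 1"
        "\<mu>1 < s" "0 < s" "s < 1"
      using eventually_happens[of _ "at_left (1::real)"] by (auto simp: trivial_limit_at_left_real)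
    have "\<forall>\<^sub>F x in at_top. lhs s a x / ennreal (F x) < ennreal a"
      using s a0 by (intro order_tendstoD(2)[OF lhs_lim]) (auto intro!: ennreal_lessI)
    then have "\<forall>\<^sub>F x in at_top. lhs s a x \<le> ennreal (a * F x)"
      using eventually_gt_at_top[of 0] by eventually_elim (use a0 le_mult in auto)
    then obtain x1 where x1: "\<And>x. x \<ge> x1 \<Longrightarrow> lhs s a x \<le> ennreal (a * F x)"
      by (auto simp: eventually_at_top_linorder)
    obtain K where K: "K \<ge> 0" "\<And>x. x > 0 \<Longrightarrow> ennreal (G x) \<le> ennreal (F (s * x)) +
        tail_op \<nu> s (\<lambda>y. ennreal (G y)) x + ennreal (K * x powr (-p))"
      using upper[of s] s by auto
    obtain K' where K': "K' \<ge> max x1 0 powr p" "\<And>x. x > 0 \<Longrightarrow>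
        ennreal (K * x powr (-p)) + tail_op \<nu> s (\<lambda>y. ennreal (K' * y powr (-p))) x \<le> ennreal (K' * x powr (-p))"
      by (rule power_supersolution[OF sets s(4) \<mu>p(1,2) s(2) K(1), of "max x1 0 powr p"]) auto
    have K'0: "K' \<ge> 0" by (rule order.trans[OF _ K'(1)]) simp
    have "ennreal (G x) \<le> ennreal (a * F x) + ennreal (K' * x powr (-p))" if x: "x > 0" for x
    proof (rule tail_op_comparison[where \<nu>=\<nu> and s=s and T=x1 and \<kappa>=\<kappa> and
            L="\<lambda>x. ennreal (G x)" and U="\<lambda>x. ennreal (a * F x) + ennreal (K' * x powr (-p))" and
            b="\<lambda>x. ennreal (F (s * x)) + ennreal (K * x powr (-p))"])
      fix x :: real assume x: "x > 0"
      show "ennreal (G x) \<le> ennreal (F (s * x)) + ennreal (K * x powr (-p)) + tail_op \<nu> s (\<lambda>x. ennreal (G x)) x"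
        using K(2)[OF x] by (simp add: add_ac)
      show "ennreal (G x) \<le> ennreal (a * F x) + ennreal (K' * x powr (-p)) + ennreal (\<kappa> / x)"
        using G\<kappa>[OF x] by (simp add: add_increasing ennreal_leI)
      {
        assume "x \<ge> x1"
        have "tail_op \<nu> s (\<lambda>x. ennreal (a * F x) + ennreal (K' * x powr (-p))) x =
            ennreal a * tail_op \<nu> s (\<lambda>y. ennreal (F y)) x + tail_op \<nu> s (\<lambda>x. ennreal (K' * x powr (-p))) x"
          using a0 by (simp add: tail_op_add sets ennreal_mult' tail_op_cmult)
        then have "ennreal (F (s * x)) + ennreal (K * x powr (-p)) +
             tail_op \<nu> s (\<lambda>x. ennreal (a * F x) + ennreal (K' * x powr (-p))) x
          = lhs s a x + (ennreal (K * x powr (-p)) + tail_op \<nu> s (\<lambda>x. ennreal (K' * x powr (-p))) x)"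
          by (simp add: lhs_def add_ac)
        also have "\<dots> \<le> ennreal (a * F x) + ennreal (K' * x powr (-p))"
          by (intro add_mono x1 \<open>x \<ge> x1\<close> K' x)
        finally show "ennreal (F (s * x)) + ennreal (K * x powr (-p)) +
             tail_op \<nu> s (\<lambda>x. ennreal (a * F x) + ennreal (K' * x powr (-p))) x
             \<le> ennreal (a * F x) + ennreal (K' * x powr (-p))" .
      }
      {
        assume "x < x1"
        have "x powr p * x powr (-p) \<le> K' * x powr (-p)"
          using x \<open>x < x1\<close> p \<alpha> by (intro mult_right_mono order.trans[OF powr_mono2 K'(1)]) auto
        then have "G x \<le> K' * x powr (-p)" using G1[of x] x by (simp flip: powr_add)
        then show "ennreal (G x) \<le> ennreal (a * F x) + ennreal (K' * x powr (-p))"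
          by (simp add: add_increasing ennreal_leI)
      }
    qed (use s \<mu>1 \<kappa> x sets in \<open>auto simp: ennreal_less_iff\<close>)
    then have "G x \<le> a * F x + K' * x powr (-p)" if "x > 0" for x
      using that a0 K'0 F0 by (simp add: G0 flip: ennreal_plus)
    then show ?thesis by blast
  qed
  have low: "\<exists>K. \<forall>x>0. a * F x \<le> G x + K * x powr (-p)" if a: "0 \<le> a" "a < 1 / (1 - \<rho>)" for a
  proof -
    have a1: "1 + a * \<rho> > a" using a m\<alpha> by (simp add: field_simps)
    have "\<forall>\<^sub>F s in at_right 1. s powr (-\<alpha>) * (1 + a * \<rho>) > a"
      by (rule order_tendstoD(1)[OF lim1]) (use a1 in simp)
    moreover have "\<forall>\<^sub>F s in at_right 1. s powr (-p) * \<mu>p < 1"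
      by (rule order_tendstoD(2)[OF limp]) (use \<mu>p in simp)
    moreover have "\<forall>\<^sub>F s in at_right (1::real). 1 < s"
      by (simp add: eventually_at_right_less)
    ultimately have "\<forall>\<^sub>F s in at_right 1. s powr (-\<alpha>) * (1 + a * \<rho>) > a \<and> s powr (-p) * \<mu>p < 1
        \<and> 1 < s" by eventually_elim simp
    then obtain s where s: "s powr (-\<alpha>) * (1 + a * \<rho>) > a" "s powr (-p) * \<mu>p < 1" "1 < s"
      using eventually_happens[of _ "at_right (1::real)"] by (auto simp: trivial_limit_at_right_real)
    have "\<forall>\<^sub>F x in at_top. ennreal a < lhs s a x / ennreal (F x)"
      using s a by (intro order_tendstoD(1)[OF lhs_lim]) (auto simp: ennreal_less_iff)
    then have "\<forall>\<^sub>F x in at_top. ennreal (a * F x) \<le> lhs s a x"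
      using eventually_gt_at_top[of 0] by eventually_elim (use a le_mult in auto)
    then obtain x1 where x1: "\<And>x. x \<ge> x1 \<Longrightarrow> ennreal (a * F x) \<le> lhs s a x"
      by (auto simp: eventually_at_top_linorder)
    obtain K where K: "K \<ge> 0" "\<And>x. x > 0 \<Longrightarrow> ennreal (F (s * x)) +
        tail_op \<nu> s (\<lambda>y. ennreal (G y)) x \<le> ennreal (G x) + ennreal (K * x powr (-p))"
      using lower[of s] s by auto
    obtain K' where K': "K' \<ge> a * max x1 0 powr p" "\<And>x. x > 0 \<Longrightarrow>
        ennreal (K * x powr (-p)) + tail_op \<nu> s (\<lambda>y. ennreal (K' * y powr (-p))) x \<le> ennreal (K' * x powr (-p))"
      using s a by (auto intro: power_supersolution[OF sets _ \<mu>p(1,2) s(2) K(1), of "a * max x1 0 powr p"])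
    have K'0: "K' \<ge> 0" by (rule order.trans[OF _ K'(1)]) (use a in simp)
    have "ennreal (a * F x) \<le> ennreal (G x) + ennreal (K' * x powr (-p))" if x: "x > 0" for x
    proof (rule tail_op_comparison[where \<nu>=\<nu> and s=s and T=x1 and \<kappa>="a * \<kappa>" and
            L="\<lambda>x. ennreal (a * F x)" and U="\<lambda>x. ennreal (G x) + ennreal (K' * x powr (-p))" and
            b="\<lambda>x. ennreal (F (s * x))"])
      fix x :: real assume x: "x > 0"
      have "a * F x \<le> a * (\<kappa> / x)" using F\<kappa>[OF x] a by (intro mult_left_mono) auto
      then show "ennreal (a * F x) \<le> ennreal (G x) + ennreal (K' * x powr (-p)) + ennreal (a * \<kappa> / x)"
        by (simp add: add_increasing ennreal_leI)
      {
        assume "x \<ge> x1"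
        then show "ennreal (a * F x) \<le> ennreal (F (s * x)) + tail_op \<nu> s (\<lambda>x. ennreal (a * F x)) x"
          using x1[of x] a by (simp add: lhs_def ennreal_mult' tail_op_cmult sets)
        have "tail_op \<nu> s (\<lambda>x. ennreal (G x) + ennreal (K' * x powr (-p))) x =
            tail_op \<nu> s (\<lambda>y. ennreal (G y)) x + tail_op \<nu> s (\<lambda>x. ennreal (K' * x powr (-p))) x"
          by (intro tail_op_add sets) measurable
        then have "ennreal (F (s * x)) + tail_op \<nu> s (\<lambda>x. ennreal (G x) + ennreal (K' * x powr (-p))) x
           \<le> ennreal (G x) + (ennreal (K * x powr (-p)) + tail_op \<nu> s (\<lambda>x. ennreal (K' * x powr (-p))) x)"
          using add_right_mono[OF K(2)[OF x], of "tail_op \<nu> s (\<lambda>x. ennreal (K' * x powr (-p))) x"]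
          by (simp add: add_ac)
        also have "\<dots> \<le> ennreal (G x) + ennreal (K' * x powr (-p))"
          by (intro add_left_mono K' x)
        finally show "ennreal (F (s * x)) + tail_op \<nu> s (\<lambda>x. ennreal (G x) + ennreal (K' * x powr (-p))) x
             \<le> ennreal (G x) + ennreal (K' * x powr (-p))" .
      }
      {
        assume "x < x1"
        have "(a * x powr p) * x powr (-p) \<le> K' * x powr (-p)"
          using x \<open>x < x1\<close> p \<alpha> a
          by (intro mult_right_mono order.trans[OF mult_left_mono[OF powr_mono2] K'(1)]) auto
        moreover have "a * F x \<le> a * 1" by (intro mult_left_mono le1 a)
        ultimately have "a * F x \<le> K' * x powr (-p)" using x by (simp add: mult.assoc flip: powr_add)
        then show "ennreal (a * F x) \<le> ennreal (G x) + ennreal (K' * x powr (-p))"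
          by (simp add: add_increasing ennreal_leI)
      }
    qed (use s \<mu>1 \<kappa> x sets a in \<open>auto simp: ennreal_less_iff\<close>)
    then have "a * F x \<le> G x + K' * x powr (-p)" if "x > 0" for x
      using that G0 K'0 F0 a by (simp flip: ennreal_plus)
    then show ?thesis by blast
  qed
  show ?thesis
  proof (rule order_tendstoI)
    fix u assume u: "u < 1 / (1 - \<rho>)"
    define a where "a = max 0 ((u + 1 / (1 - \<rho>)) / 2)"
    have i: "1 / (1 - \<rho>) > 0" using m\<alpha> by simp
    have "0 \<le> a" "a < 1 / (1 - \<rho>)" "a > u \<or> u < 0"
      using u i by (auto simp: a_def max_def)
    then obtain K where K: "\<And>x. x > 0 \<Longrightarrow> a * F x \<le> G x + K * x powr (-p)" using low[of a] by auto
    show "\<forall>\<^sub>F x in at_top. u < G x / F x"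
    proof (cases "u < 0")
      case True
      show ?thesis using eventually_gt_at_top[of 0]
      proof eventually_elim
        case (elim x)
        then show ?case using pos[of x] G0[of x] True by (meson divide_nonneg_pos less_le_trans)
      qed
    next
      case False
      then have "a - u > 0" using \<open>a > u \<or> u < 0\<close> by simp
      have "\<forall>\<^sub>F x in at_top. K * x powr (-p) / F x < a - u"
        by (rule order_tendstoD(2)[OF negl]) fact
      then show ?thesis using eventually_gt_at_top[of 0]
      proof eventually_elim
        case (elim x)
        have "a \<le> G x / F x + K * x powr (-p) / F x"
          using K[of x] elim pos[of x] by (simp add: field_simps)
        then show ?case using elim by simp
      qed
    qed
  next
    fix u assume u: "u > 1 / (1 - \<rho>)"
    define a where "a = (u + 1 / (1 - \<rho>)) / 2"
    have a: "a > 1 / (1 - \<rho>)" "u - a > 0" using u by (auto simp: a_def)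
    then obtain K where K: "\<And>x. x > 0 \<Longrightarrow> G x \<le> a * F x + K * x powr (-p)" using up[of a] by auto
    have "\<forall>\<^sub>F x in at_top. K * x powr (-p) / F x < u - a"
      by (rule order_tendstoD(2)[OF negl]) fact
    then show "\<forall>\<^sub>F x in at_top. G x / F x < u" using eventually_gt_at_top[of 0]
    proof eventually_elim
      case (elim x)
      have "G x / F x \<le> a + K * x powr (-p) / F x"
        using K[of x] elim pos[of x] by (simp add: field_simps)
      then show ?case using elim by simp
    qed
  qed
qed

section \<open>Real powers of extended nonnegative reals\<close>

lemma ennreal_powr_ennreal: "x \<ge> 0 \<Longrightarrow> ennreal_powr (ennreal x) p = ennreal (x powr p)"
  by (simp add: ennreal_powr_def)

lemma ennreal_powr_mono:
  assumes "p \<ge> 0" "x \<le> y"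
  shows "ennreal_powr x p \<le> ennreal_powr y p"
  using assms by (cases x; cases y) (auto simp: ennreal_powr_def top_unique intro!: ennreal_leI powr_mono2)

lemma ennreal_powr_measurable[measurable (raw)]:
  assumes [measurable]: "f \<in> borel_measurable M"
  shows "(\<lambda>x. ennreal_powr (f x) p) \<in> borel_measurable M"
  unfolding ennreal_powr_def by measurable

lemma ennreal_powr_1: "ennreal_powr z 1 = z"
  by (cases z) (auto simp: ennreal_powr_def)

lemma ennreal_powr_mult_self: "p > 1 \<Longrightarrow> z * ennreal_powr z (p - 1) = ennreal_powr z p"
  by (cases z) (auto simp: ennreal_powr_def ennreal_mult_top powr_mult_base simp flip: ennreal_mult)

lemma ennreal_powr_add_le:
  assumes "p \<ge> 0"
  shows "ennreal_powr (x + y) p \<le> ennreal (2 powr p) * (ennreal_powr x p + ennreal_powr y p)"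
proof (cases "x = \<infinity> \<or> y = \<infinity>")
  case True
  then show ?thesis by (auto simp: ennreal_powr_def ennreal_mult_top)
next
  case False
  then obtain a b where ab: "x = ennreal a" "a \<ge> 0" "y = ennreal b" "b \<ge> 0"
    by (cases x; cases y) auto
  have "(a + b) powr p \<le> (2 * max a b) powr p"
    using ab assms by (intro powr_mono2) auto
  also have "\<dots> = 2 powr p * max a b powr p" using ab by (simp add: powr_mult)
  also have "\<dots> \<le> 2 powr p * (a powr p + b powr p)"
    by (intro mult_left_mono) (auto simp: max_def)
  finally show ?thesis
    using ab by (simp add: ennreal_powr_ennreal ennreal_leI flip: ennreal_mult ennreal_plus)
qed

section \<open>One big jump, pathwise\<close>

text \<open>The part of a power \<open>(\<Sum>j. b j) powr p\<close> in which at least two summands take part is of this form.\<close>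

definition cross_term :: "real \<Rightarrow> (nat \<Rightarrow> ennreal) \<Rightarrow> ennreal" where
  "cross_term p b = (\<Sum>j. b j * ennreal_powr (\<Sum>k. if k = j then 0 else b k) (p - 1))"

lemma suminf_ennreal_head: "(\<Sum>k. f k) = f 0 + (\<Sum>k. f (Suc k))" for f :: "nat \<Rightarrow> ennreal"
  by (subst suminf_offset[of f 1]) auto

lemma sums_le_suminf_ennreal:
  assumes "y sums S" and "\<And>k. ennreal \<bar>y k\<bar> \<le> b k"
  shows "ennreal S \<le> (\<Sum>k. b k)"
proof (rule LIMSEQ_le_const2)
  show "(\<lambda>n. ennreal (\<Sum>k<n. y k)) \<longlonglongrightarrow> ennreal S"
    using assms(1) by (intro tendsto_ennrealI) (simp add: sums_def)
  have "ennreal (\<Sum>k<n. y k) \<le> (\<Sum>k. b k)" for n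
  proof -
    have "ennreal (\<Sum>k<n. y k) \<le> ennreal (\<Sum>k<n. \<bar>y k\<bar>)"
      by (intro ennreal_leI sum_mono) simp
    also have "\<dots> = (\<Sum>k<n. ennreal \<bar>y k\<bar>)" by simp
    also have "\<dots> \<le> (\<Sum>k<n. b k)" by (intro sum_mono assms)
    also have "\<dots> \<le> (\<Sum>k. b k)" by (intro sum_le_suminf) auto
    finally show ?thesis .
  qed
  then show "\<exists>N. \<forall>n\<ge>N. ennreal (\<Sum>k<n. y k) \<le> (\<Sum>k. b k)" by auto
qed

lemma rest_bounds:
  assumes y: "y sums S" and b: "\<And>k. ennreal \<bar>y k\<bar> \<le> b k"
  shows "ennreal (S - y j) \<le> (\<Sum>k. if k = j then 0 else b k)"
    and "ennreal (y j - S) \<le> (\<Sum>k. if k = j then 0 else b k)"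
proof -
  have "(\<lambda>k. y k - (if k = j then y j else 0)) sums (S - y j)"
    by (intro sums_diff y sums_single[of j "\<lambda>_. y j"])
  moreover have "(\<lambda>k. y k - (if k = j then y j else 0)) = (\<lambda>k. if k = j then 0 else y k)" by auto
  ultimately have s: "(\<lambda>k. if k = j then 0 else y k) sums (S - y j)" by simp
  show "ennreal (S - y j) \<le> (\<Sum>k. if k = j then 0 else b k)"
    by (rule sums_le_suminf_ennreal[OF s]) (use b in auto)
  have "(\<lambda>k. - (if k = j then 0 else y k)) sums (- (S - y j))" by (rule sums_minus[OF s])
  then show "ennreal (y j - S) \<le> (\<Sum>k. if k = j then 0 else b k)"
    by (intro sums_le_suminf_ennreal) (use b in auto)
qed

lemma cross_term_scale:
  assumes "x > 0" "0 < e" "p > 1"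
  shows "ennreal (e powr (1 - p) * x powr (- p)) * (ennreal x * ennreal ((e * x) powr (p - 1))) = 1"
proof -
  have "e powr (1 - p) * x powr (- p) * (x * (e * x) powr (p - 1))
      = (e powr (1 - p) * e powr (p - 1)) * (x powr (- p) * (x powr 1 * x powr (p - 1)))"
    using assms by (simp add: powr_mult)
  also have "e powr (1 - p) * e powr (p - 1) = e powr ((1 - p) + (p - 1))" by (rule powr_add[symmetric])
  also have "x powr (- p) * (x powr 1 * x powr (p - 1)) = x powr (- p + (1 + (p - 1)))" by (simp only: powr_add)
  also have "e powr ((1 - p) + (p - 1)) * x powr (- p + (1 + (p - 1))) = 1" using assms by simp
  finally show ?thesis using assms by (simp add: mult.assoc flip: ennreal_mult)
qed

text \<open>If no summand exceeds \<open>(1 - e) * x\<close> but the sum exceeds \<open>x\<close>, then each summand leaves at least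
  \<open>e * x\<close> to the others, and the cross term is of the order of the full power \<open>x powr p\<close>.\<close>

lemma one_big_jump_upper:
  assumes y: "y sums S" and b: "\<And>k. ennreal \<bar>y k\<bar> \<le> b k" and x: "x > 0" and e: "0 < e" and p: "p > 1"
  shows "indicator {x<..} S \<le> (\<Sum>j. indicator {(1 - e) * x<..} (y j))
           + ennreal (e powr (1 - p) * x powr (- p)) * cross_term p b"
proof (cases "S > x \<and> (\<forall>j. y j \<le> (1 - e) * x)")
  case True
  have "ennreal x * ennreal ((e * x) powr (p - 1)) \<le> (\<Sum>j. b j) * ennreal ((e * x) powr (p - 1))"
    using True by (intro mult_right_mono order.trans[OF ennreal_leI sums_le_suminf_ennreal[OF y b]]) auto
  also have "\<dots> = (\<Sum>j. b j * ennreal ((e * x) powr (p - 1)))" by (rule ennreal_suminf_multc[symmetric])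
  also have "\<dots> \<le> cross_term p b"
    unfolding cross_term_def
  proof (intro suminf_le mult_left_mono)
    fix j
    have "y j \<le> (1 - e) * x" "x < S" using True by auto
    then have "e * x \<le> S - y j" by (simp add: left_diff_distrib)
    then have "ennreal (e * x) \<le> (\<Sum>k. if k = j then 0 else b k)"
      using rest_bounds(1)[OF y b, of j] by (meson ennreal_leI order.trans)
    then show "ennreal ((e * x) powr (p - 1)) \<le> ennreal_powr (\<Sum>k. if k = j then 0 else b k) (p - 1)"
      using x e p by (subst ennreal_powr_ennreal[symmetric]) (auto intro!: ennreal_powr_mono)
  qed auto
  finally have "ennreal (e powr (1 - p) * x powr (- p)) * (ennreal x * ennreal ((e * x) powr (p - 1)))
      \<le> ennreal (e powr (1 - p) * x powr (- p)) * cross_term p b"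
    by (rule mult_left_mono) simp
  then show ?thesis
    using True by (simp add: cross_term_scale[OF x e p] add_increasing)
next
  case False
  show ?thesis
  proof (cases "S > x")
    case True
    then obtain j where j: "y j > (1 - e) * x" using False by (auto simp: not_le)
    have "(1::ennreal) = (\<Sum>i\<in>{j}. indicator {(1 - e) * x<..} (y i))" using j by simp
    also have "\<dots> \<le> (\<Sum>i. indicator {(1 - e) * x<..} (y i))" by (intro sum_le_suminf) auto
    finally show ?thesis using True by (simp add: add_increasing2)
  qed simp
qed

text \<open>If a summand exceeds \<open>(1 + e) * x\<close> while the bounds of all others add up to less than \<open>e * x\<close>, it
  is the only such summand and forces the sum above \<open>x\<close>. Failing that, each summand above
  \<open>(1 + e) * x\<close> contributes a term of order \<open>x powr p\<close> to the cross term.\<close>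

lemma one_big_jump_lower:
  assumes y: "y sums S" and b: "\<And>k. ennreal \<bar>y k\<bar> \<le> b k" and x: "x > 0" and e: "0 < e" and p: "p > 1"
  shows "(\<Sum>j. indicator {(1 + e) * x<..} (y j)) \<le> indicator {x<..} S
           + ennreal (e powr (1 - p) * x powr (- p)) * cross_term p b"
proof -
  define D where "D j = (\<Sum>k. if k = j then 0 else b k)" for j
  show ?thesis
  proof (cases "\<exists>j. y j > (1 + e) * x \<and> D j < ennreal (e * x)")
    case True
    then obtain j where j: "y j > (1 + e) * x" "D j < ennreal (e * x)" by auto
    have other: "y i \<le> (1 + e) * x" if "i \<noteq> j" for i
    proof -
      have "ennreal (y i) \<le> (if i = j then 0 else b i)" using that
        by (auto intro: order.trans[OF ennreal_leI[OF abs_ge_self] b])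
      also have "\<dots> = (\<Sum>k\<in>{i}. if k = j then 0 else b k)" by simp
      also have "\<dots> \<le> D j" unfolding D_def by (intro sum_le_suminf) auto
      also note j(2)
      finally have "y i \<le> e * x" using x e by (metis ennreal_leI not_le less_imp_le)
      then show ?thesis using x by (simp add: algebra_simps)
    qed
    have "(\<Sum>i. indicator {(1 + e) * x<..} (y i)) = (\<Sum>i\<in>{j}. indicator {(1 + e) * x<..} (y i) :: ennreal)"
      using other by (intro suminf_finite) (auto simp: indicator_def not_less)
    also have "\<dots> = 1" using j by simp
    also have "(1::ennreal) = indicator {x<..} S"
    proof -
      have "ennreal (y j - S) < ennreal (e * x)"
        using rest_bounds(2)[OF y b, of j] j(2) by (simp add: D_def)
      then have "y j - S < e * x" using x e by (metis ennreal_leI not_le)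
      then show ?thesis using j(1) by (simp add: algebra_simps)
    qed
    finally show ?thesis by simp
  next
    case False
    have "(\<Sum>j. indicator {(1 + e) * x<..} (y j)) \<le>
      (\<Sum>j. ennreal (e powr (1 - p) * x powr (- p)) * (b j * ennreal_powr (D j) (p - 1)))"
    proof (intro suminf_le)
      fix j
      show "indicator {(1 + e) * x<..} (y j) \<le> ennreal (e powr (1 - p) * x powr (- p)) * (b j * ennreal_powr (D j) (p - 1))"
      proof (cases "y j > (1 + e) * x")
        case True
        then have D: "ennreal (e * x) \<le> D j" using False by (meson not_less)
        have "x \<le> y j" using True x e by (simp add: algebra_simps) (smt (verit) mult_pos_pos)
        then have "ennreal x \<le> b j" by (meson abs_ge_self b ennreal_leI order.trans)
        moreover have "ennreal ((e * x) powr (p - 1)) \<le> ennreal_powr (D j) (p - 1)"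
          using x e p D by (subst ennreal_powr_ennreal[symmetric]) (auto intro!: ennreal_powr_mono)
        ultimately have "ennreal (e powr (1 - p) * x powr (- p)) * (ennreal x * ennreal ((e * x) powr (p - 1)))
           \<le> ennreal (e powr (1 - p) * x powr (- p)) * (b j * ennreal_powr (D j) (p - 1))"
          by (intro mult_left_mono mult_mono) auto
        then show ?thesis using True by (simp add: cross_term_scale[OF x e p])
      qed simp
    qed auto
    also have "\<dots> = ennreal (e powr (1 - p) * x powr (- p)) * cross_term p b"
      unfolding cross_term_def D_def by (rule ennreal_suminf_cmult)
    finally show ?thesis by (simp add: add_increasing)
  qed
qed

text \<open>Jensen's inequality for the weights \<open>c j / z\<close>, in the tangent form of Young's inequality. The
  summand \<open>z powr q\<close> covers \<open>S \<le> z\<close> and makes exponents \<open>q < 1\<close> admissible.\<close>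

lemma weighted_sum_powr_le:
  fixes c :: "nat \<Rightarrow> real" and \<beta> :: "nat \<Rightarrow> ennreal"
  assumes c: "\<And>j. c j \<ge> 0" and z: "(\<Sum>j. ennreal (c j)) = ennreal z" "z \<ge> 0"
    and S: "(\<Sum>j. ennreal (c j) * \<beta> j) = ennreal S" "S \<ge> 0"
    and q: "q > 0" and r: "r \<ge> 1" "r \<ge> q"
  shows "ennreal (S powr q) \<le> ennreal (z powr q) + (\<Sum>j. ennreal (c j * z powr (q - 1)) * ennreal_powr (\<beta> j) r)"
proof (cases "S \<le> z")
  case True
  then have "ennreal (S powr q) \<le> ennreal (z powr q)" using S q by (intro ennreal_leI powr_mono2) auto
  then show ?thesis by (simp add: add_increasing2)
next
  case False
  have z0: "z > 0"
  proof (rule ccontr)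
    assume "\<not> z > 0"
    then have "(\<Sum>j. ennreal (c j)) = 0" using z by simp
    then have "ennreal (c j) = 0" for j by (simp add: suminf_eq_zero_iff)
    then have "ennreal S = 0" using S by simp
    then show False using False z S by simp
  qed
  define m where "m = S / z"
  have m: "m > 1" "S = m * z" using False z0 by (auto simp: m_def)
  define V where "V = (\<Sum>j. ennreal (c j) * ennreal_powr (\<beta> j) r)"
  have tangent: "ennreal (r * m powr (r - 1)) * \<beta>' \<le> ennreal_powr \<beta>' r + ennreal ((r - 1) * m powr r)" for \<beta>'
  proof (cases \<beta>')
    case (real a)
    have "r * m powr (r - 1) * a \<le> a powr r + (r - 1) * m powr r"
    proof (cases "a = 0")
      case False
      have "(a powr r) powr (1 / r) * (m powr r) powr ((r - 1) / r) \<le> 1 / r * a powr r + (r - 1) / r * m powr r"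
        using r m False real by (intro Youngs_inequality_0) (auto simp: divide_simps)
      then have "r * (a * m powr (r - 1)) \<le> r * (1 / r * a powr r + (r - 1) / r * m powr r)"
        using r real False by (intro mult_left_mono) (auto simp: powr_powr)
      also have "\<dots> = a powr r + (r - 1) * m powr r" using r by (simp add: field_simps)
      finally show ?thesis by (simp add: mult_ac)
    qed (use r in simp)
    then show ?thesis using real r
      by (simp add: ennreal_powr_ennreal ennreal_leI flip: ennreal_mult ennreal_plus)
  qed (simp add: ennreal_powr_def)
  have "ennreal (r * m powr (r - 1)) * ennreal S = (\<Sum>j. ennreal (c j) * (ennreal (r * m powr (r - 1)) * \<beta> j))"
    unfolding S(1)[symmetric] by (simp add: mult_ac flip: ennreal_suminf_cmult)
  also have "\<dots> \<le> (\<Sum>j. ennreal (c j) * (ennreal_powr (\<beta> j) r + ennreal ((r - 1) * m powr r)))"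
    by (intro suminf_le mult_left_mono tangent) auto
  also have "\<dots> = V + ennreal z * ennreal ((r - 1) * m powr r)"
    unfolding V_def z(1)[symmetric] by (simp add: distrib_left suminf_add[symmetric] flip: ennreal_suminf_multc)
  finally have *: "ennreal (r * m powr (r - 1)) * ennreal S \<le> V + ennreal z * ennreal ((r - 1) * m powr r)" .
  have V: "ennreal (z * m powr r) \<le> V"
  proof (cases V)
    case (real v)
    have "r * m powr (r - 1) * S \<le> v + z * ((r - 1) * m powr r)"
      using * real r S z by (simp flip: ennreal_mult ennreal_plus)
    moreover have "m powr (r - 1) * S = z * m powr r" using m by (simp add: powr_diff)
    then have "r * m powr (r - 1) * S = r * (z * m powr r)" by (simp add: mult.assoc)
    moreover have "z * ((r - 1) * m powr r) = r * (z * m powr r) - z * m powr r" by (simp add: algebra_simps)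
    ultimately have "z * m powr r \<le> v" by linarith
    then show ?thesis using real by (simp add: ennreal_leI)
  qed simp
  have "S powr q = z powr q * m powr q" using m z0 by (simp add: powr_mult)
  also have "\<dots> \<le> z powr q * m powr r" using m r by (intro mult_left_mono powr_mono) auto
  also have "z powr q = z powr (q - 1) * z" using z0 by (simp add: powr_diff)
  finally have "ennreal (S powr q) \<le> ennreal (z powr (q - 1)) * ennreal (z * m powr r)"
    using z0 by (simp add: ennreal_leI mult.assoc flip: ennreal_mult)
  also have "\<dots> \<le> ennreal (z powr (q - 1)) * V" by (intro mult_left_mono V) auto
  also have "\<dots> = (\<Sum>j. ennreal (c j * z powr (q - 1)) * ennreal_powr (\<beta> j) r)"
    unfolding V_def using c by (simp add: ennreal_mult mult_ac flip: ennreal_suminf_cmult)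
  finally show ?thesis by (simp add: add_increasing)
qed


section \<open>One step of the recursion\<close>

lemma measurable_pair_count_space:
  fixes f :: "'i::countable \<Rightarrow> 'a \<Rightarrow> 'b::topological_space"
  assumes [measurable]: "\<And>i. f i \<in> borel_measurable M"
  shows "(\<lambda>(x, i). f i x) \<in> borel_measurable (M \<Otimes>\<^sub>M count_space UNIV)"
proof -
  have "(\<lambda>z. (\<lambda>x. f (snd z) x) (fst z)) \<in> borel_measurable (M \<Otimes>\<^sub>M count_space UNIV)"
    by measurable
  then show ?thesis by (simp add: case_prod_beta')
qed

text \<open>The equation \<open>law\<close> states at once that \<open>X\<close> is independent of \<open>Y\<close> and distributed as \<open>X'\<close>.\<close>

lemma (in prob_space) nn_integral_product_law:
  assumes X[measurable]: "X \<in> measurable M S" and X'[measurable]: "X' \<in> measurable M S"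
    and Y[measurable]: "Y \<in> measurable M T"
    and law: "distr M (S \<Otimes>\<^sub>M T) (\<lambda>\<omega>. (X \<omega>, Y \<omega>)) = distr M S X' \<Otimes>\<^sub>M distr M T Y"
    and h[measurable]: "h \<in> borel_measurable (S \<Otimes>\<^sub>M T)"
  shows "(\<integral>\<^sup>+\<omega>. h (X \<omega>, Y \<omega>) \<partial>M) = (\<integral>\<^sup>+\<omega>. (\<integral>\<^sup>+\<omega>'. h (X' \<omega>', Y \<omega>) \<partial>M) \<partial>M)"
proof -
  interpret X: prob_space "distr M S X'" by (rule prob_space_distr) simp
  interpret Y: prob_space "distr M T Y" by (rule prob_space_distr) simp
  interpret XY: pair_sigma_finite "distr M S X'" "distr M T Y" ..
  have "(\<integral>\<^sup>+\<omega>. h (X \<omega>, Y \<omega>) \<partial>M) = (\<integral>\<^sup>+z. h z \<partial>distr M (S \<Otimes>\<^sub>M T) (\<lambda>\<omega>. (X \<omega>, Y \<omega>)))"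
    by (subst nn_integral_distr) auto
  also have "\<dots> = (\<integral>\<^sup>+z. h z \<partial>(distr M S X' \<Otimes>\<^sub>M distr M T Y))"
    by (simp add: law)
  also have "\<dots> = (\<integral>\<^sup>+y. (\<integral>\<^sup>+x. h (x, y) \<partial>distr M S X') \<partial>distr M T Y)"
    by (subst XY.nn_integral_snd[symmetric]) auto
  also have "\<dots> = (\<integral>\<^sup>+\<omega>. (\<integral>\<^sup>+x. h (x, Y \<omega>) \<partial>distr M S X') \<partial>M)"
    by (subst nn_integral_distr) auto
  also have "\<dots> = (\<integral>\<^sup>+\<omega>. (\<integral>\<^sup>+\<omega>'. h (X' \<omega>', Y \<omega>) \<partial>M) \<partial>M)"
    using measurable_space[OF Y] by (intro nn_integral_cong, subst nn_integral_distr) auto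
  finally show ?thesis .
qed

lemma (in prob_space) product_law_compose:
  assumes X[measurable]: "X \<in> measurable M S" and X'[measurable]: "X' \<in> measurable M S"
    and Y[measurable]: "Y \<in> measurable M T"
    and law: "distr M (S \<Otimes>\<^sub>M T) (\<lambda>\<omega>. (X \<omega>, Y \<omega>)) = distr M S X' \<Otimes>\<^sub>M distr M T Y"
    and f[measurable]: "f \<in> measurable S S'" and g[measurable]: "g \<in> measurable T T'"
  shows "distr M (S' \<Otimes>\<^sub>M T') (\<lambda>\<omega>. (f (X \<omega>), g (Y \<omega>)))
    = distr M S' (\<lambda>\<omega>. f (X' \<omega>)) \<Otimes>\<^sub>M distr M T' (\<lambda>\<omega>. g (Y \<omega>))"
proof -
  have "distr M (S' \<Otimes>\<^sub>M T') (\<lambda>\<omega>. (f (X \<omega>), g (Y \<omega>)))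
    = distr (distr M (S \<Otimes>\<^sub>M T) (\<lambda>\<omega>. (X \<omega>, Y \<omega>))) (S' \<Otimes>\<^sub>M T') (\<lambda>(x, y). (f x, g y))"
    by (subst distr_distr) (auto simp: comp_def)
  also have "\<dots> = distr (distr M S X') S' f \<Otimes>\<^sub>M distr (distr M T Y) T' g"
    unfolding law
  proof (rule pair_measure_distr[symmetric])
    have "prob_space (distr (distr M T Y) T' g)"
      by (intro prob_space.prob_space_distr prob_space_distr) auto
    then show "sigma_finite_measure (distr (distr M T Y) T' g)"
      by (simp add: prob_space_imp_sigma_finite)
  qed auto
  also have "distr (distr M S X') S' f = distr M S' (\<lambda>\<omega>. f (X' \<omega>))"
    by (subst distr_distr) (auto simp: comp_def)
  also have "distr (distr M T Y) T' g = distr M T' (\<lambda>\<omega>. g (Y \<omega>))"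
    by (subst distr_distr) (auto simp: comp_def)
  finally show ?thesis .
qed

abbreviation rest_space :: "(real \<times> (nat \<Rightarrow> real) \<times> (nat \<Rightarrow> ennreal)) measure" where
  "rest_space \<equiv> borel \<Otimes>\<^sub>M (\<Pi>\<^sub>M k\<in>UNIV. borel) \<Otimes>\<^sub>M (\<Pi>\<^sub>M k\<in>UNIV. borel)"

abbreviation (in prob_space) mean :: "('a \<Rightarrow> ennreal) \<Rightarrow> ennreal" where
  "mean f \<equiv> \<integral>\<^sup>+\<omega>. f \<omega> \<partial>M"

text \<open>A recursion with nonnegative terms. It will majorize the recursion for the total weight, and all
  moment estimates are made for \<open>B\<close>. By \<open>B'_law\<close> each \<open>B' j\<close> is a copy of \<open>B\<close> that is independent of
  \<open>q\<close>, of all weights and of the other copies jointly; its own entry in that list is overwritten by \<open>0\<close>.\<close>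

locale linear_recursion = prob_space M for M :: "'w measure" +
  fixes q :: "'w \<Rightarrow> real" and c :: "nat \<Rightarrow> 'w \<Rightarrow> real"
    and B :: "'w \<Rightarrow> ennreal" and B' :: "nat \<Rightarrow> 'w \<Rightarrow> ennreal"
  assumes q_measurable[measurable]: "q \<in> borel_measurable M"
    and c_measurable[measurable]: "\<And>j. c j \<in> borel_measurable M"
    and B_measurable[measurable]: "B \<in> borel_measurable M"
    and c_nonneg: "\<And>j \<omega>. c j \<omega> \<ge> 0"
    and B_rec: "AE \<omega> in M. B \<omega> = ennreal \<bar>q \<omega>\<bar> + (\<Sum>j. ennreal (c j \<omega>) * B' j \<omega>)"
    and B'_measurable[measurable]: "\<And>j. B' j \<in> borel_measurable M"
    and B'_law: "\<And>j. distr M (borel \<Otimes>\<^sub>M rest_space)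
        (\<lambda>\<omega>. (B' j \<omega>, q \<omega>, \<lambda>k. c k \<omega>, \<lambda>k. if k = j then 0 else B' k \<omega>)) =
      distr M borel B \<Otimes>\<^sub>M distr M rest_space
        (\<lambda>\<omega>. (q \<omega>, \<lambda>k. c k \<omega>, \<lambda>k. if k = j then 0 else B' k \<omega>))"
begin

definition intensity :: "real measure" where
  "intensity = distr (M \<Otimes>\<^sub>M count_space UNIV) borel (\<lambda>(\<omega>, j). c j \<omega>)"

definition Z :: "'w \<Rightarrow> ennreal" where
  "Z \<omega> = (\<Sum>j. ennreal (c j \<omega>))"

definition summand :: "'w \<Rightarrow> nat \<Rightarrow> ennreal" where
  "summand \<omega> j = (case j of 0 \<Rightarrow> ennreal \<bar>q \<omega>\<bar> | Suc j \<Rightarrow> ennreal (c j \<omega>) * B' j \<omega>)"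

lemma Z_measurable[measurable]: "Z \<in> borel_measurable M"
  unfolding Z_def by measurable

lemma summand_measurable[measurable]: "(\<lambda>\<omega>. summand \<omega> j) \<in> borel_measurable M"
  unfolding summand_def by (cases j) simp_all

lemma sets_intensity[measurable_cong]: "sets intensity = sets borel"
  by (simp add: intensity_def)

lemma nn_integral_intensity:
  assumes [measurable]: "g \<in> borel_measurable borel"
  shows "(\<integral>\<^sup>+x. g x \<partial>intensity) = mean (\<lambda>\<omega>. (\<Sum>j. g (c j \<omega>)))"
proof -
  interpret N: sigma_finite_measure "count_space UNIV :: nat measure"
    by (rule sigma_finite_measure_count_space)
  have [measurable]: "(\<lambda>(\<omega>, j). c j \<omega>) \<in> borel_measurable (M \<Otimes>\<^sub>M count_space UNIV)"
    by (rule measurable_pair_count_space) measurable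
  have "(\<integral>\<^sup>+x. g x \<partial>intensity) = (\<integral>\<^sup>+z. g (case z of (\<omega>, j) \<Rightarrow> c j \<omega>) \<partial>(M \<Otimes>\<^sub>M count_space UNIV))"
    unfolding intensity_def by (subst nn_integral_distr) auto
  also have "\<dots> = mean (\<lambda>\<omega>. (\<integral>\<^sup>+j. g (c j \<omega>) \<partial>count_space UNIV))"
    by (subst N.nn_integral_fst[symmetric]) auto
  finally show ?thesis by (simp add: nn_integral_count_space_nat)
qed

lemma moment_intensity_1: "moment intensity 1 = mean Z"
  unfolding moment_def Z_def
  by (subst nn_integral_intensity)
     (auto intro!: nn_integral_cong suminf_cong simp: indicator_def c_nonneg less_le)

lemma nn_integral_B'_mult:
  assumes [measurable]: "\<phi> \<in> borel_measurable borel"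
    "g \<in> borel_measurable rest_space"
  shows "mean (\<lambda>\<omega>. \<phi> (B' j \<omega>) * g (q \<omega>, \<lambda>k. c k \<omega>, \<lambda>k. if k = j then 0 else B' k \<omega>))
    = mean (\<lambda>\<omega>. \<phi> (B \<omega>)) * mean (\<lambda>\<omega>. g (q \<omega>, \<lambda>k. c k \<omega>, \<lambda>k. if k = j then 0 else B' k \<omega>))"
proof -
  let ?O = "\<lambda>\<omega>. (q \<omega>, \<lambda>k. c k \<omega>, \<lambda>k. if k = j then 0 else B' k \<omega>)"
  have O[measurable]: "?O \<in> measurable M rest_space"
    by (intro measurable_Pair measurable_PiM_single') auto
  have gO: "(\<lambda>\<omega>. g (?O \<omega>)) \<in> borel_measurable M"
    by (rule measurable_compose[OF O]) measurable
  have "mean (\<lambda>\<omega>. \<phi> (B' j \<omega>) * g (?O \<omega>))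
      = mean (\<lambda>\<omega>. (\<integral>\<^sup>+\<omega>'. \<phi> (B \<omega>') * g (?O \<omega>) \<partial>M))"
    using nn_integral_product_law[OF B'_measurable B_measurable O B'_law, of "\<lambda>(x, y). \<phi> x * g y"] by simp
  also have "\<dots> = mean (\<lambda>\<omega>. (\<integral>\<^sup>+\<omega>'. \<phi> (B \<omega>') \<partial>M) * g (?O \<omega>))"
    by (subst nn_integral_multc) auto
  also have "\<dots> = mean (\<lambda>\<omega>. \<phi> (B \<omega>)) * mean (\<lambda>\<omega>. g (?O \<omega>))"
    by (rule nn_integral_cmult[OF gO])
  finally show ?thesis .
qed

lemma AE_finite_of_moment:
  assumes "mean f < \<infinity>" and "f \<in> borel_measurable M"
  shows "AE \<omega> in M. f \<omega> \<noteq> \<infinity>"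
  using nn_integral_PInf_AE[of f M] assms by auto

definition children_sum :: "'w \<Rightarrow> ennreal" where
  "children_sum \<omega> = (\<Sum>j. ennreal (c j \<omega>) * B' j \<omega>)"

lemma children_sum_measurable[measurable]: "children_sum \<in> borel_measurable M"
  unfolding children_sum_def by measurable

text \<open>The factor \<open>g\<close> is a function of \<open>q\<close> and \<open>c\<close> only. Taking conditional expectations given \<open>(q, c)\<close>
  in Jensen's inequality replaces the powers of \<open>B' j\<close> by moments of \<open>B\<close>, so that \<open>children_sum\<close> behaves like \<open>Z\<close>.\<close>

lemma children_sum_moment:
  assumes g[measurable]: "g \<in> borel_measurable (borel \<Otimes>\<^sub>M (\<Pi>\<^sub>M k\<in>UNIV. borel))"
    and B1: "mean B < \<infinity>" and Z1: "mean Z < \<infinity>" and s: "s > 0" and r: "r \<ge> 1" "r \<ge> s"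
  shows "mean (\<lambda>\<omega>. g (q \<omega>, \<lambda>k. c k \<omega>) * ennreal_powr (children_sum \<omega>) s)
    \<le> (1 + mean (\<lambda>\<omega>. ennreal_powr (B \<omega>) r)) * mean (\<lambda>\<omega>. g (q \<omega>, \<lambda>k. c k \<omega>) * ennreal_powr (Z \<omega>) s)"
proof -
  let ?g = "\<lambda>\<omega>. g (q \<omega>, \<lambda>k. c k \<omega>)"
  define w where "w = (\<lambda>j (x, y). g (x, y) * ennreal (y j * enn2real (\<Sum>k. ennreal (y k)) powr (s - 1)))"
  have w[measurable]: "w j \<in> borel_measurable (borel \<Otimes>\<^sub>M (\<Pi>\<^sub>M k\<in>UNIV. borel))" for j
    unfolding w_def by measurable
  have w_eq: "w j (q \<omega>, \<lambda>k. c k \<omega>) = ?g \<omega> * ennreal (c j \<omega> * enn2real (Z \<omega>) powr (s - 1))" for j \<omega>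
    by (simp add: w_def Z_def)
  have qc[measurable]: "(\<lambda>\<omega>. (q \<omega>, \<lambda>k. c k \<omega>)) \<in> measurable M (borel \<Otimes>\<^sub>M (\<Pi>\<^sub>M k\<in>UNIV. borel))"
    by (intro measurable_Pair measurable_PiM_single') auto
  have wm[measurable]: "(\<lambda>\<omega>. w j (q \<omega>, \<lambda>k. c k \<omega>)) \<in> borel_measurable M" for j
    by (rule measurable_compose[OF qc w])
  have gm[measurable]: "?g \<in> borel_measurable M"
    by (rule measurable_compose[OF qc g])
  have Zfin: "AE \<omega> in M. Z \<omega> \<noteq> \<infinity>" by (rule AE_finite_of_moment[OF Z1]) measurable
  have Sfin: "AE \<omega> in M. children_sum \<omega> \<noteq> \<infinity>"
    using AE_finite_of_moment[OF B1 B_measurable] B_rec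
    by eventually_elim (auto simp: children_sum_def)
  have "AE \<omega> in M. ?g \<omega> * ennreal_powr (children_sum \<omega>) s
      \<le> ?g \<omega> * ennreal_powr (Z \<omega>) s + (\<Sum>j. ennreal_powr (B' j \<omega>) r * w j (q \<omega>, \<lambda>k. c k \<omega>))"
    using Zfin Sfin
  proof eventually_elim
    case (elim \<omega>)
    obtain z where z: "Z \<omega> = ennreal z" "z \<ge> 0" using elim by (cases "Z \<omega>") auto
    obtain t where t: "children_sum \<omega> = ennreal t" "t \<ge> 0" using elim by (cases "children_sum \<omega>") auto
    have "ennreal (t powr s) \<le> ennreal (z powr s) +
        (\<Sum>j. ennreal (c j \<omega> * z powr (s - 1)) * ennreal_powr (B' j \<omega>) r)"
      by (rule weighted_sum_powr_le) (use z t s r c_nonneg in \<open>auto simp: Z_def children_sum_def\<close>)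
    then have "?g \<omega> * ennreal (t powr s) \<le> ?g \<omega> * (ennreal (z powr s) +
        (\<Sum>j. ennreal (c j \<omega> * z powr (s - 1)) * ennreal_powr (B' j \<omega>) r))"
      by (rule mult_left_mono) simp
    then show ?case
      by (simp add: z t ennreal_powr_ennreal w_eq distrib_left mult_ac flip: ennreal_suminf_cmult)
  qed
  then have "mean (\<lambda>\<omega>. ?g \<omega> * ennreal_powr (children_sum \<omega>) s) \<le>
      mean (\<lambda>\<omega>. ?g \<omega> * ennreal_powr (Z \<omega>) s + (\<Sum>j. ennreal_powr (B' j \<omega>) r * w j (q \<omega>, \<lambda>k. c k \<omega>)))"
    by (rule nn_integral_mono_AE)
  also have "\<dots> = mean (\<lambda>\<omega>. ?g \<omega> * ennreal_powr (Z \<omega>) s) +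
      (\<Sum>j. \<integral>\<^sup>+\<omega>. ennreal_powr (B' j \<omega>) r * w j (q \<omega>, \<lambda>k. c k \<omega>) \<partial>M)"
    by (subst nn_integral_add) (auto simp: nn_integral_suminf)
  also have "(\<lambda>j. \<integral>\<^sup>+\<omega>. ennreal_powr (B' j \<omega>) r * w j (q \<omega>, \<lambda>k. c k \<omega>) \<partial>M)
      = (\<lambda>j. mean (\<lambda>\<omega>. ennreal_powr (B \<omega>) r) * mean (\<lambda>\<omega>. w j (q \<omega>, \<lambda>k. c k \<omega>)))"
  proof
    fix j
    have "(\<lambda>(x, y, z). w j (x, y)) \<in> borel_measurable rest_space"
      by measurable
    from nn_integral_B'_mult[of "\<lambda>x. ennreal_powr x r", OF _ this, of j]
    show "mean (\<lambda>\<omega>. ennreal_powr (B' j \<omega>) r * w j (q \<omega>, \<lambda>k. c k \<omega>))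
      = mean (\<lambda>\<omega>. ennreal_powr (B \<omega>) r) * mean (\<lambda>\<omega>. w j (q \<omega>, \<lambda>k. c k \<omega>))"
      by simp
  qed
  also have "(\<Sum>j. mean (\<lambda>\<omega>. ennreal_powr (B \<omega>) r) * mean (\<lambda>\<omega>. w j (q \<omega>, \<lambda>k. c k \<omega>)))
      = mean (\<lambda>\<omega>. ennreal_powr (B \<omega>) r) * mean (\<lambda>\<omega>. (\<Sum>j. w j (q \<omega>, \<lambda>k. c k \<omega>)))"
    by (simp add: nn_integral_suminf)
  also have "mean (\<lambda>\<omega>. (\<Sum>j. w j (q \<omega>, \<lambda>k. c k \<omega>))) = mean (\<lambda>\<omega>. ?g \<omega> * ennreal_powr (Z \<omega>) s)"
  proof (rule nn_integral_cong_AE)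
    show "AE \<omega> in M. (\<Sum>j. w j (q \<omega>, \<lambda>k. c k \<omega>)) = ?g \<omega> * ennreal_powr (Z \<omega>) s"
      using Zfin
    proof eventually_elim
      case (elim \<omega>)
      obtain z where z: "Z \<omega> = ennreal z" "z \<ge> 0" using elim by (cases "Z \<omega>") auto
      have "(\<Sum>j. w j (q \<omega>, \<lambda>k. c k \<omega>)) = ?g \<omega> * (Z \<omega> * ennreal (z powr (s - 1)))"
        using c_nonneg by (simp add: w_eq z(1) ennreal_mult z(2)) (simp add: Z_def z(1)[symmetric])
      also have "Z \<omega> * ennreal (z powr (s - 1)) = ennreal_powr (Z \<omega>) s"
        using z powr_mult_base[OF z(2), of "s - 1"] by (simp add: ennreal_powr_ennreal flip: ennreal_mult)
      finally show ?case .
    qed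
  qed
  finally show ?thesis by (simp add: distrib_right)
qed

text \<open>Pulling one factor \<open>B' j\<close> out of the cross term leaves only powers \<open>p - 1\<close> of the remaining sum,
  so moments of \<open>B\<close> of order \<open>max 1 (p - 1)\<close>, not \<open>p\<close>, suffice.\<close>

lemma cross_term_integrable:
  assumes p: "p > 1" and B1: "mean B < \<infinity>"
    and Br: "mean (\<lambda>\<omega>. ennreal_powr (B \<omega>) (max 1 (p - 1))) < \<infinity>"
    and Z1: "mean Z < \<infinity>"
    and Zp: "mean (\<lambda>\<omega>. ennreal_powr (Z \<omega>) p) < \<infinity>"
    and qZ: "mean (\<lambda>\<omega>. ennreal \<bar>q \<omega>\<bar> * ennreal_powr (Z \<omega>) (p - 1)) < \<infinity>"
    and Zq: "mean (\<lambda>\<omega>. Z \<omega> * ennreal_powr (ennreal \<bar>q \<omega>\<bar>) (p - 1)) < \<infinity>"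
  shows "mean (\<lambda>\<omega>. cross_term p (summand \<omega>)) < \<infinity>"
proof -
  define \<sigma> where "\<sigma> = p - 1"
  define r where "r = max 1 \<sigma>"
  have s: "\<sigma> > 0" "r \<ge> 1" "r \<ge> \<sigma>" using p by (auto simp: \<sigma>_def r_def)
  define H where "H = 1 + mean (\<lambda>\<omega>. ennreal_powr (B \<omega>) r)"
  have H: "H < \<infinity>" using Br by (simp add: H_def r_def \<sigma>_def)
  define D where "D j \<omega> = ennreal \<bar>q \<omega>\<bar> + (\<Sum>k. ennreal (c k \<omega>) * (if k = j then 0 else B' k \<omega>))" for j \<omega>
  have [measurable]: "D j \<in> borel_measurable M" for j unfolding D_def by measurable
  have D_le: "D j \<omega> \<le> ennreal \<bar>q \<omega>\<bar> + children_sum \<omega>" for j \<omega>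
    unfolding D_def children_sum_def by (intro add_left_mono suminf_le) auto
  have split: "cross_term p (summand \<omega>) = ennreal \<bar>q \<omega>\<bar> * ennreal_powr (children_sum \<omega>) \<sigma>
      + (\<Sum>j. B' j \<omega> * (ennreal (c j \<omega>) * ennreal_powr (D j \<omega>) \<sigma>))" for \<omega>
  proof -
    have D: "(\<Sum>k. if k = Suc j then 0 else summand \<omega> k) = D j \<omega>" for j
      by (subst suminf_ennreal_head) (auto simp: summand_def D_def intro!: arg_cong[where f=suminf])
    have D0: "(\<Sum>k. if k = 0 then 0 else summand \<omega> k) = children_sum \<omega>"
      by (subst suminf_ennreal_head) (simp add: summand_def children_sum_def)
    show ?thesis
      unfolding cross_term_def by (subst suminf_ennreal_head) (simp add: D D0 \<sigma>_def, simp add: summand_def mult_ac)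
  qed
  have first: "mean (\<lambda>\<omega>. ennreal \<bar>q \<omega>\<bar> * ennreal_powr (children_sum \<omega>) \<sigma>) < \<infinity>"
  proof -
    have "mean (\<lambda>\<omega>. ennreal \<bar>q \<omega>\<bar> * ennreal_powr (children_sum \<omega>) \<sigma>)
       \<le> H * mean (\<lambda>\<omega>. ennreal \<bar>q \<omega>\<bar> * ennreal_powr (Z \<omega>) \<sigma>)"
      using children_sum_moment[of "\<lambda>(x, y). ennreal \<bar>x\<bar>", OF _ B1 Z1 s] by (simp add: H_def)
    also have "\<dots> < \<infinity>" using H qZ by (simp add: ennreal_mult_less_top \<sigma>_def)
    finally show ?thesis .
  qed
  have second: "mean (\<lambda>\<omega>. Z \<omega> * ennreal_powr (children_sum \<omega>) \<sigma>) < \<infinity>"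
  proof -
    have "mean (\<lambda>\<omega>. Z \<omega> * ennreal_powr (children_sum \<omega>) \<sigma>)
       \<le> H * mean (\<lambda>\<omega>. Z \<omega> * ennreal_powr (Z \<omega>) \<sigma>)"
      using children_sum_moment[of "\<lambda>(x, y). \<Sum>k. ennreal (y k)", OF _ B1 Z1 s] by (simp add: H_def Z_def)
    also have "\<dots> = H * mean (\<lambda>\<omega>. ennreal_powr (Z \<omega>) p)"
      using p by (simp add: \<sigma>_def ennreal_powr_mult_self)
    also have "\<dots> < \<infinity>" using H Zp by (simp add: ennreal_mult_less_top)
    finally show ?thesis .
  qed
  have "(\<Sum>j. \<integral>\<^sup>+\<omega>. B' j \<omega> * (ennreal (c j \<omega>) * ennreal_powr (D j \<omega>) \<sigma>) \<partial>M)
      = (\<Sum>j. mean B * mean (\<lambda>\<omega>. ennreal (c j \<omega>) * ennreal_powr (D j \<omega>) \<sigma>))"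
  proof (intro arg_cong[where f=suminf] ext)
    fix j
    have "(\<lambda>(x, y, z). ennreal (y j) * ennreal_powr (ennreal \<bar>x\<bar> + (\<Sum>k. ennreal (y k) * z k)) \<sigma>) \<in>
      borel_measurable rest_space"
      by measurable
    from nn_integral_B'_mult[of "\<lambda>x. x", OF _ this, of j]
    show "mean (\<lambda>\<omega>. B' j \<omega> * (ennreal (c j \<omega>) * ennreal_powr (D j \<omega>) \<sigma>))
      = mean B * mean (\<lambda>\<omega>. ennreal (c j \<omega>) * ennreal_powr (D j \<omega>) \<sigma>)"
      by (simp add: D_def)
  qed
  also have "\<dots> = mean B * mean (\<lambda>\<omega>. (\<Sum>j. ennreal (c j \<omega>) * ennreal_powr (D j \<omega>) \<sigma>))"
    by (simp add: nn_integral_suminf)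
  also have "\<dots> \<le> mean B * mean (\<lambda>\<omega>. ennreal (2 powr \<sigma>) *
      (Z \<omega> * ennreal_powr (ennreal \<bar>q \<omega>\<bar>) \<sigma> + Z \<omega> * ennreal_powr (children_sum \<omega>) \<sigma>))"
  proof (intro mult_left_mono nn_integral_mono)
    fix \<omega>
    have "(\<Sum>j. ennreal (c j \<omega>) * ennreal_powr (D j \<omega>) \<sigma>)
      \<le> (\<Sum>j. ennreal (c j \<omega>) * (ennreal (2 powr \<sigma>) * (ennreal_powr (ennreal \<bar>q \<omega>\<bar>) \<sigma> + ennreal_powr (children_sum \<omega>) \<sigma>)))"
      using s by (intro suminf_le mult_left_mono order.trans[OF ennreal_powr_mono[OF _ D_le] ennreal_powr_add_le]) auto
    also have "\<dots> = Z \<omega> * (ennreal (2 powr \<sigma>) * (ennreal_powr (ennreal \<bar>q \<omega>\<bar>) \<sigma> + ennreal_powr (children_sum \<omega>) \<sigma>))"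
      unfolding Z_def by (rule ennreal_suminf_multc)
    finally show "(\<Sum>j. ennreal (c j \<omega>) * ennreal_powr (D j \<omega>) \<sigma>) \<le> ennreal (2 powr \<sigma>) *
      (Z \<omega> * ennreal_powr (ennreal \<bar>q \<omega>\<bar>) \<sigma> + Z \<omega> * ennreal_powr (children_sum \<omega>) \<sigma>)"
      by (simp add: distrib_left mult_ac)
  qed auto
  also have "\<dots> = mean B * (ennreal (2 powr \<sigma>) *
      (mean (\<lambda>\<omega>. Z \<omega> * ennreal_powr (ennreal \<bar>q \<omega>\<bar>) \<sigma>) + mean (\<lambda>\<omega>. Z \<omega> * ennreal_powr (children_sum \<omega>) \<sigma>)))"
    by (subst nn_integral_cmult, simp, subst nn_integral_add) auto
  also have "\<dots> < \<infinity>" using B1 Zq second by (simp add: ennreal_mult_less_top \<sigma>_def)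
  finally have third: "(\<Sum>j. \<integral>\<^sup>+\<omega>. B' j \<omega> * (ennreal (c j \<omega>) * ennreal_powr (D j \<omega>) \<sigma>) \<partial>M) < \<infinity>" .
  have "mean (\<lambda>\<omega>. cross_term p (summand \<omega>)) = mean (\<lambda>\<omega>. ennreal \<bar>q \<omega>\<bar> * ennreal_powr (children_sum \<omega>) \<sigma>)
      + (\<Sum>j. \<integral>\<^sup>+\<omega>. B' j \<omega> * (ennreal (c j \<omega>) * ennreal_powr (D j \<omega>) \<sigma>) \<partial>M)"
    unfolding split by (subst nn_integral_add) (auto simp: nn_integral_suminf)
  also have "\<dots> < \<infinity>" using first third by simp
  finally show ?thesis .
qed

end

text \<open>A signed solution of the recursion below the majorant. The majorant itself is one, so the tail
  inequalities below serve twice.\<close>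

locale dominated_recursion = linear_recursion M q c B B'
  for M :: "'w measure" and q c B B' +
  fixes u S :: "'w \<Rightarrow> real" and S' :: "nat \<Rightarrow> 'w \<Rightarrow> real"
  assumes u_measurable[measurable]: "u \<in> borel_measurable M"
    and S_measurable[measurable]: "S \<in> borel_measurable M"
    and S'_measurable[measurable]: "\<And>j. S' j \<in> borel_measurable M"
    and u_le: "AE \<omega> in M. \<bar>u \<omega>\<bar> \<le> \<bar>q \<omega>\<bar>"
    and S'_le: "AE \<omega> in M. \<forall>j. ennreal \<bar>S' j \<omega>\<bar> \<le> B' j \<omega>"
    and S_rec: "AE \<omega> in M. (\<lambda>j. c j \<omega> * S' j \<omega>) sums (S \<omega> - u \<omega>)"
    and S'_law: "\<And>j. distr M (borel \<Otimes>\<^sub>M borel) (\<lambda>\<omega>. (S' j \<omega>, c j \<omega>)) =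
      distr M borel S \<Otimes>\<^sub>M distr M borel (c j)"
begin

definition jump :: "'w \<Rightarrow> nat \<Rightarrow> real" where
  "jump \<omega> j = (case j of 0 \<Rightarrow> u \<omega> | Suc j \<Rightarrow> c j \<omega> * S' j \<omega>)"

abbreviation tail :: "real \<Rightarrow> real" where
  "tail x \<equiv> \<P>(\<omega> in M. S \<omega> > x)"

lemma jump_measurable[measurable]: "(\<lambda>\<omega>. jump \<omega> j) \<in> borel_measurable M"
  unfolding jump_def by (cases j) simp_all

lemma jump_sums: "AE \<omega> in M. jump \<omega> sums S \<omega>"
  using S_rec
proof eventually_elim
  case (elim \<omega>)
  have "(\<lambda>j. jump \<omega> (Suc j)) sums (S \<omega> - jump \<omega> 0)" using elim by (simp add: jump_def)
  then show ?case by (simp add: sums_Suc_iff)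
qed

lemma jump_le: "AE \<omega> in M. \<forall>j. ennreal \<bar>jump \<omega> j\<bar> \<le> summand \<omega> j"
  using u_le S'_le
proof eventually_elim
  case (elim \<omega>)
  show ?case
  proof
    fix j show "ennreal \<bar>jump \<omega> j\<bar> \<le> summand \<omega> j"
    proof (cases j)
      case 0
      then show ?thesis using elim by (simp add: jump_def summand_def ennreal_leI)
    next
      case (Suc k)
      have "ennreal (c k \<omega>) * ennreal \<bar>S' k \<omega>\<bar> \<le> ennreal (c k \<omega>) * B' k \<omega>"
        using elim by (intro mult_left_mono) auto
      then show ?thesis using Suc c_nonneg[of k \<omega>]
        by (simp add: jump_def summand_def abs_mult ennreal_mult)
    qed
  qed
qed

lemma antimono_tail: "antimono tail"
  by (intro antimonoI finite_measure_mono) auto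

text \<open>The summand \<open>c j * S' j\<close> exceeds a level if \<open>S' j\<close> exceeds the level divided by \<open>c j\<close>, and \<open>S' j\<close> is
  a copy of \<open>S\<close> independent of \<open>c j\<close>.\<close>

lemma expected_jumps:
  assumes x: "x > 0" and s: "s > 0"
  shows "mean (\<lambda>\<omega>. (\<Sum>j. indicator {s * x<..} (jump \<omega> j)))
    = ennreal (\<P>(\<omega> in M. u \<omega> > s * x)) + tail_op intensity s (\<lambda>y. ennreal (tail y)) x"
proof -
  note [measurable] = antimono_borel_measurable[OF antimono_tail]
  have "mean (\<lambda>\<omega>. (\<Sum>j. indicator {s * x<..} (jump \<omega> j)))
      = mean (\<lambda>\<omega>. indicator {s * x<..} (u \<omega>) + (\<Sum>j. indicator {s * x<..} (c j \<omega> * S' j \<omega>)))"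
    by (subst suminf_ennreal_head) (simp add: jump_def)
  also have "\<dots> = mean (\<lambda>\<omega>. indicator {s * x<..} (u \<omega>))
      + (\<Sum>j. \<integral>\<^sup>+\<omega>. indicator {s * x<..} (c j \<omega> * S' j \<omega>) \<partial>M)"
    by (subst nn_integral_add) (auto simp: nn_integral_suminf)
  also have "mean (\<lambda>\<omega>. indicator {s * x<..} (u \<omega>)) = ennreal (\<P>(\<omega> in M. u \<omega> > s * x))"
  proof -
    have "mean (\<lambda>\<omega>. indicator {s * x<..} (u \<omega>)) = mean (\<lambda>\<omega>. indicator {\<omega>\<in>space M. u \<omega> > s * x} \<omega>)"
      by (intro nn_integral_cong) (auto simp: indicator_def)
    also have "\<dots> = emeasure M {\<omega>\<in>space M. u \<omega> > s * x}" by (rule nn_integral_indicator) simp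
    finally show ?thesis by (simp add: emeasure_eq_measure)
  qed
  also have "(\<lambda>j. \<integral>\<^sup>+\<omega>. indicator {s * x<..} (c j \<omega> * S' j \<omega>) \<partial>M)
     = (\<lambda>j. \<integral>\<^sup>+\<omega>. ennreal (tail (s * x / c j \<omega>)) * indicator {0<..} (c j \<omega>) \<partial>M)"
  proof
    fix j
    have "mean (\<lambda>\<omega>. indicator {s * x<..} (c j \<omega> * S' j \<omega>))
        = mean (\<lambda>\<omega>. (\<integral>\<^sup>+\<omega>'. indicator {s * x<..} (c j \<omega> * S \<omega>') \<partial>M))"
      using nn_integral_product_law[OF S'_measurable S_measurable c_measurable S'_law,
          of "\<lambda>(a, b). indicator {s * x<..} (b * a)" j] by simp
    also have "\<dots> = mean (\<lambda>\<omega>. ennreal (tail (s * x / c j \<omega>)) * indicator {0<..} (c j \<omega>))"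
    proof (intro nn_integral_cong)
      fix \<omega>
      show "(\<integral>\<^sup>+\<omega>'. indicator {s * x<..} (c j \<omega> * S \<omega>') \<partial>M)
         = ennreal (tail (s * x / c j \<omega>)) * indicator {0<..} (c j \<omega>)"
      proof (cases "c j \<omega> > 0")
        case True
        have "(\<integral>\<^sup>+\<omega>'. indicator {s * x<..} (c j \<omega> * S \<omega>') \<partial>M)
            = (\<integral>\<^sup>+\<omega>'. indicator {\<omega>'\<in>space M. S \<omega>' > s * x / c j \<omega>} \<omega>' \<partial>M)"
          using True by (intro nn_integral_cong) (auto simp: indicator_def field_simps)
        also have "\<dots> = emeasure M {\<omega>'\<in>space M. S \<omega>' > s * x / c j \<omega>}" by (rule nn_integral_indicator) simp
        also have "\<dots> = ennreal (tail (s * x / c j \<omega>)) * indicator {0<..} (c j \<omega>)"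
          using True by (simp add: emeasure_eq_measure)
        finally show ?thesis .
      next
        case False
        then have "c j \<omega> = 0" using c_nonneg[of j \<omega>] by simp
        then show ?thesis using mult_pos_pos[OF s x] by simp
      qed
    qed
    finally show "mean (\<lambda>\<omega>. indicator {s * x<..} (c j \<omega> * S' j \<omega>))
      = mean (\<lambda>\<omega>. ennreal (tail (s * x / c j \<omega>)) * indicator {0<..} (c j \<omega>))" .
  qed
  also have "(\<Sum>j. \<integral>\<^sup>+\<omega>. ennreal (tail (s * x / c j \<omega>)) * indicator {0<..} (c j \<omega>) \<partial>M)
      = tail_op intensity s (\<lambda>y. ennreal (tail y)) x"
    unfolding tail_op_def by (subst nn_integral_intensity) (auto simp: nn_integral_suminf)
  finally show ?thesis .
qed

lemma emeasure_tail: "mean (\<lambda>\<omega>. indicator {x<..} (S \<omega>)) = ennreal (tail x)"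
proof -
  have "mean (\<lambda>\<omega>. indicator {x<..} (S \<omega>)) = mean (\<lambda>\<omega>. indicator {\<omega>\<in>space M. S \<omega> > x} \<omega>)"
    by (intro nn_integral_cong) (auto simp: indicator_def)
  also have "\<dots> = emeasure M {\<omega>\<in>space M. S \<omega> > x}" by (rule nn_integral_indicator) simp
  finally show ?thesis by (simp add: emeasure_eq_measure)
qed

lemma cross_term_measurable[measurable]: "(\<lambda>\<omega>. cross_term p (summand \<omega>)) \<in> borel_measurable M"
  unfolding cross_term_def by measurable

lemma tail_upper:
  assumes x: "x > 0" and e: "0 < e" "e < 1" and p: "p > 1"
  shows "ennreal (tail x) \<le> ennreal (\<P>(\<omega> in M. u \<omega> > (1 - e) * x))
    + tail_op intensity (1 - e) (\<lambda>y. ennreal (tail y)) x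
    + ennreal (e powr (1 - p) * x powr (- p)) * mean (\<lambda>\<omega>. cross_term p (summand \<omega>))"
proof -
  have "ennreal (tail x) = mean (\<lambda>\<omega>. indicator {x<..} (S \<omega>))" by (simp add: emeasure_tail)
  also have "\<dots> \<le> mean (\<lambda>\<omega>. (\<Sum>j. indicator {(1 - e) * x<..} (jump \<omega> j))
           + ennreal (e powr (1 - p) * x powr (- p)) * cross_term p (summand \<omega>))"
  proof (rule nn_integral_mono_AE, use jump_sums jump_le in eventually_elim)
    case (elim \<omega>)
    show ?case by (rule one_big_jump_upper[OF elim(1) _ x e(1) p]) (use elim(2) in blast)
  qed
  also have "\<dots> = mean (\<lambda>\<omega>. (\<Sum>j. indicator {(1 - e) * x<..} (jump \<omega> j)))
      + ennreal (e powr (1 - p) * x powr (- p)) * mean (\<lambda>\<omega>. cross_term p (summand \<omega>))"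
    by (subst nn_integral_add) (auto simp: nn_integral_cmult)
  finally show ?thesis using x e by (simp add: expected_jumps)
qed

lemma tail_lower:
  assumes x: "x > 0" and e: "0 < e" and p: "p > 1"
  shows "ennreal (\<P>(\<omega> in M. u \<omega> > (1 + e) * x)) + tail_op intensity (1 + e) (\<lambda>y. ennreal (tail y)) x
    \<le> ennreal (tail x)
      + ennreal (e powr (1 - p) * x powr (- p)) * mean (\<lambda>\<omega>. cross_term p (summand \<omega>))"
proof -
  have "mean (\<lambda>\<omega>. (\<Sum>j. indicator {(1 + e) * x<..} (jump \<omega> j)))
    \<le> mean (\<lambda>\<omega>. indicator {x<..} (S \<omega>)
           + ennreal (e powr (1 - p) * x powr (- p)) * cross_term p (summand \<omega>))"
  proof (rule nn_integral_mono_AE, use jump_sums jump_le in eventually_elim)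
    case (elim \<omega>)
    show ?case by (rule one_big_jump_lower[OF elim(1) _ x e p]) (use elim(2) in blast)
  qed
  also have "\<dots> = mean (\<lambda>\<omega>. indicator {x<..} (S \<omega>))
      + ennreal (e powr (1 - p) * x powr (- p)) * mean (\<lambda>\<omega>. cross_term p (summand \<omega>))"
    by (subst nn_integral_add) (auto simp: nn_integral_cmult)
  finally show ?thesis using x e by (simp add: expected_jumps emeasure_tail)
qed

end

section \<open>Moments of the majorant\<close>

lemma ennreal_powr_le_1_add:
  assumes "0 \<le> s" "s \<le> t"
  shows "ennreal_powr z s \<le> 1 + ennreal_powr z t"
proof (cases z)
  case (real a)
  have "a powr s \<le> 1 + a powr t"
  proof (cases "a \<le> 1")
    case True
    then have "a powr s \<le> 1" using real assms by (intro powr_le1) auto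
    then show ?thesis by (simp add: add_increasing2)
  next
    case False
    then have "a powr s \<le> a powr t" using assms by (intro powr_mono) auto
    then show ?thesis by simp
  qed
  then show ?thesis
    using real ennreal_leI[of "a powr s" "1 + a powr t"] by (simp add: ennreal_powr_ennreal)
qed (simp add: ennreal_powr_def)

text \<open>A dyadic form of the layer-cake formula: it turns tail bounds into moments.\<close>

lemma powr_le_dyadic_tail:
  fixes z :: real
  assumes "z \<ge> 0" "\<beta> \<ge> 0"
  shows "ennreal (z powr \<beta>) \<le> 1 + (\<Sum>k. ennreal ((2 ^ Suc k) powr \<beta>) * indicator {2 ^ k<..} z)"
proof (cases "z \<le> 1")
  case True
  then have "ennreal (z powr \<beta>) \<le> 1" using assms by (simp add: powr_le1)
  then show ?thesis by (simp add: add_increasing2)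
next
  case False
  define n where "n = (LEAST n. z \<le> 2 ^ n)"
  obtain m where "z < 2 ^ m" using real_arch_pow[of 2 z] by auto
  then have "\<exists>n. z \<le> 2 ^ n" by (intro exI[of _ m]) simp
  then have n: "z \<le> 2 ^ n" unfolding n_def by (rule LeastI_ex)
  then have "n \<noteq> 0" using False by (cases n) auto
  then obtain k where k: "n = Suc k" by (cases n) auto
  have "\<not> z \<le> 2 ^ k" using not_less_Least[of k "\<lambda>n. z \<le> 2 ^ n"] k by (simp add: n_def)
  define f where "f i = ennreal ((2 ^ Suc i) powr \<beta>) * indicator {2 ^ i<..} z" for i
  have "ennreal (z powr \<beta>) \<le> f k"
    using n k assms \<open>\<not> z \<le> 2 ^ k\<close> by (auto simp: f_def intro!: ennreal_leI powr_mono2)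
  also have "f k = sum f {k}" by simp
  also have "\<dots> \<le> (\<Sum>i. f i)" by (intro sum_le_suminf) auto
  finally have "ennreal (z powr \<beta>) \<le> (\<Sum>i. ennreal ((2 ^ Suc i) powr \<beta>) * indicator {2 ^ i<..} z)"
    by (simp only: f_def)
  then show ?thesis by (simp add: add_increasing)
qed

context linear_recursion
begin

lemma markov_tail:
  fixes f :: "'w \<Rightarrow> real"
  assumes [measurable]: "f \<in> borel_measurable M" and x: "x > 0" and \<beta>: "\<beta> > 0"
  shows "ennreal (\<P>(\<omega> in M. f \<omega> > x)) \<le> ennreal (x powr (-\<beta>)) * mean (\<lambda>\<omega>. ennreal (\<bar>f \<omega>\<bar> powr \<beta>))"
proof -
  have "ennreal (\<P>(\<omega> in M. f \<omega> > x)) = mean (\<lambda>\<omega>. indicator {\<omega>\<in>space M. f \<omega> > x} \<omega>)"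
    by (simp add: emeasure_eq_measure)
  also have "\<dots> \<le> mean (\<lambda>\<omega>. ennreal (x powr (-\<beta>)) * ennreal (\<bar>f \<omega>\<bar> powr \<beta>))"
  proof (intro nn_integral_mono)
    fix \<omega>
    show "indicator {\<omega>\<in>space M. f \<omega> > x} \<omega> \<le> ennreal (x powr (-\<beta>)) * ennreal (\<bar>f \<omega>\<bar> powr \<beta>)"
    proof (cases "f \<omega> > x")
      case True
      then have "x powr (-\<beta>) * x powr \<beta> \<le> x powr (-\<beta>) * \<bar>f \<omega>\<bar> powr \<beta>"
        using x \<beta> by (intro mult_left_mono powr_mono2) auto
      moreover have "x powr (-\<beta>) * x powr \<beta> = 1" using x by (simp flip: powr_add)
      ultimately have "1 \<le> ennreal (x powr (-\<beta>) * \<bar>f \<omega>\<bar> powr \<beta>)" by simp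
      then show ?thesis using x by (auto simp: indicator_def ennreal_mult)
    qed simp
  qed
  also have "\<dots> = ennreal (x powr (-\<beta>)) * mean (\<lambda>\<omega>. ennreal (\<bar>f \<omega>\<bar> powr \<beta>))"
    by (rule nn_integral_cmult) measurable
  finally show ?thesis .
qed

lemma markov_majorant:
  assumes f[measurable]: "f \<in> borel_measurable M" and le: "AE \<omega> in M. ennreal \<bar>f \<omega>\<bar> \<le> B \<omega>"
    and mB: "mean B = ennreal m" "m \<ge> 0" and x: "x > 0"
  shows "\<P>(\<omega> in M. f \<omega> > x) \<le> m / x"
proof -
  have "ennreal (\<P>(\<omega> in M. f \<omega> > x)) \<le> ennreal (x powr (-1)) * mean (\<lambda>\<omega>. ennreal (\<bar>f \<omega>\<bar> powr 1))"
    using x by (intro markov_tail) auto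
  also have "\<dots> \<le> ennreal (x powr (-1)) * mean B"
    using le by (intro mult_left_mono nn_integral_mono_AE) auto
  also have "\<dots> = ennreal (m / x)"
    using x mB by (simp add: powr_minus field_simps flip: ennreal_mult)
  finally show ?thesis using x mB by (simp add: ennreal_le_iff)
qed

lemma majorant_dominated:
  assumes B1: "mean B < \<infinity>"
  shows "dominated_recursion M q c B B' (\<lambda>\<omega>. \<bar>q \<omega>\<bar>) (\<lambda>\<omega>. enn2real (B \<omega>)) (\<lambda>j \<omega>. enn2real (B' j \<omega>))"
proof -
  let ?O = "\<lambda>j \<omega>. (q \<omega>, \<lambda>k. c k \<omega>, \<lambda>k. if k = j then 0 else B' k \<omega>)"
  have O[measurable]: "?O j \<in> measurable M rest_space" for j
    by (intro measurable_Pair measurable_PiM_single') auto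
  show ?thesis
  proof (intro dominated_recursion.intro linear_recursion_axioms dominated_recursion_axioms.intro)
    have Bfin: "AE \<omega> in M. B \<omega> \<noteq> \<infinity>" by (rule AE_finite_of_moment[OF B1]) measurable
    have "mean (\<lambda>\<omega>. B' j \<omega>) = mean B" for j
      using nn_integral_B'_mult[of "\<lambda>x. x" "\<lambda>_. 1" j] by (simp add: emeasure_space_1)
    then have "AE \<omega> in M. B' j \<omega> \<noteq> \<infinity>" for j
      using B1 by (intro AE_finite_of_moment) auto
    then have B'fin: "AE \<omega> in M. \<forall>j. B' j \<omega> \<noteq> \<infinity>" by (subst AE_all_countable) auto
    show "AE \<omega> in M. \<forall>j. ennreal \<bar>enn2real (B' j \<omega>)\<bar> \<le> B' j \<omega>"
      using B'fin by eventually_elim (auto simp: ennreal_enn2real_if)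
    show "AE \<omega> in M. (\<lambda>j. c j \<omega> * enn2real (B' j \<omega>)) sums (enn2real (B \<omega>) - \<bar>q \<omega>\<bar>)"
      using B_rec Bfin B'fin
    proof eventually_elim
      case (elim \<omega>)
      define f where "f j = c j \<omega> * enn2real (B' j \<omega>)" for j
      have f0: "f j \<ge> 0" for j using c_nonneg by (simp add: f_def)
      have f: "ennreal (c j \<omega>) * B' j \<omega> = ennreal (f j)" for j
        using elim c_nonneg[of j \<omega>] by (cases "B' j \<omega>") (auto simp: f_def ennreal_mult)
      have "(\<Sum>j. ennreal (f j)) \<noteq> \<infinity>" using elim by (auto simp: f)
      then have "summable f" using f0 by (simp add: summable_suminf_not_top)
      moreover have "B \<omega> = ennreal \<bar>q \<omega>\<bar> + ennreal (suminf f)"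
        using elim f0 \<open>summable f\<close> by (simp add: f suminf_ennreal2)
      then have "enn2real (B \<omega>) = \<bar>q \<omega>\<bar> + suminf f"
        using suminf_nonneg[OF \<open>summable f\<close> f0] by (simp flip: ennreal_plus)
      ultimately show ?case by (simp add: f_def[symmetric] sums_iff)
    qed
    show "distr M (borel \<Otimes>\<^sub>M borel) (\<lambda>\<omega>. (enn2real (B' j \<omega>), c j \<omega>))
        = distr M borel (\<lambda>\<omega>. enn2real (B \<omega>)) \<Otimes>\<^sub>M distr M borel (c j)" for j
    proof -
      have "(\<lambda>z. fst (snd z) j) \<in> borel_measurable rest_space" by measurable
      from product_law_compose[OF B'_measurable B_measurable O B'_law borel_measurable_enn2real[OF measurable_ident] this]
      show ?thesis by simp
    qed
  qed auto
qed

text \<open>Comparison with a multiple of \<open>x powr (-\<beta>)\<close>: the bound on the cross term at exponent \<open>\<beta>\<close> only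
  involves lower moments of \<open>B\<close>, which sets up an induction on the exponent.\<close>

lemma majorant_tail_bound:
  assumes \<beta>: "\<beta> > 1" and B1: "mean B < \<infinity>"
    and cross: "mean (\<lambda>\<omega>. cross_term \<beta> (summand \<omega>)) < \<infinity>"
    and q\<beta>: "mean (\<lambda>\<omega>. ennreal (\<bar>q \<omega>\<bar> powr \<beta>)) < \<infinity>"
    and m1: "moment intensity 1 < 1" and m\<beta>: "moment intensity \<beta> < 1"
  shows "\<exists>K\<ge>0. \<forall>x>0. \<P>(\<omega> in M. enn2real (B \<omega>) > x) \<le> K * x powr (-\<beta>)"
proof -
  interpret D: dominated_recursion M q c B B' "\<lambda>\<omega>. \<bar>q \<omega>\<bar>" "\<lambda>\<omega>. enn2real (B \<omega>)" "\<lambda>j \<omega>. enn2real (B' j \<omega>)"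
    by (rule majorant_dominated[OF B1])
  obtain \<mu>1 where \<mu>1: "moment intensity 1 = ennreal \<mu>1" "0 \<le> \<mu>1" "\<mu>1 < 1"
    using m1 by (cases "moment intensity 1") auto
  obtain \<mu> where \<mu>: "moment intensity \<beta> = ennreal \<mu>" "0 \<le> \<mu>" "\<mu> < 1"
    using m\<beta> by (cases "moment intensity \<beta>") auto
  obtain \<tau> where \<tau>: "mean (\<lambda>\<omega>. cross_term \<beta> (summand \<omega>)) = ennreal \<tau>" "\<tau> \<ge> 0"
    using cross by (cases "\<integral>\<^sup>+\<omega>. cross_term \<beta> (summand \<omega>) \<partial>M") auto
  obtain mq where mq: "mean (\<lambda>\<omega>. ennreal (\<bar>q \<omega>\<bar> powr \<beta>)) = ennreal mq" "mq \<ge> 0"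
    using q\<beta> by (cases "\<integral>\<^sup>+\<omega>. ennreal (\<bar>q \<omega>\<bar> powr \<beta>) \<partial>M") auto
  obtain mB where mB: "mean B = ennreal mB" "mB \<ge> 0"
    using B1 by (cases "\<integral>\<^sup>+\<omega>. B \<omega> \<partial>M") auto
  have "((\<lambda>e. (1 - e) powr (-\<beta>) * \<mu>) \<longlongrightarrow> (1 - 0) powr (-\<beta>) * \<mu>) (at_right 0)"
    by (intro tendsto_intros) auto
  then have "\<forall>\<^sub>F e in at_right 0. (1 - e) powr (-\<beta>) * \<mu> < 1"
    by (rule order_tendstoD(2)) (use \<mu> in simp)
  moreover have "\<forall>\<^sub>F e in at_right (0::real). 0 < e \<and> e < 1 - \<mu>1"
    using eventually_at_right_real[of 0 "1 - \<mu>1"] \<mu>1 by simp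
  ultimately have "\<forall>\<^sub>F e in at_right (0::real). (1 - e) powr (-\<beta>) * \<mu> < 1 \<and> 0 < e \<and> e < 1 - \<mu>1"
    by eventually_elim simp
  then obtain e where e: "(1 - e) powr (-\<beta>) * \<mu> < 1" "0 < e" "e < 1 - \<mu>1"
    using eventually_happens[of _ "at_right (0::real)"] by (auto simp: trivial_limit_at_right_real)
  define s where "s = 1 - e"
  have s: "0 < s" "s < 1" "\<mu>1 < s" using e \<mu>1 by (auto simp: s_def)
  define k where "k = s powr (-\<beta>) * mq + e powr (1 - \<beta>) * \<tau>"
  have k: "k \<ge> 0" using mq \<tau> by (simp add: k_def)
  obtain K where K: "K \<ge> 0" "\<And>x. x > 0 \<Longrightarrow>
      ennreal (k * x powr (-\<beta>)) + tail_op intensity s (\<lambda>y. ennreal (K * y powr (-\<beta>))) x \<le> ennreal (K * x powr (-\<beta>))"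
    using e by (auto intro: power_supersolution[OF sets_intensity s(1) \<mu>(1,2) _ k order_refl] simp: s_def)
  have "ennreal (D.tail x) \<le> ennreal (K * x powr (-\<beta>))" if x: "x > 0" for x
  proof (rule tail_op_comparison[where \<nu>=intensity and s=s and T=0 and \<kappa>=mB and
        b="\<lambda>x. ennreal (k * x powr (-\<beta>))" and L="\<lambda>x. ennreal (D.tail x)"])
    fix x :: real assume x: "x > 0"
    have "ennreal (D.tail x) \<le> ennreal (\<P>(\<omega> in M. \<bar>q \<omega>\<bar> > s * x))
      + tail_op intensity s (\<lambda>y. ennreal (D.tail y)) x + ennreal (e powr (1 - \<beta>) * x powr (- \<beta>)) * ennreal \<tau>"
      using D.tail_upper[OF x e(2) _ \<beta>] e \<mu>1 by (simp add: s_def \<tau>)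
    also have "ennreal (\<P>(\<omega> in M. \<bar>q \<omega>\<bar> > s * x)) \<le> ennreal ((s * x) powr (-\<beta>)) * ennreal mq"
      using markov_tail[of "\<lambda>\<omega>. \<bar>q \<omega>\<bar>" "s * x" \<beta>] s x \<beta> by (simp add: mq)
    also have "ennreal ((s * x) powr (-\<beta>)) * ennreal mq + tail_op intensity s (\<lambda>y. ennreal (D.tail y)) x
          + ennreal (e powr (1 - \<beta>) * x powr (- \<beta>)) * ennreal \<tau>
        = (ennreal ((s * x) powr (-\<beta>) * mq) + ennreal (e powr (1 - \<beta>) * x powr (- \<beta>) * \<tau>))
          + tail_op intensity s (\<lambda>y. ennreal (D.tail y)) x"
      using mq \<tau> by (simp add: ennreal_mult add_ac)
    also have "ennreal ((s * x) powr (-\<beta>) * mq) + ennreal (e powr (1 - \<beta>) * x powr (- \<beta>) * \<tau>)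
        = ennreal (k * x powr (-\<beta>))"
      using mq \<tau> s x by (simp add: k_def powr_mult algebra_simps flip: ennreal_plus)
    finally show "ennreal (D.tail x) \<le> ennreal (k * x powr (-\<beta>)) + tail_op intensity s (\<lambda>y. ennreal (D.tail y)) x"
      by (simp add: add_right_mono)
    show "ennreal (k * x powr (-\<beta>)) + tail_op intensity s (\<lambda>x. ennreal (K * x powr (-\<beta>))) x
        \<le> ennreal (K * x powr (-\<beta>))" by (rule K(2)[OF x])
    have "D.tail x \<le> mB / x"
      by (rule markov_majorant[OF _ _ mB x]) (auto simp: ennreal_enn2real_if)
    then show "ennreal (D.tail x) \<le> ennreal (K * x powr (-\<beta>)) + ennreal (mB / x)"
      by (simp add: add_increasing ennreal_leI)
  qed (use s \<mu>1 mB x sets_intensity in \<open>auto simp: ennreal_less_iff\<close>)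
  then have "D.tail x \<le> K * x powr (-\<beta>)" if "x > 0" for x
    using that K by (simp add: ennreal_le_iff)
  then show ?thesis using K by blast
qed

lemma majorant_moment_of_tail_bound:
  assumes tail: "\<And>x. x > 0 \<Longrightarrow> \<P>(\<omega> in M. enn2real (B \<omega>) > x) \<le> K * x powr (-\<beta>)" and K: "K \<ge> 0"
    and B1: "mean B < \<infinity>" and \<beta>': "0 \<le> \<beta>'" "\<beta>' < \<beta>"
  shows "mean (\<lambda>\<omega>. ennreal_powr (B \<omega>) \<beta>') < \<infinity>"
proof -
  define r where "r = 2 powr (\<beta>' - \<beta>)"
  have r: "0 \<le> r" "r < 1" using \<beta>' by (auto simp: r_def intro: powr_less_one)
  have Bfin: "AE \<omega> in M. B \<omega> \<noteq> \<infinity>" by (rule AE_finite_of_moment[OF B1]) measurable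
  define A where "A k = {\<omega>\<in>space M. enn2real (B \<omega>) > 2 ^ k}" for k :: nat
  have [measurable]: "A k \<in> sets M" for k unfolding A_def by measurable
  have "mean (\<lambda>\<omega>. ennreal_powr (B \<omega>) \<beta>')
    \<le> mean (\<lambda>\<omega>. 1 + (\<Sum>k. ennreal ((2 ^ Suc k) powr \<beta>') * indicator (A k) \<omega>))"
  proof (rule nn_integral_mono_AE)
    show "AE \<omega> in M. ennreal_powr (B \<omega>) \<beta>' \<le>
        1 + (\<Sum>k. ennreal ((2 ^ Suc k) powr \<beta>') * indicator (A k) \<omega>)"
      using Bfin AE_space
    proof eventually_elim
      case (elim \<omega>)
      have "(indicator {2 ^ k<..} (enn2real (B \<omega>)) :: ennreal)
          = indicator (A k) \<omega>" for k
        using elim by (auto simp: indicator_def A_def)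
      then show ?case using powr_le_dyadic_tail[of "enn2real (B \<omega>)" \<beta>'] elim \<beta>'
        by (simp add: ennreal_powr_def)
    qed
  qed
  also have "\<dots> = 1 + (\<Sum>k. ennreal ((2 ^ Suc k) powr \<beta>') * ennreal (prob (A k)))"
    by (subst nn_integral_add) (auto simp: nn_integral_suminf nn_integral_cmult emeasure_eq_measure prob_space)
  also have "\<dots> \<le> 1 + (\<Sum>k. ennreal (2 powr \<beta>' * K * r ^ k))"
  proof (intro add_left_mono suminf_le)
    fix k :: nat
    have "(2 ^ Suc k) powr \<beta>' * prob (A k) \<le> (2 ^ Suc k) powr \<beta>' * (K * (2 ^ k) powr (-\<beta>))"
      by (intro mult_left_mono tail[of "2 ^ k", folded A_def]) auto
    also have "\<dots> = 2 powr \<beta>' * K * ((2 ^ k) powr \<beta>' * (2 ^ k) powr (-\<beta>))"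
      by (simp add: powr_mult mult_ac)
    also have "(2 ^ k) powr \<beta>' * (2 ^ k) powr (-\<beta>) = (2 ^ k :: real) powr (\<beta>' - \<beta>)" by (simp flip: powr_add)
    also have "\<dots> = r ^ k" by (simp add: r_def powr_powr mult.commute flip: powr_realpow)
    finally show "ennreal ((2 ^ Suc k) powr \<beta>') * ennreal (prob (A k))
        \<le> ennreal (2 powr \<beta>' * K * r ^ k)"
      by (simp add: ennreal_leI flip: ennreal_mult)
  qed auto
  also have "\<dots> < \<infinity>"
    using r K by (subst suminf_ennreal2) (auto intro!: summable_mult summable_geometric)
  finally show ?thesis .
qed

text \<open>Raising the exponent by at most \<open>1/2\<close> at a time keeps \<open>\<beta> - 1\<close> below the exponents reached before.\<close>

lemma majorant_moments:
  assumes B1: "mean B < \<infinity>"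
    and q: "\<And>\<beta>. 0 < \<beta> \<Longrightarrow> \<beta> < \<alpha> \<Longrightarrow> mean (\<lambda>\<omega>. ennreal (\<bar>q \<omega>\<bar> powr \<beta>)) < \<infinity>"
    and m1: "moment intensity 1 < 1" and m: "moment intensity \<alpha> < 1"
    and p: "p \<ge> \<alpha>" and Zp: "mean (\<lambda>\<omega>. ennreal_powr (Z \<omega>) p) < \<infinity>"
    and qZ: "mean (\<lambda>\<omega>. ennreal \<bar>q \<omega>\<bar> * ennreal_powr (Z \<omega>) (p - 1)) < \<infinity>"
    and Zq: "mean (\<lambda>\<omega>. Z \<omega> * ennreal_powr (ennreal \<bar>q \<omega>\<bar>) (p - 1)) < \<infinity>"
    and \<beta>: "1 \<le> \<beta>" "\<beta> < \<alpha>"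
  shows "mean (\<lambda>\<omega>. ennreal_powr (B \<omega>) \<beta>) < \<infinity>"
proof -
  have Z1: "mean Z < \<infinity>" using m1 by (auto simp: moment_intensity_1 intro: less_trans)
  have q1: "mean (\<lambda>\<omega>. ennreal \<bar>q \<omega>\<bar>) < \<infinity>"
    using q[of 1] \<beta> by simp
  have mb: "moment intensity \<beta> < 1" if "1 \<le> \<beta>" "\<beta> < \<alpha>" for \<beta>
  proof -
    obtain \<mu>1 where \<mu>1: "moment intensity 1 = ennreal \<mu>1" "0 \<le> \<mu>1" "\<mu>1 < 1"
      using m1 by (cases "moment intensity 1") auto
    obtain \<mu> where \<mu>: "moment intensity \<alpha> = ennreal \<mu>" "0 \<le> \<mu>" "\<mu> < 1"
      using m by (cases "moment intensity \<alpha>") auto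
    define t where "t = (\<beta> - 1) / (\<alpha> - 1)"
    have t: "0 \<le> t" "t \<le> 1" using that by (auto simp: t_def)
    have "t * (\<alpha> - 1) = \<beta> - 1" using that by (simp add: t_def)
    then have "\<beta> = (1 - t) * 1 + t * \<alpha>" by (simp add: algebra_simps)
    then have "moment intensity \<beta> \<le> ennreal (1 - t) * moment intensity 1 + ennreal t * moment intensity \<alpha>"
      using moment_convex[OF sets_intensity t, of 1 \<alpha>] by simp
    also have "\<dots> = ennreal ((1 - t) * \<mu>1 + t * \<mu>)"
      using t \<mu>1 \<mu> by (simp flip: ennreal_mult ennreal_plus)
    also have "\<dots> < 1"
    proof -
      have "(1 - t) * \<mu>1 + t * \<mu> \<le> (1 - t) * max \<mu>1 \<mu> + t * max \<mu>1 \<mu>"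
        using t by (intro add_mono mult_left_mono) auto
      also have "\<dots> = max \<mu>1 \<mu>" by (simp add: algebra_simps)
      also have "\<dots> < 1" using \<mu>1 \<mu> by simp
      finally show ?thesis using ennreal_lessI[of 1] by simp
    qed
    finally show ?thesis .
  qed
  have cross: "mean (\<lambda>\<omega>. cross_term \<beta> (summand \<omega>)) < \<infinity>"
    if \<beta>: "1 < \<beta>" "\<beta> < \<alpha>" and Br: "mean (\<lambda>\<omega>. ennreal_powr (B \<omega>) (max 1 (\<beta> - 1))) < \<infinity>" for \<beta>
  proof (rule cross_term_integrable[OF \<beta>(1) B1 Br Z1])
    have "mean (\<lambda>\<omega>. ennreal_powr (Z \<omega>) \<beta>) \<le> mean (\<lambda>\<omega>. 1 + ennreal_powr (Z \<omega>) p)"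
      using \<beta> p by (intro nn_integral_mono ennreal_powr_le_1_add) auto
    also have "\<dots> < \<infinity>" using Zp by (subst nn_integral_add) (auto simp: emeasure_space_1)
    finally show "mean (\<lambda>\<omega>. ennreal_powr (Z \<omega>) \<beta>) < \<infinity>" .
    have "mean (\<lambda>\<omega>. ennreal \<bar>q \<omega>\<bar> * ennreal_powr (Z \<omega>) (\<beta> - 1))
       \<le> mean (\<lambda>\<omega>. ennreal \<bar>q \<omega>\<bar> * (1 + ennreal_powr (Z \<omega>) (p - 1)))"
      using \<beta> p by (intro nn_integral_mono mult_left_mono ennreal_powr_le_1_add) auto
    also have "\<dots> < \<infinity>" using qZ q1 by (simp add: distrib_left, subst nn_integral_add) auto
    finally show "mean (\<lambda>\<omega>. ennreal \<bar>q \<omega>\<bar> * ennreal_powr (Z \<omega>) (\<beta> - 1)) < \<infinity>" .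
    have "mean (\<lambda>\<omega>. Z \<omega> * ennreal_powr (ennreal \<bar>q \<omega>\<bar>) (\<beta> - 1))
       \<le> mean (\<lambda>\<omega>. Z \<omega> * (1 + ennreal_powr (ennreal \<bar>q \<omega>\<bar>) (p - 1)))"
      using \<beta> p by (intro nn_integral_mono mult_left_mono ennreal_powr_le_1_add) auto
    also have "\<dots> < \<infinity>" using Zq Z1 by (simp add: distrib_left, subst nn_integral_add) auto
    finally show "mean (\<lambda>\<omega>. Z \<omega> * ennreal_powr (ennreal \<bar>q \<omega>\<bar>) (\<beta> - 1)) < \<infinity>" .
  qed
  have "\<forall>\<beta>. 1 \<le> \<beta> \<longrightarrow> \<beta> < \<alpha> \<longrightarrow> \<beta> \<le> 1 + real n / 2 \<longrightarrow> mean (\<lambda>\<omega>. ennreal_powr (B \<omega>) \<beta>) < \<infinity>" for n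
  proof (induction n)
    case 0
    show ?case
    proof (intro allI impI)
      fix \<beta> :: real assume "1 \<le> \<beta>" "\<beta> \<le> 1 + real 0 / 2"
      then have "\<beta> = 1" by simp
      then show "mean (\<lambda>\<omega>. ennreal_powr (B \<omega>) \<beta>) < \<infinity>" using B1 by (simp add: ennreal_powr_1)
    qed
  next
    case (Suc n)
    show ?case
    proof (intro allI impI)
      fix \<beta> :: real assume \<beta>: "1 \<le> \<beta>" "\<beta> < \<alpha>" "\<beta> \<le> 1 + real (Suc n) / 2"
      \<comment> \<open>The tail bound is needed at an exponent strictly above \<open>\<beta>\<close>.\<close>
      define \<gamma> where "\<gamma> = min (\<beta> + 1 / 2) ((\<beta> + \<alpha>) / 2)"
      have \<gamma>: "\<beta> < \<gamma>" "\<gamma> < \<alpha>" "\<gamma> \<le> \<beta> + 1 / 2" using \<beta> by (auto simp: \<gamma>_def min_def field_simps)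
      have "mean (\<lambda>\<omega>. ennreal_powr (B \<omega>) (max 1 (\<gamma> - 1))) < \<infinity>"
        using \<beta> \<gamma> by (intro Suc.IH[rule_format]) (auto simp: max_def field_simps)
      then have "mean (\<lambda>\<omega>. cross_term \<gamma> (summand \<omega>)) < \<infinity>"
        using \<beta> \<gamma> by (intro cross) auto
      then have "\<exists>K\<ge>0. \<forall>x>0. \<P>(\<omega> in M. enn2real (B \<omega>) > x) \<le> K * x powr (-\<gamma>)"
        using \<beta> \<gamma> by (intro majorant_tail_bound B1 q m1 mb) auto
      then show "mean (\<lambda>\<omega>. ennreal_powr (B \<omega>) \<beta>) < \<infinity>"
        using majorant_moment_of_tail_bound[OF _ _ B1, of _ \<gamma> \<beta>] \<beta> \<gamma> by auto
    qed
  qed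
  note this[of "nat \<lceil>2 * \<beta>\<rceil>", rule_format, OF \<beta>]
  moreover have "\<beta> \<le> 1 + real (nat \<lceil>2 * \<beta>\<rceil>) / 2" using \<beta> by linarith
  ultimately show ?thesis by simp
qed

end


text \<open>Either \<open>x\<close> or \<open>y powr s\<close> is the larger one, and replacing the smaller one leaves a pure power.\<close>

lemma mixed_powers_le:
  fixes x y :: real
  assumes "x \<ge> 0" "y \<ge> 0" "s > 0" "m > 0"
  shows "x * y powr m \<le> x powr (1 + m / s) + y powr (s + m)"
proof (cases "x \<le> y powr s")
  case True
  then have "x * y powr m \<le> y powr s * y powr m" by (rule mult_right_mono) simp
  also have "\<dots> = y powr (s + m)" by (simp add: powr_add)
  finally show ?thesis by (simp add: add_increasing)
next
  case False
  have "y = (y powr s) powr (1 / s)" using assms by (simp add: powr_powr)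
  also have "\<dots> \<le> x powr (1 / s)" using False assms by (intro powr_mono2) auto
  finally have "y powr m \<le> (x powr (1 / s)) powr m" using assms by (intro powr_mono2) auto
  then have "x * y powr m \<le> x * x powr (m / s)" using assms by (intro mult_left_mono) (auto simp: powr_powr)
  also have "\<dots> = x powr (1 + m / s)" using assms by (simp add: powr_mult_base)
  finally show ?thesis by (simp add: add_increasing2)
qed

context linear_recursion
begin

lemma moment_intensity_le:
  assumes b: "b \<ge> 1"
  shows "moment intensity b \<le> mean (\<lambda>\<omega>. ennreal_powr (Z \<omega>) b)"
proof -
  have "(\<Sum>j. ennreal (c j \<omega> powr b) * indicator {0<..} (c j \<omega>)) \<le> ennreal_powr (Z \<omega>) b" for \<omega>
  proof (cases "Z \<omega>")
    case (real z)
    have le: "c j \<omega> \<le> z" for j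
    proof -
      have "ennreal (c j \<omega>) = (\<Sum>k\<in>{j}. ennreal (c k \<omega>))" by simp
      also have "\<dots> \<le> Z \<omega>" unfolding Z_def by (intro sum_le_suminf) auto
      finally show ?thesis using real by simp
    qed
    have "(\<Sum>j. ennreal (c j \<omega> powr b) * indicator {0<..} (c j \<omega>)) \<le> (\<Sum>j. ennreal (c j \<omega>) * ennreal (z powr (b - 1)))"
    proof (intro suminf_le)
      fix j
      have "c j \<omega> powr b = c j \<omega> * c j \<omega> powr (b - 1)" using c_nonneg[of j \<omega>] by (simp add: powr_mult_base)
      also have "\<dots> \<le> c j \<omega> * z powr (b - 1)"
        using le[of j] c_nonneg[of j \<omega>] b by (intro mult_left_mono powr_mono2) auto
      finally show "ennreal (c j \<omega> powr b) * indicator {0<..} (c j \<omega>) \<le> ennreal (c j \<omega>) * ennreal (z powr (b - 1))"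
        using c_nonneg[of j \<omega>] by (auto simp: indicator_def ennreal_leI simp flip: ennreal_mult)
    qed auto
    also have "\<dots> = Z \<omega> * ennreal (z powr (b - 1))" by (simp add: Z_def)
    also have "\<dots> = ennreal_powr (Z \<omega>) b"
      using real powr_mult_base[of z "b - 1"] by (simp add: ennreal_powr_ennreal flip: ennreal_mult)
    finally show ?thesis .
  qed (simp add: ennreal_powr_def)
  then show ?thesis
    unfolding moment_def by (subst nn_integral_intensity) (auto intro!: nn_integral_mono)
qed

text \<open>The exponent \<open>p\<close> exceeds \<open>\<alpha>\<close> by so little that the contraction at \<open>\<alpha>\<close> persists and that the
  moments of \<open>q\<close> below \<open>\<alpha>\<close>, together with the moment of \<open>Z\<close> of order \<open>b > \<alpha>\<close>, control the mixed
  moments of \<open>q\<close> and \<open>Z\<close>.\<close>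

lemma exponent_above:
  assumes \<alpha>: "\<alpha> > 1" and b: "b > \<alpha>"
    and q: "\<And>\<beta>. 0 < \<beta> \<Longrightarrow> \<beta> < \<alpha> \<Longrightarrow> mean (\<lambda>\<omega>. ennreal (\<bar>q \<omega>\<bar> powr \<beta>)) < \<infinity>"
    and m: "moment intensity \<alpha> < 1" and Zb: "mean (\<lambda>\<omega>. ennreal_powr (Z \<omega>) b) < \<infinity>"
  obtains p where "p > \<alpha>" "p - 1 < \<alpha>" "moment intensity p < 1"
    "mean (\<lambda>\<omega>. ennreal_powr (Z \<omega>) p) < \<infinity>"
    "mean (\<lambda>\<omega>. ennreal \<bar>q \<omega>\<bar> * ennreal_powr (Z \<omega>) (p - 1)) < \<infinity>"
    "mean (\<lambda>\<omega>. Z \<omega> * ennreal_powr (ennreal \<bar>q \<omega>\<bar>) (p - 1)) < \<infinity>"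
proof -
  have mb: "moment intensity b < \<infinity>" using moment_intensity_le[of b] \<alpha> b Zb by simp
  obtain \<mu> where \<mu>: "moment intensity \<alpha> = ennreal \<mu>" "0 \<le> \<mu>" "\<mu> < 1"
    using m by (cases "moment intensity \<alpha>") auto
  obtain \<mu>b where \<mu>b: "moment intensity b = ennreal \<mu>b" "0 \<le> \<mu>b"
    using mb by (cases "moment intensity b") auto
  \<comment> \<open>Mixed products are split by comparing \<open>\<bar>q\<bar>\<close> with \<open>Z powr (1 + \<sigma>)\<close>. This \<open>\<sigma>\<close> is small enough for the powers
    of \<open>Z\<close> to stay below \<open>b\<close>, and positive so that the powers of \<open>q\<close> stay below \<open>\<alpha>\<close>.\<close>
  define \<sigma> where "\<sigma> = (b - \<alpha>) / (2 * \<alpha>)"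
  have \<sigma>: "\<sigma> > 0" using \<alpha> b by (simp add: \<sigma>_def)
  have "\<sigma> * (2 * \<alpha>) = b - \<alpha>" using \<alpha> by (simp add: \<sigma>_def)
  then have \<sigma>\<alpha>: "2 * (\<sigma> * \<alpha>) = b - \<alpha>" by (simp add: mult_ac)
  have \<sigma>b: "\<sigma> < b - \<alpha>" "\<sigma> * (\<alpha> - 1) < b - \<alpha>"
  proof -
    have "\<sigma> * 1 < \<sigma> * \<alpha>" using \<sigma> \<alpha> by (intro mult_strict_left_mono) auto
    moreover have "\<sigma> * \<alpha> > 0" using \<sigma> \<alpha> by simp
    ultimately show "\<sigma> < b - \<alpha>" using \<sigma>\<alpha> by linarith
    have "\<sigma> * (\<alpha> - 1) = \<sigma> * \<alpha> - \<sigma>" by (simp add: algebra_simps)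
    then show "\<sigma> * (\<alpha> - 1) < b - \<alpha>" using \<sigma>\<alpha> \<sigma> \<open>\<sigma> * \<alpha> > 0\<close> by linarith
  qed
  have inv: "1 / (1 + \<sigma>) < 1" using \<sigma> by (simp add: field_simps)
  define P where "P t = (1 - t) * \<alpha> + t * b" for t
  have P: "(P \<longlongrightarrow> \<alpha>) (at_right 0)"
  proof -
    have "((\<lambda>t. (1 - t) * \<alpha> + t * b) \<longlongrightarrow> (1 - 0) * \<alpha> + 0 * b) (at_right 0)"
      by (intro tendsto_intros)
    then show ?thesis by (simp add: P_def[abs_def])
  qed
  have "((\<lambda>t. (1 - t) * \<mu> + t * \<mu>b) \<longlongrightarrow> (1 - 0) * \<mu> + 0 * \<mu>b) (at_right 0)"
    by (intro tendsto_intros)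
  then have "\<forall>\<^sub>F t in at_right 0. (1 - t) * \<mu> + t * \<mu>b < 1"
    by (rule order_tendstoD(2)) (use \<mu> in simp)
  moreover have "((\<lambda>t. 1 + (P t - 1) / (1 + \<sigma>)) \<longlongrightarrow> 1 + (\<alpha> - 1) / (1 + \<sigma>)) (at_right 0)"
    using \<sigma> by (intro tendsto_intros P) auto
  then have "\<forall>\<^sub>F t in at_right 0. 1 + (P t - 1) / (1 + \<sigma>) < \<alpha>"
    by (rule order_tendstoD(2)) (use \<sigma> \<alpha> in \<open>simp add: field_simps\<close>)
  moreover have "((\<lambda>t. (1 + \<sigma>) + (P t - 1)) \<longlongrightarrow> (1 + \<sigma>) + (\<alpha> - 1)) (at_right 0)"
    by (intro tendsto_intros P)
  then have "\<forall>\<^sub>F t in at_right 0. (1 + \<sigma>) + (P t - 1) < b"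
    by (rule order_tendstoD(2)) (use \<sigma>b in simp)
  moreover have "((\<lambda>t. 1 + (P t - 1) * (1 + \<sigma>)) \<longlongrightarrow> 1 + (\<alpha> - 1) * (1 + \<sigma>)) (at_right 0)"
    by (intro tendsto_intros P)
  then have "\<forall>\<^sub>F t in at_right 0. 1 + (P t - 1) * (1 + \<sigma>) < b"
    by (rule order_tendstoD(2)) (use \<sigma>b in \<open>simp add: algebra_simps\<close>)
  moreover have "((\<lambda>t. 1 / (1 + \<sigma>) + (P t - 1)) \<longlongrightarrow> 1 / (1 + \<sigma>) + (\<alpha> - 1)) (at_right 0)"
    by (intro tendsto_intros P)
  then have "\<forall>\<^sub>F t in at_right 0. 1 / (1 + \<sigma>) + (P t - 1) < \<alpha>"
    by (rule order_tendstoD(2)) (use inv in simp)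
  moreover have "\<forall>\<^sub>F t in at_right (0::real). 0 < t \<and> t < 1"
    using eventually_at_right_real[of 0 1] by simp
  ultimately have "\<forall>\<^sub>F t in at_right (0::real). (1 - t) * \<mu> + t * \<mu>b < 1 \<and> 1 + (P t - 1) / (1 + \<sigma>) < \<alpha>
      \<and> (1 + \<sigma>) + (P t - 1) < b \<and> 1 + (P t - 1) * (1 + \<sigma>) < b \<and> 1 / (1 + \<sigma>) + (P t - 1) < \<alpha>
      \<and> 0 < t \<and> t < 1"
    by eventually_elim simp
  then obtain t where t: "(1 - t) * \<mu> + t * \<mu>b < 1" "1 + (P t - 1) / (1 + \<sigma>) < \<alpha>"
      "(1 + \<sigma>) + (P t - 1) < b" "1 + (P t - 1) * (1 + \<sigma>) < b" "1 / (1 + \<sigma>) + (P t - 1) < \<alpha>"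
      "0 < t" "t < 1"
    using eventually_happens[of _ "at_right (0::real)"] by (auto simp: trivial_limit_at_right_real)
  define p where "p = P t"
  have "p = \<alpha> + t * (b - \<alpha>)" by (simp add: p_def P_def algebra_simps)
  then have p: "p > \<alpha>" using t b by simp
  have inv0: "1 / (1 + \<sigma>) > 0" using \<sigma> by simp
  have p1: "p - 1 < \<alpha>" using t(5) inv0 unfolding p_def by linarith
  have pb: "p < b" using t(3) \<sigma> by (simp add: p_def)
  have mp: "moment intensity p < 1"
  proof -
    have "moment intensity p \<le> ennreal (1 - t) * moment intensity \<alpha> + ennreal t * moment intensity b"
      unfolding p_def P_def using t by (intro moment_convex sets_intensity) auto
    also have "\<dots> = ennreal ((1 - t) * \<mu> + t * \<mu>b)"
      using t \<mu> \<mu>b by (simp flip: ennreal_mult ennreal_plus)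
    also have "\<dots> < 1" using ennreal_lessI[OF _ t(1)] by simp
    finally show ?thesis .
  qed
  have Z_mom: "mean (\<lambda>\<omega>. ennreal_powr (Z \<omega>) a) < \<infinity>" if "0 \<le> a" "a \<le> b" for a
  proof -
    have "mean (\<lambda>\<omega>. ennreal_powr (Z \<omega>) a) \<le> mean (\<lambda>\<omega>. 1 + ennreal_powr (Z \<omega>) b)"
      using that by (intro nn_integral_mono ennreal_powr_le_1_add) auto
    also have "\<dots> < \<infinity>" using Zb by (subst nn_integral_add) (auto simp: emeasure_space_1)
    finally show ?thesis .
  qed
  have Zfin: "AE \<omega> in M. Z \<omega> \<noteq> \<infinity>"
    using AE_finite_of_moment[OF Z_mom[of 1]] \<alpha> b by (simp add: ennreal_powr_1)
  have qZ: "mean (\<lambda>\<omega>. ennreal \<bar>q \<omega>\<bar> * ennreal_powr (Z \<omega>) (p - 1)) < \<infinity>"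
  proof -
    have "mean (\<lambda>\<omega>. ennreal \<bar>q \<omega>\<bar> * ennreal_powr (Z \<omega>) (p - 1))
      \<le> mean (\<lambda>\<omega>. ennreal (\<bar>q \<omega>\<bar> powr (1 + (p - 1) / (1 + \<sigma>))) + ennreal_powr (Z \<omega>) ((1 + \<sigma>) + (p - 1)))"
    proof (intro nn_integral_mono_AE, use Zfin in eventually_elim)
      case (elim \<omega>)
      then obtain z where z: "Z \<omega> = ennreal z" "z \<ge> 0" by (cases "Z \<omega>") auto
      show ?case using mixed_powers_le[of "\<bar>q \<omega>\<bar>" z "1 + \<sigma>" "p - 1"] z \<sigma> p \<alpha>
        by (simp add: ennreal_powr_ennreal ennreal_leI flip: ennreal_mult ennreal_plus)
    qed
    also have "\<dots> = mean (\<lambda>\<omega>. ennreal (\<bar>q \<omega>\<bar> powr (1 + (p - 1) / (1 + \<sigma>))))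
        + mean (\<lambda>\<omega>. ennreal_powr (Z \<omega>) ((1 + \<sigma>) + (p - 1)))"
      by (rule nn_integral_add) measurable
    also have "\<dots> < \<infinity>"
      using t \<sigma> p \<alpha> q[of "1 + (p - 1) / (1 + \<sigma>)"] Z_mom[of "(1 + \<sigma>) + (p - 1)"]
      by (simp add: p_def[symmetric] add_pos_pos)
    finally show ?thesis .
  qed
  have Zq: "mean (\<lambda>\<omega>. Z \<omega> * ennreal_powr (ennreal \<bar>q \<omega>\<bar>) (p - 1)) < \<infinity>"
  proof -
    have "mean (\<lambda>\<omega>. Z \<omega> * ennreal_powr (ennreal \<bar>q \<omega>\<bar>) (p - 1))
      \<le> mean (\<lambda>\<omega>. ennreal_powr (Z \<omega>) (1 + (p - 1) * (1 + \<sigma>)) + ennreal (\<bar>q \<omega>\<bar> powr (1 / (1 + \<sigma>) + (p - 1))))"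
    proof (intro nn_integral_mono_AE, use Zfin in eventually_elim)
      case (elim \<omega>)
      then obtain z where z: "Z \<omega> = ennreal z" "z \<ge> 0" by (cases "Z \<omega>") auto
      show ?case using mixed_powers_le[of z "\<bar>q \<omega>\<bar>" "1 / (1 + \<sigma>)" "p - 1"] z \<sigma> p \<alpha>
        by (simp add: ennreal_powr_ennreal ennreal_leI flip: ennreal_mult ennreal_plus)
    qed
    also have "\<dots> = mean (\<lambda>\<omega>. ennreal_powr (Z \<omega>) (1 + (p - 1) * (1 + \<sigma>)))
        + mean (\<lambda>\<omega>. ennreal (\<bar>q \<omega>\<bar> powr (1 / (1 + \<sigma>) + (p - 1))))"
      by (rule nn_integral_add) measurable
    also have "\<dots> < \<infinity>"
      using t \<sigma> p \<alpha> q[of "1 / (1 + \<sigma>) + (p - 1)"] Z_mom[of "1 + (p - 1) * (1 + \<sigma>)"] inv0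
      by (simp add: p_def[symmetric] add_pos_pos)
    finally show ?thesis .
  qed
  show thesis
    by (rule that[OF p p1 mp _ qZ Zq]) (use Z_mom[of p] p \<alpha> pb in auto)
qed

end

section \<open>Tail asymptotics of solutions\<close>

text \<open>The cross term is integrable at some exponent \<open>p > \<alpha>\<close>, so \<open>tail_upper\<close> and \<open>tail_lower\<close> are the
  approximate equation that determines the tail.\<close>

theorem (in dominated_recursion) tail_ratio_limit:
  assumes \<alpha>: "\<alpha> > 1" and b: "b > \<alpha>"
    and F: "(\<lambda>x. \<P>(\<omega> in M. u \<omega> > x)) \<in> regularly_varying (- \<alpha>)"
    and q: "\<And>\<beta>. 0 < \<beta> \<Longrightarrow> \<beta> < \<alpha> \<Longrightarrow> mean (\<lambda>\<omega>. ennreal (\<bar>q \<omega>\<bar> powr \<beta>)) < \<infinity>"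
    and m1: "moment intensity 1 < 1" and m: "moment intensity \<alpha> < 1"
    and Zb: "mean (\<lambda>\<omega>. ennreal_powr (Z \<omega>) b) < \<infinity>"
    and B1: "mean B < \<infinity>"
  shows "((\<lambda>x. tail x / \<P>(\<omega> in M. u \<omega> > x)) \<longlongrightarrow> 1 / (1 - enn2real (moment intensity \<alpha>))) at_top"
proof -
  obtain p where p: "p > \<alpha>" "p - 1 < \<alpha>" "moment intensity p < 1"
    "mean (\<lambda>\<omega>. ennreal_powr (Z \<omega>) p) < \<infinity>"
    "mean (\<lambda>\<omega>. ennreal \<bar>q \<omega>\<bar> * ennreal_powr (Z \<omega>) (p - 1)) < \<infinity>"
    "mean (\<lambda>\<omega>. Z \<omega> * ennreal_powr (ennreal \<bar>q \<omega>\<bar>) (p - 1)) < \<infinity>"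
    by (rule exponent_above[OF \<alpha> b q m Zb]) blast
  have p1: "p > 1" using p \<alpha> by simp
  have Z1: "mean Z < \<infinity>" using m1 by (auto simp: moment_intensity_1 intro: less_trans)
  have "mean (\<lambda>\<omega>. ennreal_powr (B \<omega>) (max 1 (p - 1))) < \<infinity>"
    using p \<alpha> by (intro majorant_moments[OF B1 q m1 m _ p(4-6)]) auto
  then have "mean (\<lambda>\<omega>. cross_term p (summand \<omega>)) < \<infinity>"
    by (intro cross_term_integrable p1 B1 Z1 p)
  then obtain \<tau> where \<tau>: "mean (\<lambda>\<omega>. cross_term p (summand \<omega>)) = ennreal \<tau>" "\<tau> \<ge> 0"
    by (cases "\<integral>\<^sup>+\<omega>. cross_term p (summand \<omega>) \<partial>M") auto
  obtain mB where mB: "mean B = ennreal mB" "mB \<ge> 0"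
    using B1 by (cases "\<integral>\<^sup>+\<omega>. B \<omega> \<partial>M") auto
  have uB: "AE \<omega> in M. ennreal \<bar>u \<omega>\<bar> \<le> B \<omega>"
    using u_le B_rec by eventually_elim (simp add: ennreal_leI add_increasing2)
  have SB: "AE \<omega> in M. ennreal \<bar>S \<omega>\<bar> \<le> B \<omega>"
    using jump_sums jump_le B_rec
  proof eventually_elim
    case (elim \<omega>)
    have "(\<Sum>k. summand \<omega> k) = summand \<omega> 0 + (\<Sum>k. summand \<omega> (Suc k))"
      by (rule suminf_ennreal_head)
    also have "\<dots> = B \<omega>" using elim by (simp add: summand_def)
    finally have B: "(\<Sum>k. summand \<omega> k) = B \<omega>" .
    have "ennreal (S \<omega>) \<le> B \<omega>"
      using sums_le_suminf_ennreal[OF elim(1), of "summand \<omega>"] elim(2) B by simp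
    moreover have "ennreal (- S \<omega>) \<le> B \<omega>"
      using sums_le_suminf_ennreal[OF sums_minus[OF elim(1)], of "summand \<omega>"] elim(2) B by simp
    ultimately show ?case by (cases "S \<omega> \<ge> 0") auto
  qed
  obtain \<rho> where \<rho>: "moment intensity \<alpha> = ennreal \<rho>" "0 \<le> \<rho>" "\<rho> < 1"
    using m by (cases "moment intensity \<alpha>") auto
  have "((\<lambda>x. tail x / \<P>(\<omega> in M. u \<omega> > x)) \<longlongrightarrow> 1 / (1 - \<rho>)) at_top"
  proof (rule tail_equation_asymptotics[where \<nu>=intensity and \<alpha>=\<alpha> and p=p and \<kappa>=mB])
    show "antimono (\<lambda>x. \<P>(\<omega> in M. u \<omega> > x))"
      by (intro antimonoI finite_measure_mono) auto
    show "antimono tail" by (rule antimono_tail)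
    show "\<exists>K\<ge>0. \<forall>x>0. ennreal (tail x) \<le> ennreal (\<P>(\<omega> in M. u \<omega> > s * x))
        + tail_op intensity s (\<lambda>y. ennreal (tail y)) x + ennreal (K * x powr (-p))"
      if s: "0 < s" "s < 1" for s
    proof (intro exI[of _ "(1 - s) powr (1 - p) * \<tau>"] conjI allI impI)
      fix x :: real assume x: "x > 0"
      show "ennreal (tail x) \<le> ennreal (\<P>(\<omega> in M. u \<omega> > s * x))
        + tail_op intensity s (\<lambda>y. ennreal (tail y)) x + ennreal ((1 - s) powr (1 - p) * \<tau> * x powr (-p))"
        using tail_upper[OF x, of "1 - s" p] s p1 \<tau> by (simp add: mult_ac flip: ennreal_mult)
    qed (use \<tau> in simp)
    show "\<exists>K\<ge>0. \<forall>x>0. ennreal (\<P>(\<omega> in M. u \<omega> > s * x)) + tail_op intensity s (\<lambda>y. ennreal (tail y)) x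
        \<le> ennreal (tail x) + ennreal (K * x powr (-p))"
      if s: "1 < s" for s
    proof (intro exI[of _ "(s - 1) powr (1 - p) * \<tau>"] conjI allI impI)
      fix x :: real assume x: "x > 0"
      show "ennreal (\<P>(\<omega> in M. u \<omega> > s * x)) + tail_op intensity s (\<lambda>y. ennreal (tail y)) x
        \<le> ennreal (tail x) + ennreal ((s - 1) powr (1 - p) * \<tau> * x powr (-p))"
        using tail_lower[OF x, of "s - 1" p] s p1 \<tau> by (simp add: mult_ac flip: ennreal_mult)
    qed (use \<tau> in simp)
    show "tail x \<le> mB / x" if "x > 0" for x using SB that mB by (intro markov_majorant) auto
    show "\<P>(\<omega> in M. u \<omega> > x) \<le> mB / x" if "x > 0" for x using uB that mB by (intro markov_majorant) auto
  qed (use \<alpha> p F m1 \<rho> mB sets_intensity in auto)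
  then show ?thesis by (simp add: \<rho>)
qed

section \<open>Sums over countable index types\<close>

text \<open>Both sides are \<open>0\<close> by default if \<open>f\<close> is not absolutely summable. Hence sums of measurable functions are
  measurable even where they diverge.\<close>

lemma infsum_eq_integral_count_space:
  fixes f :: "'a \<Rightarrow> real"
  shows "infsum f UNIV = (\<integral>x. f x \<partial>count_space UNIV)"
proof (cases "f summable_on UNIV")
  case True
  then have "Infinite_Set_Sum.abs_summable_on f UNIV"
    using abs_summable_equivalent summable_on_iff_abs_summable_on_real by blast
  then show ?thesis by (simp add: infsetsum_infsum[symmetric] infsetsum_def)
next
  case False
  then have "\<not> Infinite_Set_Sum.abs_summable_on f UNIV"
    using abs_summable_equivalent summable_on_iff_abs_summable_on_real by blast
  then have "\<not> integrable (count_space UNIV) f" by (simp add: Infinite_Set_Sum.abs_summable_on_def)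
  then show ?thesis using False by (simp add: infsum_not_exists not_integrable_integral_eq)
qed

lemma borel_measurable_infsum:
  fixes f :: "'i::countable \<Rightarrow> 'a \<Rightarrow> real"
  assumes "\<And>i. f i \<in> borel_measurable M"
  shows "(\<lambda>x. infsum (\<lambda>i. f i x) UNIV) \<in> borel_measurable M"
  unfolding infsum_eq_integral_count_space
  by (intro sigma_finite_measure.borel_measurable_lebesgue_integral sigma_finite_measure_count_space
      measurable_pair_count_space assms)

lemma borel_measurable_nn_integral_count_space:
  fixes f :: "'i::countable \<Rightarrow> 'a \<Rightarrow> ennreal"
  assumes "\<And>i. f i \<in> borel_measurable M"
  shows "(\<lambda>x. \<integral>\<^sup>+i. f i x \<partial>count_space UNIV) \<in> borel_measurable M"
  by (intro sigma_finite_measure.borel_measurable_nn_integral sigma_finite_measure_count_space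
      measurable_pair_count_space assms)

lemma summable_on_real_iff_nn_integral:
  fixes f :: "'a \<Rightarrow> real"
  shows "f summable_on UNIV \<longleftrightarrow> (\<integral>\<^sup>+x. ennreal \<bar>f x\<bar> \<partial>count_space UNIV) < \<infinity>"
proof -
  have "f summable_on UNIV \<longleftrightarrow> Infinite_Set_Sum.abs_summable_on f UNIV"
    using abs_summable_equivalent summable_on_iff_abs_summable_on_real by blast
  also have "\<dots> \<longleftrightarrow> integrable (count_space UNIV) f" by (simp add: Infinite_Set_Sum.abs_summable_on_def)
  finally show ?thesis by (simp add: integrable_iff_bounded)
qed

lemma abs_infsum_le_nn_integral:
  fixes f :: "'a \<Rightarrow> real"
  shows "ennreal \<bar>infsum f UNIV\<bar> \<le> (\<integral>\<^sup>+x. ennreal \<bar>f x\<bar> \<partial>count_space UNIV)"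
proof (cases "f summable_on UNIV")
  case True
  then have "integrable (count_space UNIV) f"
    by (simp add: summable_on_real_iff_nn_integral integrable_iff_bounded)
  from integral_norm_bound_ennreal[OF this] show ?thesis
    by (simp add: infsum_eq_integral_count_space)
qed (simp add: infsum_not_exists)

lemma infsum_offspring_eq_suminf:
  fixes f :: "nat \<Rightarrow> ennreal"
  assumes "0 \<notin> A"
  shows "infsum f A = (\<Sum>j. if Suc j \<in> A then f (Suc j) else 0)"
proof -
  have "infsum f A = infsum (\<lambda>j. if j \<in> A then f j else 0) (range Suc)"
    using assms by (intro infsum_cong_neutral) (auto simp: image_iff, metis not0_implies_Suc)
  also have "\<dots> = infsum (\<lambda>j. if Suc j \<in> A then f (Suc j) else 0) UNIV"
    by (subst infsum_reindex) (auto simp: comp_def)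
  also have "\<dots> = (\<Sum>j. if Suc j \<in> A then f (Suc j) else 0)"

    by (intro sums_unique has_sum_imp_sums has_sum_infsum nonneg_summable_on_complete) simp
  finally show ?thesis .
qed

lemma nn_integral_lists:
  fixes f :: "'a list \<Rightarrow> ennreal"
  shows "(\<integral>\<^sup>+l. f l \<partial>count_space UNIV)
    = f [] + (\<integral>\<^sup>+j. (\<integral>\<^sup>+l. f (j # l) \<partial>count_space UNIV) \<partial>count_space UNIV)"
proof -
  have bij: "bij_betw (\<lambda>(j, l). j # l) UNIV (UNIV - {[] :: 'a list})"
    by (auto simp: bij_betw_def inj_on_def image_iff) (metis list.exhaust)
  have "(\<integral>\<^sup>+l. f l \<partial>count_space UNIV)
      = (\<integral>\<^sup>+l. f l * indicator {[]} l + f l * indicator (UNIV - {[]}) l \<partial>count_space UNIV)"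
    by (intro nn_integral_cong) (auto simp: indicator_def)
  also have "\<dots> = (\<integral>\<^sup>+l. f l * indicator {[]} l \<partial>count_space UNIV)
      + (\<integral>\<^sup>+l. f l * indicator (UNIV - {[]}) l \<partial>count_space UNIV)"
    by (rule nn_integral_add) auto
  also have "(\<integral>\<^sup>+l. f l * indicator {[]} l \<partial>count_space UNIV) = f []"
    by (simp add: nn_integral_count_space_indicator[symmetric] nn_integral_indicator_finite)
  also have "(\<integral>\<^sup>+l. f l * indicator (UNIV - {[]}) l \<partial>count_space UNIV)
      = (\<integral>\<^sup>+l. f l \<partial>count_space (UNIV - {[]}))"
    by (rule nn_integral_count_space_indicator[symmetric]) simp
  also have "\<dots> = (\<integral>\<^sup>+x. f (case x of (j, l) \<Rightarrow> j # l) \<partial>count_space UNIV)"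
    by (rule nn_integral_bij_count_space[OF bij, symmetric])
  also have "\<dots> = (\<integral>\<^sup>+j. (\<integral>\<^sup>+l. f (j # l) \<partial>count_space UNIV) \<partial>count_space UNIV)"
    by (subst nn_integral_fst_count_space[symmetric]) simp
  finally show ?thesis .
qed

lemma infsum_lists_sums:
  fixes f :: "nat list \<Rightarrow> real"
  assumes f: "f summable_on UNIV"
  shows "(\<lambda>j. infsum (\<lambda>l. f (j # l)) UNIV) sums (infsum f UNIV - f [])"
proof -
  have inj: "inj (\<lambda>(j, l). j # l :: nat list)" by (auto simp: inj_on_def)
  have rng: "range (\<lambda>(j, l). j # l :: nat list) = UNIV - {[]}"
    by (auto simp: image_iff) (metis list.exhaust)
  have f': "f summable_on (UNIV - {[]})" using f by (rule summable_on_subset_banach) auto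
  then have s: "(\<lambda>(j, l). f (j # l)) summable_on UNIV \<times> UNIV"
    unfolding rng[symmetric] by (subst (asm) summable_on_reindex[OF inj]) (simp add: comp_def case_prod_beta')
  have "infsum f UNIV = infsum f ({[]} \<union> (UNIV - {[]}))" by simp
  also have "\<dots> = f [] + infsum f (UNIV - {[]})" using f' by (subst infsum_Un_disjoint) auto
  also have "infsum f (UNIV - {[]}) = infsum (\<lambda>(j, l). f (j # l)) (UNIV \<times> UNIV)"
    unfolding rng[symmetric] by (subst infsum_reindex[OF inj]) (simp add: comp_def case_prod_beta')
  also have "\<dots> = infsum (\<lambda>j. infsum (\<lambda>l. f (j # l)) UNIV) UNIV"
    by (rule infsum_Sigma'_banach[OF s, symmetric])
  finally have "infsum f UNIV - f [] = infsum (\<lambda>j. infsum (\<lambda>l. f (j # l)) UNIV) UNIV" by simp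
  moreover have "(\<lambda>j. infsum (\<lambda>l. f (j # l)) UNIV) summable_on UNIV"
    by (rule summable_on_Sigma_banach[OF s])
  ultimately show ?thesis by (metis has_sum_infsum has_sum_imp_sums)
qed

lemma infsum_by_length_sums:
  fixes f :: "'a list \<Rightarrow> real"
  assumes f: "f summable_on UNIV"
  shows "(\<lambda>n. infsum f {l. length l = n}) sums infsum f UNIV"
proof -
  have bij: "bij_betw snd (SIGMA n:UNIV. {l. length l = n}) (UNIV :: 'a list set)"
    by (auto simp: bij_betw_def inj_on_def image_iff)
  have s: "(\<lambda>(n, l). f l) summable_on (SIGMA n:UNIV. {l. length l = n})"
    using f summable_on_reindex_bij_betw[OF bij, of f] by (simp add: case_prod_beta')
  have "infsum (\<lambda>n. infsum f {l. length l = n}) UNIV = infsum (\<lambda>(n, l). f l) (SIGMA n:UNIV. {l. length l = n})"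
    by (rule infsum_Sigma'_banach[OF s])
  also have "\<dots> = infsum f UNIV"
    using infsum_reindex_bij_betw[OF bij, of f] by (simp add: case_prod_beta')
  finally have "infsum (\<lambda>n. infsum f {l. length l = n}) UNIV = infsum f UNIV" .
  moreover have "(\<lambda>n. infsum f {l. length l = n}) summable_on UNIV"
    by (rule summable_on_Sigma_banach[OF s])
  ultimately show ?thesis by (metis has_sum_infsum has_sum_imp_sums)
qed

section \<open>The weighted branching tree as a function of its vectors\<close>

type_synonym vector = "real \<times> enat \<times> (nat \<Rightarrow> real)"

text \<open>Nodes are renumbered by \<open>map Suc\<close>, so that every list of natural numbers is a node. Overwriting
  the weights outside the offspring by \<open>0\<close> turns sums over generations into sums over all lists.\<close>

definition coef :: "vector \<Rightarrow> nat \<Rightarrow> real" where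
  "coef v j = (if Suc j \<in> offspring (fst (snd v)) then snd (snd v) (Suc j) else 0)"

definition subtree :: "nat \<Rightarrow> (nat list \<Rightarrow> vector) \<Rightarrow> nat list \<Rightarrow> vector" where
  "subtree j \<xi> = (\<lambda>k. \<xi> (j # k))"

primrec path_weight :: "nat list \<Rightarrow> (nat list \<Rightarrow> vector) \<Rightarrow> real" where
  "path_weight [] \<xi> = 1"
| "path_weight (j # l) \<xi> = coef (\<xi> []) j * path_weight l (subtree j \<xi>)"

definition contrib :: "nat list \<Rightarrow> (nat list \<Rightarrow> vector) \<Rightarrow> real" where
  "contrib l \<xi> = fst (\<xi> l) * path_weight l \<xi>"

definition tree_sum :: "(nat list \<Rightarrow> vector) \<Rightarrow> real" where
  "tree_sum \<xi> = infsum (\<lambda>l. contrib l \<xi>) UNIV"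

definition abs_tree_sum :: "(nat list \<Rightarrow> vector) \<Rightarrow> ennreal" where
  "abs_tree_sum \<xi> = (\<integral>\<^sup>+l. ennreal \<bar>contrib l \<xi>\<bar> \<partial>count_space UNIV)"

definition abs_generation_sum :: "nat \<Rightarrow> (nat list \<Rightarrow> vector) \<Rightarrow> ennreal" where
  "abs_generation_sum n \<xi> = (\<integral>\<^sup>+l. (if length l = n then ennreal \<bar>contrib l \<xi>\<bar> else 0) \<partial>count_space UNIV)"

abbreviation tree_space :: "(nat list \<Rightarrow> vector) measure" where
  "tree_space \<equiv> \<Pi>\<^sub>M l\<in>UNIV. vec_space"

lemma contrib_simps [simp]:
  "contrib [] \<xi> = fst (\<xi> [])"
  "contrib (j # l) \<xi> = coef (\<xi> []) j * contrib l (subtree j \<xi>)"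
  by (simp_all add: contrib_def subtree_def)

text \<open>Subtrees are split off at the first edge of a path, whereas \<open>generation\<close> and \<open>weight\<close> recurse on the
  last one; this lemma connects the two.\<close>

lemma path_weight_snoc: "path_weight (l @ [j]) \<xi> = path_weight l \<xi> * coef (\<xi> l) j"
  by (induction l arbitrary: \<xi>) (simp_all add: subtree_def)

lemma fst_vec_measurable[measurable]: "fst \<in> borel_measurable vec_space"
  unfolding vec_space_def by measurable

lemma coef_measurable[measurable]: "(\<lambda>v. coef v j) \<in> borel_measurable vec_space"
  unfolding vec_space_def coef_def by measurable

lemma subtree_measurable[measurable]: "subtree j \<in> measurable tree_space tree_space"
  unfolding subtree_def by (rule measurable_PiM_single') (auto simp: space_PiM)

lemma contrib_measurable[measurable]: "contrib l \<in> borel_measurable tree_space"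
proof (induction l)
  case Nil
  have "(\<lambda>\<xi>. fst (\<xi> [])) \<in> borel_measurable tree_space" by measurable
  then show ?case by (simp add: fun_eq_iff[symmetric])
next
  case (Cons j l)
  note [measurable] = Cons
  have "(\<lambda>\<xi>. coef (\<xi> []) j * contrib l (subtree j \<xi>)) \<in> borel_measurable tree_space" by measurable
  then show ?case by (simp add: fun_eq_iff[symmetric])
qed

lemma tree_sum_measurable[measurable]: "tree_sum \<in> borel_measurable tree_space"
  unfolding tree_sum_def[abs_def] by (rule borel_measurable_infsum) measurable

lemma abs_tree_sum_measurable[measurable]: "abs_tree_sum \<in> borel_measurable tree_space"
  unfolding abs_tree_sum_def[abs_def] by (rule borel_measurable_nn_integral_count_space) measurable

lemma abs_generation_sum_measurable[measurable]: "abs_generation_sum n \<in> borel_measurable tree_space"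
  unfolding abs_generation_sum_def[abs_def] by (rule borel_measurable_nn_integral_count_space) measurable

lemma abs_tree_sum_rec:
  "abs_tree_sum \<xi> = ennreal \<bar>fst (\<xi> [])\<bar> + (\<Sum>j. ennreal \<bar>coef (\<xi> []) j\<bar> * abs_tree_sum (subtree j \<xi>))"
  unfolding abs_tree_sum_def
  by (subst nn_integral_lists)
     (simp add: abs_mult ennreal_mult nn_integral_cmult nn_integral_count_space_nat)

lemma abs_generation_sum_0: "abs_generation_sum 0 \<xi> = ennreal \<bar>fst (\<xi> [])\<bar>"
  unfolding abs_generation_sum_def by (subst nn_integral_lists) simp

lemma abs_generation_sum_Suc:
  "abs_generation_sum (Suc n) \<xi> = (\<Sum>j. ennreal \<bar>coef (\<xi> []) j\<bar> * abs_generation_sum n (subtree j \<xi>))"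
proof -
  have eq: "(if length l = n then ennreal \<bar>contrib (j # l) \<xi>\<bar> else 0) =
    ennreal \<bar>coef (\<xi> []) j\<bar> * (if length l = n then ennreal \<bar>contrib l (subtree j \<xi>)\<bar> else 0)" for j l
    by (simp add: abs_mult ennreal_mult)
  then show ?thesis
    unfolding abs_generation_sum_def
    by (subst nn_integral_lists) (simp add: eq nn_integral_cmult nn_integral_count_space_nat)
qed

lemma abs_tree_sum_generations: "abs_tree_sum \<xi> = (\<Sum>n. abs_generation_sum n \<xi>)"
proof -
  have "(\<Sum>n. if length l = n then x else 0) = x" for l :: "nat list" and x :: ennreal
    by (subst suminf_finite[of "{length l}"]) auto
  then show ?thesis
    unfolding abs_tree_sum_def abs_generation_sum_def by (simp add: nn_integral_suminf[symmetric])
qed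

lemma tree_sum_le: "ennreal \<bar>tree_sum \<xi>\<bar> \<le> abs_tree_sum \<xi>"
  unfolding tree_sum_def abs_tree_sum_def by (rule abs_infsum_le_nn_integral)

lemma tree_sum_rec:
  assumes "abs_tree_sum \<xi> < \<infinity>"
  shows "(\<lambda>j. coef (\<xi> []) j * tree_sum (subtree j \<xi>)) sums (tree_sum \<xi> - fst (\<xi> []))"
proof -
  have "(\<lambda>l. contrib l \<xi>) summable_on UNIV"
    using assms by (simp add: summable_on_real_iff_nn_integral abs_tree_sum_def)
  from infsum_lists_sums[OF this] show ?thesis
    by (simp add: tree_sum_def infsum_cmult_right')
qed


section \<open>Independence of the subtrees\<close>

context weighted_branching_tree
begin

definition node_vec :: "nat list \<Rightarrow> 'w \<Rightarrow> vector" where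
  "node_vec i \<omega> = vec (QT i \<omega>) (NT i \<omega>) (\<lambda>j. CT (i @ [j]) \<omega>)"

definition env :: "'w \<Rightarrow> nat list \<Rightarrow> vector" where
  "env \<omega> l = node_vec (map Suc l) \<omega>"

lemma map_Suc_nodes: "map Suc l \<in> nodes"
  by (auto simp: nodes_def)

lemma nodes_eq: "nodes = range (map Suc)"
proof -
  have "l \<in> range (map Suc)" if "l \<in> nodes" for l
  proof (rule image_eqI)
    show "l = map Suc (map (\<lambda>x. x - 1) l)"
      using that by (induction l) (auto simp: nodes_def)
  qed simp
  then show ?thesis using map_Suc_nodes by auto
qed

lemma node_vec_measurable: "i \<in> nodes \<Longrightarrow> node_vec i \<in> measurable M vec_space"
  using independent by (auto simp: indep_vars_def2 node_vec_def[abs_def])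

lemma env_measurable[measurable]: "env \<in> measurable M tree_space"
  by (rule measurable_PiM_single')
     (auto simp: env_def space_PiM intro!: node_vec_measurable map_Suc_nodes
       dest: measurable_space[OF node_vec_measurable[OF map_Suc_nodes]])

text \<open>The vectors of distinct nodes are i.i.d., so all injective relabellings have the same law.\<close>

lemma law_relabelled:
  assumes "inj f" "\<And>l. f l \<in> nodes"
  shows "distr M tree_space (\<lambda>\<omega> l. node_vec (f l) \<omega>)
    = (\<Pi>\<^sub>M l\<in>(UNIV::nat list set). distr M vec_space (\<lambda>\<omega>. vec (Q \<omega>) (N \<omega>) (\<lambda>j. C j \<omega>)))"
proof -
  let ?\<mu> = "distr M vec_space (\<lambda>\<omega>. vec (Q \<omega>) (N \<omega>) (\<lambda>j. C j \<omega>))"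
  have nm: "\<And>i. i \<in> nodes \<Longrightarrow> node_vec i \<in> measurable M vec_space" by (rule node_vec_measurable)
  have "[] \<in> nodes" by (simp add: nodes_def)
  then have ne: "nodes \<noteq> {}" by auto
  have ps: "prob_space ?\<mu>"
    using prob_space_distr[OF node_vec_measurable[OF \<open>[] \<in> nodes\<close>]] identically_distributed[OF \<open>[] \<in> nodes\<close>]
    by (simp add: node_vec_def[abs_def])
  have all: "distr M (\<Pi>\<^sub>M i\<in>nodes. vec_space) (\<lambda>\<omega>. \<lambda>i\<in>nodes. node_vec i \<omega>) = (\<Pi>\<^sub>M i\<in>nodes. ?\<mu>)"
  proof -
    have "indep_vars (\<lambda>_. vec_space) node_vec nodes"
      using independent by (simp add: node_vec_def[abs_def])
    then have "distr M (\<Pi>\<^sub>M i\<in>nodes. vec_space) (\<lambda>\<omega>. \<lambda>i\<in>nodes. node_vec i \<omega>)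
      = (\<Pi>\<^sub>M i\<in>nodes. distr M vec_space (node_vec i))"
      using indep_vars_iff_distr_eq_PiM'[where M'="\<lambda>_. vec_space" and X=node_vec, OF ne] nm by auto
    also have "\<dots> = (\<Pi>\<^sub>M i\<in>nodes. ?\<mu>)"
      using identically_distributed by (intro PiM_cong) (auto simp: node_vec_def[abs_def])
    finally show ?thesis .
  qed
  have sets_eq: "sets (\<Pi>\<^sub>M l\<in>(UNIV::nat list set). ?\<mu>) = sets tree_space"
    by (intro sets_PiM_cong) auto
  have "distr M tree_space (\<lambda>\<omega> l. node_vec (f l) \<omega>)
     = distr (distr M (\<Pi>\<^sub>M i\<in>nodes. vec_space) (\<lambda>\<omega>. \<lambda>i\<in>nodes. node_vec i \<omega>)) tree_space (\<lambda>\<zeta>. \<lambda>l\<in>UNIV. \<zeta> (f l))"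
  proof (subst distr_distr)
    show "(\<lambda>\<omega>. \<lambda>i\<in>nodes. node_vec i \<omega>) \<in> measurable M (\<Pi>\<^sub>M i\<in>nodes. vec_space)"
      using nm by (intro measurable_restrict) auto
    show "(\<lambda>\<zeta>. \<lambda>l\<in>UNIV. \<zeta> (f l)) \<in> measurable (\<Pi>\<^sub>M i\<in>nodes. vec_space) tree_space"
      using assms by (intro measurable_restrict measurable_component_singleton) auto
    show "distr M tree_space (\<lambda>\<omega> l. node_vec (f l) \<omega>)
       = distr M tree_space ((\<lambda>\<zeta>. \<lambda>l\<in>UNIV. \<zeta> (f l)) \<circ> (\<lambda>\<omega>. \<lambda>i\<in>nodes. node_vec i \<omega>))"
      using assms by (simp add: comp_def restrict_def)
  qed
  also have "\<dots> = distr (\<Pi>\<^sub>M i\<in>nodes. ?\<mu>) (\<Pi>\<^sub>M l\<in>UNIV. ?\<mu>) (\<lambda>\<zeta>. \<lambda>l\<in>UNIV. \<zeta> (f l))"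
    unfolding all by (rule distr_cong) (simp_all add: sets_eq)
  also have "\<dots> = (\<Pi>\<^sub>M l\<in>UNIV. ?\<mu>)"
    using distr_PiM_reindex[of nodes "\<lambda>_. ?\<mu>" f UNIV] assms ps by auto
  finally show ?thesis .
qed

lemma distr_relabelled:
  assumes f: "inj f" "\<And>l. f l \<in> nodes" and g: "inj g" "\<And>l. g l \<in> nodes"
    and \<phi>[measurable]: "\<phi> \<in> measurable tree_space T"
  shows "distr M T (\<lambda>\<omega>. \<phi> (\<lambda>l. node_vec (f l) \<omega>)) = distr M T (\<lambda>\<omega>. \<phi> (\<lambda>l. node_vec (g l) \<omega>))"
proof -
  have meas: "(\<lambda>\<omega> l. node_vec (h l) \<omega>) \<in> measurable M tree_space" if "\<And>l. h l \<in> nodes" for h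
    using that measurable_space[OF node_vec_measurable]
    by (intro measurable_PiM_single') (auto simp: space_PiM intro!: node_vec_measurable)
  have "distr M T (\<lambda>\<omega>. \<phi> (\<lambda>l. node_vec (h l) \<omega>)) = distr (distr M tree_space (\<lambda>\<omega> l. node_vec (h l) \<omega>)) T \<phi>"
    if "\<And>l. h l \<in> nodes" for h
    using meas[OF that] by (subst distr_distr) (auto simp: comp_def)
  then show ?thesis using f g by (simp add: law_relabelled)
qed

lemma subtree_env: "subtree j (env \<omega>) = (\<lambda>l. node_vec (Suc j # map Suc l) \<omega>)"
  by (simp add: subtree_def env_def fun_eq_iff)

lemma distr_subtree:
  assumes "\<phi> \<in> measurable tree_space T"
  shows "distr M T (\<lambda>\<omega>. \<phi> (subtree j (env \<omega>))) = distr M T (\<lambda>\<omega>. \<phi> (env \<omega>))"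
proof -
  have "inj (\<lambda>l. Suc j # map Suc l)" "inj (map Suc)"
    by (auto simp: inj_def inj_map_eq_map)
  moreover have "Suc j # map Suc l \<in> nodes" for l using map_Suc_nodes[of "j # l"] by simp
  ultimately have "distr M T (\<lambda>\<omega>. \<phi> (\<lambda>l. node_vec (Suc j # map Suc l) \<omega>))
      = distr M T (\<lambda>\<omega>. \<phi> (\<lambda>l. node_vec (map Suc l) \<omega>))"
    using map_Suc_nodes by (intro distr_relabelled assms) auto
  then show ?thesis unfolding subtree_env by (simp add: env_def[abs_def])
qed

abbreviation outside :: "nat \<Rightarrow> nat list set" where
  "outside j \<equiv> nodes - range (\<lambda>l. Suc j # map Suc l)"

text \<open>The subtree at child \<open>j\<close> and everything else are functions of the vectors on disjoint sets of nodes.\<close>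

lemma subtree_indep:
  assumes \<phi>: "\<phi> \<in> measurable tree_space S"
    and \<psi>: "\<psi> \<in> measurable (\<Pi>\<^sub>M i\<in>outside j. vec_space) T"
    and Y: "\<And>\<omega>. Y \<omega> = \<psi> (\<lambda>i\<in>outside j. node_vec i \<omega>)"
  shows "distr M (S \<Otimes>\<^sub>M T) (\<lambda>\<omega>. (\<phi> (subtree j (env \<omega>)), Y \<omega>)) = distr M S (\<lambda>\<omega>. \<phi> (env \<omega>)) \<Otimes>\<^sub>M distr M T Y"
proof -
  define A where "A = range (\<lambda>l. Suc j # map Suc l)"
  have A: "A \<subseteq> nodes" using map_Suc_nodes[of "j # l" for l] by (auto simp: A_def)
  have Y': "Y = (\<lambda>\<omega>. \<psi> (\<lambda>i\<in>nodes - A. node_vec i \<omega>))"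
    by (rule ext) (simp only: Y A_def)
  have inA: "Suc j # map Suc l \<in> A" for l by (auto simp: A_def)
  let ?X = "\<lambda>\<omega>. \<lambda>i\<in>A. node_vec i \<omega>" and ?Y = "\<lambda>\<omega>. \<lambda>i\<in>nodes - A. node_vec i \<omega>"
  have "indep_vars (\<lambda>_. vec_space) node_vec nodes"
    using independent by (simp add: node_vec_def[abs_def])
  then have "indep_var (\<Pi>\<^sub>M i\<in>A. vec_space) ?X (\<Pi>\<^sub>M i\<in>nodes - A. vec_space) ?Y"
    by (rule indep_var_restrict) (use A in auto)
  then have law: "random_variable (\<Pi>\<^sub>M i\<in>A. vec_space) ?X" "random_variable (\<Pi>\<^sub>M i\<in>nodes - A. vec_space) ?Y"
    "distr M ((\<Pi>\<^sub>M i\<in>A. vec_space) \<Otimes>\<^sub>M (\<Pi>\<^sub>M i\<in>nodes - A. vec_space)) (\<lambda>\<omega>. (?X \<omega>, ?Y \<omega>))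
      = distr M (\<Pi>\<^sub>M i\<in>A. vec_space) ?X \<Otimes>\<^sub>M distr M (\<Pi>\<^sub>M i\<in>nodes - A. vec_space) ?Y"
    by (simp_all add: indep_var_distribution_eq)
  have sh: "(\<lambda>\<zeta> l. \<zeta> (Suc j # map Suc l)) \<in> measurable (\<Pi>\<^sub>M i\<in>A. vec_space) tree_space"
    by (rule measurable_PiM_single')
       (auto simp: A_def space_PiM intro!: measurable_component_singleton)
  have "(\<lambda>\<zeta>. \<phi> (\<lambda>l. \<zeta> (Suc j # map Suc l))) \<in> measurable (\<Pi>\<^sub>M i\<in>A. vec_space) S"
    by (rule measurable_compose[OF sh \<phi>])
  from product_law_compose[OF law(1) law(1) law(2) law(3) this \<psi>[folded A_def]]
  have "distr M (S \<Otimes>\<^sub>M T) (\<lambda>\<omega>. (\<phi> (subtree j (env \<omega>)), Y \<omega>))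
      = distr M S (\<lambda>\<omega>. \<phi> (subtree j (env \<omega>))) \<Otimes>\<^sub>M distr M T Y"
    by (simp add: subtree_env inA Y')
  then show ?thesis by (simp add: distr_subtree[OF \<phi>])
qed


definition root_q :: "'w \<Rightarrow> real" where "root_q \<omega> = fst (env \<omega> [])"
definition root_c :: "nat \<Rightarrow> 'w \<Rightarrow> real" where "root_c j \<omega> = \<bar>coef (env \<omega> []) j\<bar>"

lemma env_component_measurable: "(\<lambda>\<omega>. env \<omega> l) \<in> measurable M vec_space"
  by (rule measurable_compose[OF env_measurable]) (rule measurable_component_singleton, simp)

lemma root_q_measurable[measurable]: "root_q \<in> borel_measurable M"
  unfolding root_q_def[abs_def] by (rule measurable_compose[OF env_component_measurable]) measurable

lemma root_c_measurable[measurable]: "root_c j \<in> borel_measurable M"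
proof -
  have "(\<lambda>v. \<bar>coef v j\<bar>) \<in> borel_measurable vec_space" by measurable
  from measurable_compose[OF env_component_measurable this] show ?thesis
    by (simp add: root_c_def[abs_def])
qed

lemma root_coef:
  assumes "\<omega> \<in> space M"
  shows "coef (env \<omega> []) j = (if Suc j \<in> offspring (N \<omega>) then C (Suc j) \<omega> else 0)"
    and "root_q \<omega> = Q \<omega>"
proof -
  have eq: "env \<omega> [] = vec (Q \<omega>) (N \<omega>) (\<lambda>j. C j \<omega>)"
    using root[OF assms] by (simp add: env_def node_vec_def)
  show "coef (env \<omega> []) j = (if Suc j \<in> offspring (N \<omega>) then C (Suc j) \<omega> else 0)" "root_q \<omega> = Q \<omega>"
    by (simp_all add: eq coef_def vec_def root_q_def)
qed

lemma nil_notin_range: "[] \<in> outside j"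
  by (auto simp: nodes_def)

lemma coef_root_component_measurable:
  "(\<lambda>\<zeta>. \<bar>coef (\<zeta> []) k\<bar>) \<in> borel_measurable (\<Pi>\<^sub>M i\<in>outside j. vec_space)"
proof -
  have "(\<lambda>\<zeta>. \<zeta> []) \<in> measurable (\<Pi>\<^sub>M i\<in>outside j. vec_space) vec_space"
    by (rule measurable_component_singleton[OF nil_notin_range])
  from measurable_compose[OF this coef_measurable[of k]]
  have [measurable]: "(\<lambda>\<zeta>. coef (\<zeta> []) k) \<in> borel_measurable (\<Pi>\<^sub>M i\<in>outside j. vec_space)" .
  show ?thesis by measurable
qed

lemma subtree_root_c_law:
  assumes "\<phi> \<in> measurable tree_space S"
  shows "distr M (S \<Otimes>\<^sub>M borel) (\<lambda>\<omega>. (\<phi> (subtree j (env \<omega>)), root_c j \<omega>))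
    = distr M S (\<lambda>\<omega>. \<phi> (env \<omega>)) \<Otimes>\<^sub>M distr M borel (root_c j)"
proof (rule subtree_indep[OF assms coef_root_component_measurable])
  fix \<omega>
  show "root_c j \<omega> = \<bar>coef ((\<lambda>i\<in>outside j. node_vec i \<omega>) []) j\<bar>"
    using nil_notin_range[of j] by (simp add: root_c_def env_def)
qed

lemma tree_linear_recursion:
  "linear_recursion M root_q root_c (\<lambda>\<omega>. abs_tree_sum (env \<omega>)) (\<lambda>j \<omega>. abs_tree_sum (subtree j (env \<omega>)))"
proof
  show "AE \<omega> in M. abs_tree_sum (env \<omega>)
      = ennreal \<bar>root_q \<omega>\<bar> + (\<Sum>j. ennreal (root_c j \<omega>) * abs_tree_sum (subtree j (env \<omega>)))"
    by (simp add: root_q_def root_c_def abs_tree_sum_rec[symmetric])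
  fix j
  define \<psi> where "\<psi> \<zeta> = (fst (\<zeta> []), \<lambda>k. \<bar>coef (\<zeta> []) k\<bar>,
      \<lambda>k. if k = j then 0 else abs_tree_sum (\<lambda>l. \<zeta> (Suc k # map Suc l)))" for \<zeta> :: "nat list \<Rightarrow> vector"
  have mem: "Suc k # map Suc l \<in> outside j" if "k \<noteq> j" for k l
    using map_Suc_nodes[of "k # l"] that by auto
  have comp0: "(\<lambda>\<zeta>. fst (\<zeta> [])) \<in> borel_measurable (\<Pi>\<^sub>M i\<in>outside j. vec_space)"
    by (rule measurable_compose[OF measurable_component_singleton[OF nil_notin_range] fst_vec_measurable])
  have sub: "(\<lambda>\<zeta>. if k = j then 0 else abs_tree_sum (\<lambda>l. \<zeta> (Suc k # map Suc l))) \<in> borel_measurable (\<Pi>\<^sub>M i\<in>outside j. vec_space)" for k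
  proof (cases "k = j")
    case False
    have "(\<lambda>\<zeta> l. \<zeta> (Suc k # map Suc l)) \<in> measurable (\<Pi>\<^sub>M i\<in>outside j. vec_space) tree_space"
    proof (rule measurable_PiM_single')
      show "(\<lambda>\<zeta>. \<zeta> (Suc k # map Suc l)) \<in> measurable (\<Pi>\<^sub>M i\<in>outside j. vec_space) vec_space" for l
        by (rule measurable_component_singleton[OF mem[OF False]])
    qed (use mem[OF False] in \<open>auto simp: space_PiM PiE_def Pi_def\<close>)
    from measurable_compose[OF this abs_tree_sum_measurable] show ?thesis using False by simp
  qed simp
  have "\<psi> \<in> measurable (\<Pi>\<^sub>M i\<in>outside j. vec_space) rest_space"
    unfolding \<psi>_def
    by (intro measurable_Pair measurable_PiM_single' comp0 coef_root_component_measurable sub) (auto simp: space_PiM)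
  then show "distr M (borel \<Otimes>\<^sub>M rest_space)
        (\<lambda>\<omega>. (abs_tree_sum (subtree j (env \<omega>)), root_q \<omega>, \<lambda>k. root_c k \<omega>, \<lambda>k. if k = j then 0 else abs_tree_sum (subtree k (env \<omega>)))) =
      distr M borel (\<lambda>\<omega>. abs_tree_sum (env \<omega>)) \<Otimes>\<^sub>M distr M rest_space
        (\<lambda>\<omega>. (root_q \<omega>, \<lambda>k. root_c k \<omega>, \<lambda>k. if k = j then 0 else abs_tree_sum (subtree k (env \<omega>))))"
  proof (rule subtree_indep[OF abs_tree_sum_measurable])
    fix \<omega>
    show "(root_q \<omega>, \<lambda>k. root_c k \<omega>, \<lambda>k. if k = j then 0 else abs_tree_sum (subtree k (env \<omega>)))
      = \<psi> (\<lambda>i\<in>outside j. node_vec i \<omega>)"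
    proof -
      have nil: "(\<lambda>i\<in>outside j. node_vec i \<omega>) [] = env \<omega> []"
        using nil_notin_range[of j] by (simp add: env_def)
      have sub: "(\<lambda>l. (\<lambda>i\<in>outside j. node_vec i \<omega>) (Suc k # map Suc l)) = subtree k (env \<omega>)" if "k \<noteq> j" for k
        unfolding subtree_env by (rule ext) (rule restrict_apply'[OF mem[OF that]])
      show ?thesis
        unfolding \<psi>_def nil root_q_def root_c_def prod.inject
        by (intro conjI refl ext if_cong arg_cong[where f=abs_tree_sum] sub[symmetric])
    qed
  qed
qed (auto simp: root_c_def intro: measurable_compose[OF env_measurable] measurable_compose[OF subtree_measurable])

sublocale tree: linear_recursion M root_q root_c "\<lambda>\<omega>. abs_tree_sum (env \<omega>)" "\<lambda>j \<omega>. abs_tree_sum (subtree j (env \<omega>))"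
  by (rule tree_linear_recursion)

text \<open>By independence of the root's weights and the subtrees, passing to the next generation multiplies the
  expected absolute sum by the intensity's first moment.\<close>

lemma abs_tree_sum_integrable:
  assumes q: "mean (\<lambda>\<omega>. ennreal \<bar>root_q \<omega>\<bar>) < \<infinity>" and m1: "moment tree.intensity 1 < 1"
  shows "mean (\<lambda>\<omega>. abs_tree_sum (env \<omega>)) < \<infinity>"
proof -
  have gm[measurable]: "(\<lambda>\<omega>. abs_generation_sum n (env \<omega>)) \<in> borel_measurable M" for n
    by (rule measurable_compose[OF env_measurable]) measurable
  have gs[measurable]: "(\<lambda>\<omega>. abs_generation_sum n (subtree j (env \<omega>))) \<in> borel_measurable M" for n j
    by (rule measurable_compose[OF env_measurable]) measurable
  have step: "mean (\<lambda>\<omega>. abs_generation_sum (Suc n) (env \<omega>))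
      = moment tree.intensity 1 * mean (\<lambda>\<omega>. abs_generation_sum n (env \<omega>))" for n
  proof -
    have "mean (\<lambda>\<omega>. abs_generation_sum (Suc n) (env \<omega>))
        = (\<Sum>j. \<integral>\<^sup>+\<omega>. ennreal (root_c j \<omega>) * abs_generation_sum n (subtree j (env \<omega>)) \<partial>M)"
      by (simp add: abs_generation_sum_Suc root_c_def[symmetric] nn_integral_suminf)
    also have "\<dots> = (\<Sum>j. mean (\<lambda>\<omega>. ennreal (root_c j \<omega>)) * mean (\<lambda>\<omega>. abs_generation_sum n (env \<omega>)))"
    proof (intro arg_cong[where f=suminf] ext)
      fix j
      have "mean (\<lambda>\<omega>. ennreal (root_c j \<omega>) * abs_generation_sum n (subtree j (env \<omega>)))
        = mean (\<lambda>\<omega>. (\<integral>\<^sup>+\<omega>'. ennreal (root_c j \<omega>) * abs_generation_sum n (env \<omega>') \<partial>M))"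
        using nn_integral_product_law[OF gs gm root_c_measurable
            subtree_root_c_law[OF abs_generation_sum_measurable], of "\<lambda>(x, y). ennreal y * x"] by simp
      also have "\<dots> = mean (\<lambda>\<omega>. ennreal (root_c j \<omega>)) * mean (\<lambda>\<omega>. abs_generation_sum n (env \<omega>))"
        by (simp add: nn_integral_cmult nn_integral_multc)
      finally show "mean (\<lambda>\<omega>. ennreal (root_c j \<omega>) * abs_generation_sum n (subtree j (env \<omega>)))
        = mean (\<lambda>\<omega>. ennreal (root_c j \<omega>)) * mean (\<lambda>\<omega>. abs_generation_sum n (env \<omega>))" .
    qed
    also have "\<dots> = moment tree.intensity 1 * mean (\<lambda>\<omega>. abs_generation_sum n (env \<omega>))"
      by (simp add: tree.moment_intensity_1 tree.Z_def nn_integral_suminf)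
    finally show ?thesis .
  qed
  obtain m where m: "moment tree.intensity 1 = ennreal m" "0 \<le> m" "m < 1"
    using m1 by (cases "moment tree.intensity 1") auto
  obtain k where k: "mean (\<lambda>\<omega>. ennreal \<bar>root_q \<omega>\<bar>) = ennreal k" "k \<ge> 0"
    using q by (cases "\<integral>\<^sup>+\<omega>. ennreal \<bar>root_q \<omega>\<bar> \<partial>M") auto
  have gen: "mean (\<lambda>\<omega>. abs_generation_sum n (env \<omega>)) = ennreal (k * m ^ n)" for n
  proof (induction n)
    case 0
    then show ?case using k by (simp add: abs_generation_sum_0 root_q_def)
  next
    case (Suc n)
    then show ?case using m k by (simp add: step mult_ac flip: ennreal_mult)
  qed
  have "mean (\<lambda>\<omega>. abs_tree_sum (env \<omega>)) = (\<Sum>n. ennreal (k * m ^ n))"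
    by (simp add: abs_tree_sum_generations nn_integral_suminf gen)
  also have "\<dots> < \<infinity>"
    using m k by (subst suminf_ennreal2) (auto intro!: summable_mult summable_geometric)
  finally show ?thesis .
qed

text \<open>The tree gives signed weights \<open>coef\<close> and nonnegative weights \<open>root_c\<close>, which agree almost surely; the
  recursion of \<open>tree_sum\<close> needs absolute convergence and therefore also holds almost surely only.\<close>

lemma tree_dominated_recursion:
  assumes fin: "mean (\<lambda>\<omega>. abs_tree_sum (env \<omega>)) < \<infinity>"
    and C_nonneg: "AE \<omega> in M. \<forall>j\<in>offspring (N \<omega>). C j \<omega> \<ge> 0"
  shows "dominated_recursion M root_q root_c (\<lambda>\<omega>. abs_tree_sum (env \<omega>)) (\<lambda>j \<omega>. abs_tree_sum (subtree j (env \<omega>)))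
    root_q (\<lambda>\<omega>. tree_sum (env \<omega>)) (\<lambda>j \<omega>. tree_sum (subtree j (env \<omega>)))"
proof (intro dominated_recursion.intro tree_linear_recursion dominated_recursion_axioms.intro)
  have "AE \<omega> in M. abs_tree_sum (env \<omega>) \<noteq> \<infinity>"
    by (rule tree.AE_finite_of_moment[OF fin tree.B_measurable])
  then show "AE \<omega> in M. (\<lambda>j. root_c j \<omega> * tree_sum (subtree j (env \<omega>))) sums (tree_sum (env \<omega>) - root_q \<omega>)"
    using C_nonneg AE_space
  proof eventually_elim
    case (elim \<omega>)
    have "root_c j \<omega> = coef (env \<omega> []) j" for j
      using elim by (simp add: root_c_def root_coef)
    then show ?case using tree_sum_rec[of "env \<omega>"] elim by (simp add: root_q_def less_top)
  qed
  show "(\<lambda>\<omega>. tree_sum (env \<omega>)) \<in> borel_measurable M"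
    by (rule measurable_compose[OF env_measurable tree_sum_measurable])
  show "(\<lambda>\<omega>. tree_sum (subtree j (env \<omega>))) \<in> borel_measurable M" for j
    by (rule measurable_compose[OF env_measurable]) measurable
qed (auto simp: tree_sum_le subtree_root_c_law)

section \<open>Generations\<close>

lemma generation_node: "i \<in> generation NT n \<omega> \<Longrightarrow> length i = n \<and> i \<in> nodes"
proof (induction n arbitrary: i)
  case (Suc n)
  then obtain i' j where "i = i' @ [j]" "i' \<in> generation NT n \<omega>" "j \<in> offspring (NT i' \<omega>)" by auto
  with Suc.IH[of i'] show ?case by (auto simp: nodes_def offspring_def)
qed (simp add: nodes_def)

lemma generation_snoc:
  "i @ [j] \<in> generation NT (Suc n) \<omega> \<longleftrightarrow> i \<in> generation NT n \<omega> \<and> j \<in> offspring (NT i \<omega>)"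
  by auto

lemma path_weight_env:
  "path_weight l (env \<omega>) = (if map Suc l \<in> generation NT (length l) \<omega> then weight CT (map Suc l) \<omega> else 0)"
proof (induction l rule: rev_induct)
  case (snoc j l)
  have "coef (env \<omega> l) j = (if Suc j \<in> offspring (NT (map Suc l) \<omega>) then CT (map Suc l @ [Suc j]) \<omega> else 0)"
    by (simp add: coef_def env_def node_vec_def vec_def)
  then show ?case
    using snoc generation_snoc[of "map Suc l" "Suc j" "length l" \<omega>]
    by (auto simp: path_weight_snoc simp del: generation.simps)
qed simp

text \<open>Paths that leave the tree have a coefficient \<open>0\<close>, so the sum may run over all lists of a given length,
  an index set that does not depend on \<open>\<omega>\<close>.\<close>

lemma W_gen_eq: "W_gen QT NT CT n \<omega> = infsum (\<lambda>l. contrib l (env \<omega>)) {l. length l = n}"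
proof -
  define G where "G = {l. map Suc l \<in> generation NT n \<omega>}"
  have img: "generation NT n \<omega> = map Suc ` G"
  proof
    show "generation NT n \<omega> \<subseteq> map Suc ` G"
      using generation_node[of _ n \<omega>] by (fastforce simp: G_def nodes_eq)
  qed (auto simp: G_def)
  have len: "length l = n" if "l \<in> G" for l
    using generation_node[of "map Suc l" n \<omega>] that by (simp add: G_def)
  have "W_gen QT NT CT n \<omega> = infsum (\<lambda>l. QT (map Suc l) \<omega> * weight CT (map Suc l) \<omega>) G"
    unfolding W_gen_def img
    by (subst infsum_reindex) (auto simp: comp_def intro: inj_on_subset[OF inj_mapI])
  also have "\<dots> = infsum (\<lambda>l. contrib l (env \<omega>)) {l. length l = n}"
  proof (rule infsum_cong_neutral)
    fix l assume "l \<in> G \<inter> {l. length l = n}"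
    then show "QT (map Suc l) \<omega> * weight CT (map Suc l) \<omega> = contrib l (env \<omega>)"
      by (auto simp: contrib_def path_weight_env G_def) (simp add: env_def node_vec_def vec_def)
  next
    fix l assume "l \<in> {l. length l = n} - G"
    then show "contrib l (env \<omega>) = 0" by (auto simp: contrib_def path_weight_env G_def)
  qed (use len in auto)
  finally show ?thesis .
qed

text \<open>Agreement with \<open>tree_sum\<close> almost surely would not make the events \<open>R_total > x\<close> measurable, as \<open>M\<close> need
  not be complete; so measurability is shown on the whole space, with the default values of divergent sums.\<close>

lemma R_total_measurable: "R_total QT NT CT \<in> borel_measurable M"
proof -
  have [measurable]: "(\<lambda>\<omega>. contrib l (env \<omega>)) \<in> borel_measurable M" for l
    by (rule measurable_compose[OF env_measurable contrib_measurable])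
  have "W_gen QT NT CT n \<omega> = infsum (\<lambda>l. if length l = n then contrib l (env \<omega>) else 0) UNIV" for n \<omega>
    unfolding W_gen_eq by (rule infsum_cong_neutral) auto
  moreover have "(\<lambda>\<omega>. infsum (\<lambda>l. if length l = n then contrib l (env \<omega>) else 0) UNIV) \<in> borel_measurable M" for n
    by (rule borel_measurable_infsum) measurable
  ultimately have [measurable]: "(\<lambda>\<omega>. W_gen QT NT CT n \<omega>) \<in> borel_measurable M" for n by simp
  show ?thesis unfolding R_total_def[abs_def] by measurable
qed

lemma R_total_eq:
  assumes "abs_tree_sum (env \<omega>) < \<infinity>"
  shows "R_total QT NT CT \<omega> = tree_sum (env \<omega>)"
proof -
  have "(\<lambda>l. contrib l (env \<omega>)) summable_on UNIV"
    using assms by (simp add: summable_on_real_iff_nn_integral abs_tree_sum_def)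
  from sums_unique[OF infsum_by_length_sums[OF this]] show ?thesis
    by (simp add: R_total_def W_gen_eq tree_sum_def)
qed

lemma moment_tree_intensity:
  assumes C_nonneg: "AE \<omega> in M. \<forall>j\<in>offspring (N \<omega>). C j \<omega> \<ge> 0"
  shows "moment tree.intensity \<beta> = rho M N C \<beta>"
proof -
  have off: "0 \<notin> offspring n" for n by (simp add: offspring_def)
  have "moment tree.intensity \<beta> = mean (\<lambda>\<omega>. (\<Sum>j. ennreal (root_c j \<omega> powr \<beta>) * indicator {0<..} (root_c j \<omega>)))"
    unfolding moment_def by (subst tree.nn_integral_intensity) auto
  also have "\<dots> = rho M N C \<beta>"
    unfolding rho_def
  proof (rule nn_integral_cong_AE, use C_nonneg AE_space in eventually_elim)
    case (elim \<omega>)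
    show ?case
      unfolding infsum_offspring_eq_suminf[OF off]
      using elim by (intro suminf_cong) (auto simp: root_c_def root_coef indicator_def)
  qed
  finally show ?thesis .
qed

lemma Z_tree_eq:
  assumes C_nonneg: "AE \<omega> in M. \<forall>j\<in>offspring (N \<omega>). C j \<omega> \<ge> 0"
  shows "AE \<omega> in M. tree.Z \<omega> = Z_sum N C \<omega>"
  using C_nonneg AE_space
proof eventually_elim
  case (elim \<omega>)
  have off: "0 \<notin> offspring n" for n by (simp add: offspring_def)
  show ?case
    unfolding tree.Z_def Z_sum_def infsum_offspring_eq_suminf[OF off]
    using elim by (intro suminf_cong) (auto simp: root_c_def root_coef)
qed

end

section \<open>Tail of the total weight\<close>

theorem theorem4p4:
  fixes M :: "'w measure"
    and Q :: "'w \<Rightarrow> real" and N :: "'w \<Rightarrow> enat" and C :: "nat \<Rightarrow> 'w \<Rightarrow> real"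
    and QT :: "nat list \<Rightarrow> 'w \<Rightarrow> real" and NT :: "nat list \<Rightarrow> 'w \<Rightarrow> enat"
    and CT :: "nat list \<Rightarrow> 'w \<Rightarrow> real"
    and \<alpha> :: real
  assumes tree: "weighted_branching_tree M Q N C QT NT CT"
    and C_nonneg: "AE \<omega> in M. \<forall>j\<in>offspring (N \<omega>). C j \<omega> \<ge> 0"
    and Q_nontrivial: "\<P>(\<omega> in M. \<bar>Q \<omega>\<bar> > 0) > 0"
    and alpha: "\<alpha> > 1"
    and Q_tail: "(\<lambda>x. \<P>(\<omega> in M. Q \<omega> > x)) \<in> regularly_varying (- \<alpha>)"
    and Q_moments: "\<And>\<beta>. 0 < \<beta> \<Longrightarrow> \<beta> < \<alpha> \<Longrightarrow> integrable M (\<lambda>\<omega>. \<bar>Q \<omega>\<bar> powr \<beta>)"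
    and rho_less_1: "max (rho M N C 1) (rho M N C \<alpha>) < 1"
    and Z_moment: "\<exists>\<epsilon>>0. (\<integral>\<^sup>+\<omega>. ennreal_powr (Z_sum N C \<omega>) (\<alpha> + \<epsilon>) \<partial>M) < \<infinity>"
  shows "(\<lambda>x. \<P>(\<omega> in M. R_total QT NT CT \<omega> > x)) \<sim>[at_top]
         (\<lambda>x. inverse (1 - enn2real (rho M N C \<alpha>)) * \<P>(\<omega> in M. Q \<omega> > x))"
proof -
  interpret weighted_branching_tree M Q N C QT NT CT by (rule tree)
  obtain \<epsilon> where \<epsilon>: "\<epsilon> > 0" "mean (\<lambda>\<omega>. ennreal_powr (Z_sum N C \<omega>) (\<alpha> + \<epsilon>)) < \<infinity>"
    using Z_moment by auto
  note moment = moment_tree_intensity[OF C_nonneg]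
  have m: "moment tree.intensity 1 < 1" "moment tree.intensity \<alpha> < 1"
    using rho_less_1 by (simp_all add: moment)
  have q: "mean (\<lambda>\<omega>. ennreal (\<bar>root_q \<omega>\<bar> powr \<beta>)) < \<infinity>" if "0 < \<beta>" "\<beta> < \<alpha>" for \<beta>
  proof -
    have "mean (\<lambda>\<omega>. ennreal (\<bar>root_q \<omega>\<bar> powr \<beta>)) = mean (\<lambda>\<omega>. ennreal (norm (\<bar>Q \<omega>\<bar> powr \<beta>)))"
      by (intro nn_integral_cong) (simp add: root_coef)
    also have "\<dots> < \<infinity>" using Q_moments[OF that] by (simp add: integrable_iff_bounded)
    finally show ?thesis .
  qed
  have "mean (\<lambda>\<omega>. ennreal \<bar>root_q \<omega>\<bar>) < \<infinity>" using q[of 1] alpha by simp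
  then have fin: "mean (\<lambda>\<omega>. abs_tree_sum (env \<omega>)) < \<infinity>"
    using m by (intro abs_tree_sum_integrable)
  interpret D: dominated_recursion M root_q root_c "\<lambda>\<omega>. abs_tree_sum (env \<omega>)" "\<lambda>j \<omega>. abs_tree_sum (subtree j (env \<omega>))"
    root_q "\<lambda>\<omega>. tree_sum (env \<omega>)" "\<lambda>j \<omega>. tree_sum (subtree j (env \<omega>))"
    by (rule tree_dominated_recursion[OF fin C_nonneg])
  have Qx: "\<P>(\<omega> in M. root_q \<omega> > x) = \<P>(\<omega> in M. Q \<omega> > x)" for x
    by (intro arg_cong[where f=prob]) (auto simp: root_coef)
  have Z: "mean (\<lambda>\<omega>. ennreal_powr (tree.Z \<omega>) (\<alpha> + \<epsilon>)) < \<infinity>"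
  proof -
    have "mean (\<lambda>\<omega>. ennreal_powr (tree.Z \<omega>) (\<alpha> + \<epsilon>)) = mean (\<lambda>\<omega>. ennreal_powr (Z_sum N C \<omega>) (\<alpha> + \<epsilon>))"
      using Z_tree_eq[OF C_nonneg] by (intro nn_integral_cong_AE) auto
    then show ?thesis using \<epsilon> by simp
  qed
  have R: "\<P>(\<omega> in M. R_total QT NT CT \<omega> > x) = D.tail x" for x
  proof (rule measure_eq_AE)
    have "AE \<omega> in M. abs_tree_sum (env \<omega>) \<noteq> \<infinity>"
      by (rule tree.AE_finite_of_moment[OF fin tree.B_measurable])
    then show "AE \<omega> in M. \<omega> \<in> {\<omega> \<in> space M. R_total QT NT CT \<omega> > x} \<longleftrightarrow> \<omega> \<in> {\<omega> \<in> space M. tree_sum (env \<omega>) > x}"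
      by eventually_elim (auto simp: R_total_eq less_top)
    show "{\<omega> \<in> space M. R_total QT NT CT \<omega> > x} \<in> events"
      using R_total_measurable by measurable
    show "{\<omega> \<in> space M. tree_sum (env \<omega>) > x} \<in> events" by measurable
  qed
  define \<rho> where "\<rho> = enn2real (rho M N C \<alpha>)"
  have \<rho>: "\<rho> < 1" using rho_less_1 by (cases "rho M N C \<alpha>") (auto simp: \<rho>_def)
  have lim: "((\<lambda>x. D.tail x / \<P>(\<omega> in M. root_q \<omega> > x)) \<longlongrightarrow> 1 / (1 - \<rho>)) at_top"
    using D.tail_ratio_limit[of \<alpha> "\<alpha> + \<epsilon>"] alpha \<epsilon>(1) Q_tail q m Z fin
    by (simp add: Qx moment \<rho>_def)
  have "((\<lambda>x. (1 - \<rho>) * (D.tail x / \<P>(\<omega> in M. root_q \<omega> > x))) \<longlongrightarrow> (1 - \<rho>) * (1 / (1 - \<rho>))) at_top"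
    by (intro tendsto_intros lim)
  then have "((\<lambda>x. D.tail x / (inverse (1 - \<rho>) * \<P>(\<omega> in M. Q \<omega> > x))) \<longlongrightarrow> 1) at_top"
    using \<rho> by (simp add: Qx field_simps)
  then have "(\<lambda>x. D.tail x) \<sim>[at_top] (\<lambda>x. inverse (1 - \<rho>) * \<P>(\<omega> in M. Q \<omega> > x))"
    by (rule asymp_equivI')
  then show ?thesis by (simp only: R \<rho>_def)
qed

end
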